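(* Let $\Omega \subset \mathbb{R}^d$ be open and non-empty, and let $X \subset \mathbb{R}^d$ be a set such that $\Omega \subset X \subset \overline{\Omega}$. Let $K \in C(X \times X)$. Further, let $T$ be a compact positive operator on $L_2(\Omega)$ such that $T L_2(\Omega) \subset C(X)$ and such that $$(Tu)(x) = \int_\Omega K(x,y)\, u(y)\, dy$$ for all $x \in \Omega$ and $u \in C_c(\Omega)$. Then there exist an orthonormal basis $(e_n)_{n \in \mathbb{N}}$ of $L_2(\Omega)$ and, for all $n \in \mathbb{N}$, a $\lambda_n \in [0,\infty)$ such that $\lambda_n e_n \in C(X)$ and $T e_n = \lambda_n e_n$ for all $n \in \mathbb{N}$. In particular, $e_n \in C(X)$ if $\lambda_n \neq 0$, and $\lambda_n\, e_n \otimes \overline{e_n} \in C(X \times X)$ for all $n \in \mathbb{N}$. Moreover, $$K(x,y) = \sum_{n=1}^\infty \lambda_n\, e_n(x)\, \overline{e_n(y)}$$ for all $x,y \in X$, and the series $\sum \lambda_n\, |e_n \otimes \overline{e_n}|$ converges uniformly on compact subsets of $X \times X$. Finally, $K(x,x) \ge 0$ for all $x \in X$ and $$\sum_{n=1}^\infty \lambda_n = \int_\Omega K(x,x)\, dx$$ (as an equality in $[0,\infty]$). In particular, $T$ is trace class if and only if $\int_\Omega K(x,x)\, dx < \infty$.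
   Context: $\Omega$ is not assumed to be bounded. $L_2(\Omega)$ is the complex Hilbert space of (classes of) square-integrable functions on $\Omega$ with Lebesgue measure; $C(X)$ and $C(X\times X)$ are spaces of complex-valued continuous functions; $C_c(\Omega)$ is the space of continuous functions with compact support in $\Omega$. "Positive" is meant in the Hilbert space sense: $T$ is self-adjoint and $(Tu,u)_{L_2(\Omega)} \ge 0$ for all $u \in L_2(\Omega)$. The inclusion $T L_2(\Omega) \subset C(X)$ means that for every $u \in L_2(\Omega)$ the element $Tu$ has a representative on $\Omega$ which extends to a (necessarily unique) continuous function on $X$; $Tu$ is identified with this continuous function, and likewise $\lambda_n e_n$ (and $e_n$ if $\lambda_n \ne 0$) is identified with its continuous version on $X$. The notation $(f \otimes g)(x,y) = f(x) g(y)$ is used; terms with $\lambda_n = 0$ are interpreted as the zero function on $X \times X$. *)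

theory Defs
  imports "HOL-Analysis.Analysis"
begin

text \<open>
  Elements of \<open>L\<^sub>2(\<Omega>)\<close> are represented by functions on the whole space, of which only the values on
  \<open>\<Omega>\<close> matter; equality in \<open>L\<^sub>2(\<Omega>)\<close> is \<open>ae_eq \<Omega>\<close>. An operator on \<open>L\<^sub>2(\<Omega>)\<close> is a map on
  representatives that respects \<open>ae_eq \<Omega>\<close>.
\<close>

definition L2 :: "(real ^ 'd) set \<Rightarrow> (real ^ 'd \<Rightarrow> complex) set" where
  "L2 \<Omega> = {f \<in> borel_measurable (lebesgue_on \<Omega>). integrable (lebesgue_on \<Omega>) (\<lambda>x. (cmod (f x))\<^sup>2)}"

definition ae_eq :: "(real ^ 'd) set \<Rightarrow> (real ^ 'd \<Rightarrow> complex) \<Rightarrow> (real ^ 'd \<Rightarrow> complex) \<Rightarrow> bool" where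
  "ae_eq \<Omega> f g \<longleftrightarrow> (AE x in lebesgue_on \<Omega>. f x = g x)"

definition L2_inner :: "(real ^ 'd) set \<Rightarrow> (real ^ 'd \<Rightarrow> complex) \<Rightarrow> (real ^ 'd \<Rightarrow> complex) \<Rightarrow> complex" where
  "L2_inner \<Omega> f g = (\<integral>x. f x * cnj (g x) \<partial>lebesgue_on \<Omega>)"

definition L2_norm :: "(real ^ 'd) set \<Rightarrow> (real ^ 'd \<Rightarrow> complex) \<Rightarrow> real" where
  "L2_norm \<Omega> f = sqrt (\<integral>x. (cmod (f x))\<^sup>2 \<partial>lebesgue_on \<Omega>)"

text \<open>The indexing by \<open>nat\<close> is no restriction for non-empty open \<open>\<Omega>\<close>, since \<open>L\<^sub>2(\<Omega>)\<close> is then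
  separable and infinite-dimensional (\<open>real ^ 'd\<close> has dimension at least 1).\<close>

definition orthonormal_basis :: "(real ^ 'd) set \<Rightarrow> (nat \<Rightarrow> real ^ 'd \<Rightarrow> complex) \<Rightarrow> bool" where
  "orthonormal_basis \<Omega> e \<longleftrightarrow>
     (\<forall>n. e n \<in> L2 \<Omega>) \<and>
     (\<forall>m n. L2_inner \<Omega> (e m) (e n) = (if m = n then 1 else 0)) \<and>
     (\<forall>u\<in>L2 \<Omega>. \<forall>\<epsilon>>0. \<exists>N (c :: nat \<Rightarrow> complex).
        L2_norm \<Omega> (\<lambda>x. u x - (\<Sum>n<N. c n * e n x)) < \<epsilon>)"

definition L2_linear :: "(real ^ 'd) set \<Rightarrow> ((real ^ 'd \<Rightarrow> complex) \<Rightarrow> (real ^ 'd \<Rightarrow> complex)) \<Rightarrow> bool" where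
  "L2_linear \<Omega> T \<longleftrightarrow>
     (\<forall>u\<in>L2 \<Omega>. T u \<in> L2 \<Omega>) \<and>
     (\<forall>u\<in>L2 \<Omega>. \<forall>v\<in>L2 \<Omega>. ae_eq \<Omega> u v \<longrightarrow> ae_eq \<Omega> (T u) (T v)) \<and>
     (\<forall>u\<in>L2 \<Omega>. \<forall>v\<in>L2 \<Omega>. ae_eq \<Omega> (T (\<lambda>x. u x + v x)) (\<lambda>x. T u x + T v x)) \<and>
     (\<forall>(c :: complex). \<forall>u\<in>L2 \<Omega>. ae_eq \<Omega> (T (\<lambda>x. c * u x)) (\<lambda>x. c * T u x))"

definition L2_bounded_operator :: "(real ^ 'd) set \<Rightarrow> ((real ^ 'd \<Rightarrow> complex) \<Rightarrow> (real ^ 'd \<Rightarrow> complex)) \<Rightarrow> bool" where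
  "L2_bounded_operator \<Omega> T \<longleftrightarrow>
     L2_linear \<Omega> T \<and> (\<exists>B. \<forall>u\<in>L2 \<Omega>. L2_norm \<Omega> (T u) \<le> B * L2_norm \<Omega> u)"

definition L2_compact_operator :: "(real ^ 'd) set \<Rightarrow> ((real ^ 'd \<Rightarrow> complex) \<Rightarrow> (real ^ 'd \<Rightarrow> complex)) \<Rightarrow> bool" where
  "L2_compact_operator \<Omega> T \<longleftrightarrow>
     L2_linear \<Omega> T \<and>
     (\<forall>u :: nat \<Rightarrow> real ^ 'd \<Rightarrow> complex.
        (\<forall>n. u n \<in> L2 \<Omega>) \<and> bounded (range (\<lambda>n. L2_norm \<Omega> (u n))) \<longrightarrow>
        (\<exists>r v. strict_mono r \<and> v \<in> L2 \<Omega> \<and>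
           (\<lambda>n. L2_norm \<Omega> (\<lambda>x. T (u (r n)) x - v x)) \<longlonglongrightarrow> 0))"

definition L2_positive_operator :: "(real ^ 'd) set \<Rightarrow> ((real ^ 'd \<Rightarrow> complex) \<Rightarrow> (real ^ 'd \<Rightarrow> complex)) \<Rightarrow> bool" where
  "L2_positive_operator \<Omega> T \<longleftrightarrow>
     L2_bounded_operator \<Omega> T \<and>
     (\<forall>u\<in>L2 \<Omega>. \<forall>v\<in>L2 \<Omega>. L2_inner \<Omega> (T u) v = L2_inner \<Omega> u (T v)) \<and>
     (\<forall>u\<in>L2 \<Omega>. L2_inner \<Omega> (T u) u \<in> \<real>\<^sub>\<ge>\<^sub>0)"

text \<open>\<open>A = |T|\<close>, the positive square root of \<open>T\<^sup>*T\<close>: the last clause says \<open>A\<^sup>2 = T\<^sup>*T\<close>, tested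
  against all \<open>v\<close>.\<close>

definition L2_abs_operator :: "(real ^ 'd) set \<Rightarrow> ((real ^ 'd \<Rightarrow> complex) \<Rightarrow> (real ^ 'd \<Rightarrow> complex)) \<Rightarrow>
    ((real ^ 'd \<Rightarrow> complex) \<Rightarrow> (real ^ 'd \<Rightarrow> complex)) \<Rightarrow> bool" where
  "L2_abs_operator \<Omega> T A \<longleftrightarrow>
     L2_positive_operator \<Omega> A \<and>
     (\<forall>u\<in>L2 \<Omega>. \<forall>v\<in>L2 \<Omega>. L2_inner \<Omega> (A (A u)) v = L2_inner \<Omega> (T u) (T v))"

text \<open>\<open>tr |T| < \<infinity>\<close>; the trace of a positive operator does not depend on the orthonormal basis.\<close>

definition L2_trace_class :: "(real ^ 'd) set \<Rightarrow> ((real ^ 'd \<Rightarrow> complex) \<Rightarrow> (real ^ 'd \<Rightarrow> complex)) \<Rightarrow> bool" where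
  "L2_trace_class \<Omega> T \<longleftrightarrow>
     L2_bounded_operator \<Omega> T \<and>
     (\<exists>A f. L2_abs_operator \<Omega> T A \<and> orthonormal_basis \<Omega> f \<and>
        summable (\<lambda>n. Re (L2_inner \<Omega> (A (f n)) (f n))))"

text \<open>\<open>g\<close> is the continuous function on \<open>X\<close> with which the element \<open>f\<close> of \<open>L\<^sub>2(\<Omega>)\<close> is identified.
  For \<open>\<Omega>\<close> open and \<open>\<Omega> \<subseteq> X \<subseteq> closure \<Omega>\<close> it is unique on \<open>X\<close>.\<close>

definition continuous_version ::
  "(real ^ 'd) set \<Rightarrow> (real ^ 'd) set \<Rightarrow> (real ^ 'd \<Rightarrow> complex) \<Rightarrow> (real ^ 'd \<Rightarrow> complex) \<Rightarrow> bool" where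
  "continuous_version \<Omega> X f g \<longleftrightarrow> continuous_on X g \<and> ae_eq \<Omega> f g"

definition C_c :: "(real ^ 'd) set \<Rightarrow> (real ^ 'd \<Rightarrow> complex) set" where
  "C_c \<Omega> = {u. continuous_on \<Omega> u \<and>
     compact (closure {x\<in>\<Omega>. u x \<noteq> 0}) \<and> closure {x\<in>\<Omega>. u x \<noteq> 0} \<subseteq> \<Omega>}"

end

theory Submission
  imports Defs
begin

text \<open>
  A maximal orthonormal set of eigenfunctions of \<open>T\<close> exists by Zorn's lemma. It is total, since
  compactness yields an eigenfunction in any nonzero orthogonal complement, and completeness of
  \<open>L\<^sub>2(\<Omega>)\<close> makes it a basis \<open>e\<^sub>n\<close> with eigenvalues \<open>\<lambda>\<^sub>n\<close>. For \<open>x, y \<in> X\<close> take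
  mollifiers \<open>w\<^sub>j\<close>, \<open>u\<^sub>k\<close> in \<open>C\<^sub>c(\<Omega>)\<close> concentrating at \<open>x\<close> and \<open>y\<close>. Then \<open>(T u\<^sub>k, w\<^sub>j)\<close> tends to
  \<open>K(x, y)\<close> jointly in \<open>k, j\<close>, and it equals \<open>\<Sum>\<^sub>n \<lambda>\<^sub>n (u\<^sub>k, e\<^sub>n) (e\<^sub>n, w\<^sub>j)\<close>. The sequences
  \<open>\<surd>\<lambda>\<^sub>n (u\<^sub>k, e\<^sub>n)\<close> are bounded in \<open>\<ell>\<^sub>2\<close> by \<open>(T u\<^sub>k, u\<^sub>k)\<close>, which converges to \<open>K(y, y)\<close>, and they
  converge coordinatewise, hence weakly in \<open>\<ell>\<^sub>2\<close>; so the limits \<open>k \<rightarrow> \<infinity>\<close> and then \<open>j \<rightarrow> \<infinity>\<close> give the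
  series for \<open>K(x, y)\<close>. On the diagonal all terms are nonnegative and Dini's theorem gives uniform
  convergence on compact sets, which dominates the off-diagonal series.
\<close>

section \<open>The semi-inner product space of square-integrable functions\<close>

text \<open>The kernel formula is available only for functions in \<open>C_c \<Omega>\<close> and
  only at points of \<open>\<Omega>\<close>, while \<open>K (x, y)\<close> is wanted on all of
  \<open>X\<close>, boundary points included. So values of \<open>K\<close> are reached only through
  inner products \<open>(T u, w)\<close>. The obstacle is the limit inside the series: mollifiers
  concentrating at a point have unbounded \<open>L2\<close> norms, so their coefficients carry no
  uniform bound. Splitting each eigenvalue as \<open>sqrt (lam n) * sqrt (lam n)\<close>, one factor
  per mollifier, cures this: the weighted coefficients are controlled by the quadratic form of
  \<open>T\<close>, which does converge. Weak convergence lets one factor move at a time, hence the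
  iterated limit; the joint estimate on \<open>(T u, w)\<close> identifies it as
  \<open>K (x, y)\<close>. Functions are representatives, so \<open>L2_norm\<close> is only a
  seminorm and equality of classes is tested by inner products. Symmetry moves \<open>T\<close> to
  the other argument, so \<open>T\<close> is never applied to an infinite series. Eigenfunctions
  with nonzero eigenvalue are replaced by continuous versions before point values are taken; point
  values of the others occur only with a zero factor.\<close>

lemma complex_discriminant:
  fixes a d :: real and b :: complex
  assumes nn: "\<And>c. 0 \<le> a - 2 * Re (c * b) + (cmod c)\<^sup>2 * d" and d: "0 \<le> d"
  shows "(cmod b)\<^sup>2 \<le> a * d"
proof (cases "d = 0")
  case True
  have "b = 0"
  proof (rule ccontr)
    assume "b \<noteq> 0"
    then have pos: "(cmod b)\<^sup>2 > 0" by simp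
    \<comment> \<open>With \<open>d = 0\<close> the expression is affine in \<open>c\<close>; this
      \<open>t\<close> makes it equal to \<open>a - (a + 1) = -1\<close> at
      \<open>c = t * cnj b\<close>.\<close>
    define t where "t = (a + 1) / (2 * (cmod b)\<^sup>2)"
    have "Re (of_real t * cnj b * b) = t * (cmod b)\<^sup>2"
      unfolding cmod_power2 by (simp add: power2_eq_square algebra_simps)
    then have "0 \<le> a - 2 * (t * (cmod b)\<^sup>2)"
      using nn[of "of_real t * cnj b"] True by simp
    moreover have "2 * (t * (cmod b)\<^sup>2) = a + 1" using pos by (simp add: t_def)
    ultimately show False by simp
  qed
  then show ?thesis using True by simp
next
  case False
  then have d0: "d > 0" using d by simp
  \<comment> \<open>The quadratic is smallest at \<open>c = cnj b / d\<close>; the two terms in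
    \<open>c\<close> are evaluated there.\<close>
  have 1: "Re (cnj b / of_real d * b) = (cmod b)\<^sup>2 / d"
    unfolding cmod_power2 by (simp add: power2_eq_square add_divide_distrib)
  have 2: "(cmod (cnj b / of_real d))\<^sup>2 * d = (cmod b)\<^sup>2 / d"
    using d0 by (simp add: norm_divide power_divide power2_eq_square)
  have "0 \<le> a - (cmod b)\<^sup>2 / d" using nn[of "cnj b / of_real d"] unfolding 1 2 by simp
  then show ?thesis using d0 by (simp add: field_simps)
qed

lemma L2_I:
  "u \<in> borel_measurable (lebesgue_on \<Omega>) \<Longrightarrow> integrable (lebesgue_on \<Omega>) (\<lambda>x. (cmod (u x))\<^sup>2) \<Longrightarrow> u \<in> L2 \<Omega>"
  by (simp add: L2_def)

lemma L2_measurable [measurable_dest]: "u \<in> L2 \<Omega> \<Longrightarrow> u \<in> borel_measurable (lebesgue_on \<Omega>)"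
  by (simp add: L2_def)

lemma L2_integrable_square: "u \<in> L2 \<Omega> \<Longrightarrow> integrable (lebesgue_on \<Omega>) (\<lambda>x. (cmod (u x))\<^sup>2)"
  by (simp add: L2_def)

lemma borel_measurable_cnj [measurable (raw)]:
  "f \<in> borel_measurable M \<Longrightarrow> (\<lambda>x. cnj (f x)) \<in> borel_measurable M"
  by (rule borel_measurable_continuous_on[OF continuous_on_cnj[OF continuous_on_id]])

lemma integrable_L2_mult:
  assumes [measurable]: "u \<in> L2 \<Omega>" "v \<in> L2 \<Omega>"
  shows "integrable (lebesgue_on \<Omega>) (\<lambda>x. u x * cnj (v x))"
proof (rule Bochner_Integration.integrable_bound)
  show "integrable (lebesgue_on \<Omega>) (\<lambda>x. (cmod (u x))\<^sup>2 + (cmod (v x))\<^sup>2)"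
    using assms by (intro Bochner_Integration.integrable_add L2_integrable_square)
  have "cmod (u x) * cmod (v x) \<le> (cmod (u x))\<^sup>2 + (cmod (v x))\<^sup>2" for x
    using sum_squares_bound[of "cmod (u x)" "cmod (v x)"]
      mult_nonneg_nonneg[OF norm_ge_zero norm_ge_zero, of "u x" "v x"] by linarith
  then show "AE x in lebesgue_on \<Omega>. norm (u x * cnj (v x)) \<le> norm ((cmod (u x))\<^sup>2 + (cmod (v x))\<^sup>2)"
    by (simp add: norm_mult)
qed measurable

lemma L2_zero [simp]: "(\<lambda>x. 0) \<in> L2 \<Omega>"
  by (intro L2_I) auto

lemma L2_add:
  assumes [measurable]: "u \<in> L2 \<Omega>" "v \<in> L2 \<Omega>"
  shows "(\<lambda>x. u x + v x) \<in> L2 \<Omega>"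
proof (rule L2_I)
  show "integrable (lebesgue_on \<Omega>) (\<lambda>x. (cmod (u x + v x))\<^sup>2)"
  proof (rule Bochner_Integration.integrable_bound)
    show "integrable (lebesgue_on \<Omega>) (\<lambda>x. 2 * (cmod (u x))\<^sup>2 + 2 * (cmod (v x))\<^sup>2)"
      using assms
      by (intro Bochner_Integration.integrable_add integrable_mult_right L2_integrable_square)
    have "(cmod (u x + v x))\<^sup>2 \<le> 2 * (cmod (u x))\<^sup>2 + 2 * (cmod (v x))\<^sup>2" for x
    proof -
      have "(cmod (u x + v x))\<^sup>2 \<le> (cmod (u x) + cmod (v x))\<^sup>2"
        by (intro power_mono norm_triangle_ineq) auto
      also have "\<dots> \<le> 2 * (cmod (u x))\<^sup>2 + 2 * (cmod (v x))\<^sup>2"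
        using sum_squares_bound[of "cmod (u x)" "cmod (v x)"] by (simp add: power2_sum)
      finally show ?thesis .
    qed
    then show "AE x in lebesgue_on \<Omega>. norm ((cmod (u x + v x))\<^sup>2)
        \<le> norm (2 * (cmod (u x))\<^sup>2 + 2 * (cmod (v x))\<^sup>2)"
      by simp
  qed measurable
qed measurable

lemma L2_scale:
  assumes [measurable]: "u \<in> L2 \<Omega>"
  shows "(\<lambda>x. c * u x) \<in> L2 \<Omega>"
proof (rule L2_I)
  show "integrable (lebesgue_on \<Omega>) (\<lambda>x. (cmod (c * u x))\<^sup>2)"
    using L2_integrable_square[OF assms] by (simp add: norm_mult power_mult_distrib)
qed measurable

lemma L2_diff:
  assumes "u \<in> L2 \<Omega>" "v \<in> L2 \<Omega>"
  shows "(\<lambda>x. u x - v x) \<in> L2 \<Omega>"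
  using L2_add[OF assms(1) L2_scale[OF assms(2), of "-1"]] by simp

lemma L2_sum:
  "(\<And>i. i \<in> I \<Longrightarrow> f i \<in> L2 \<Omega>) \<Longrightarrow> (\<lambda>x. \<Sum>i\<in>I. f i x) \<in> L2 \<Omega>"
  by (induction I rule: infinite_finite_induct) (auto intro: L2_add)

lemma L2_lincomb:
  "(\<And>i. i \<in> I \<Longrightarrow> f i \<in> L2 \<Omega>) \<Longrightarrow> (\<lambda>x. \<Sum>i\<in>I. c i * f i x) \<in> L2 \<Omega>"
  by (intro L2_sum L2_scale)

lemma L2_inner_commute: "L2_inner \<Omega> v u = cnj (L2_inner \<Omega> u v)"
  unfolding L2_inner_def by (simp add: mult.commute flip: Bochner_Integration.integral_cnj)

lemma L2_zero_simps [simp]: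
  "L2_inner \<Omega> (\<lambda>x. 0) u = 0" "L2_inner \<Omega> u (\<lambda>x. 0) = 0" "L2_norm \<Omega> (\<lambda>x. 0) = 0"
  by (simp_all add: L2_inner_def L2_norm_def)

lemma L2_inner_add_left:
  assumes "u \<in> L2 \<Omega>" "v \<in> L2 \<Omega>" "w \<in> L2 \<Omega>"
  shows "L2_inner \<Omega> (\<lambda>x. u x + v x) w = L2_inner \<Omega> u w + L2_inner \<Omega> v w"
  unfolding L2_inner_def
  by (simp add: distrib_right Bochner_Integration.integral_add integrable_L2_mult assms)

lemma L2_inner_scale_left: "L2_inner \<Omega> (\<lambda>x. c * u x) w = c * L2_inner \<Omega> u w"
  unfolding L2_inner_def by (simp add: mult.assoc)

lemma L2_inner_diff_left:
  assumes "u \<in> L2 \<Omega>" "v \<in> L2 \<Omega>" "w \<in> L2 \<Omega>"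
  shows "L2_inner \<Omega> (\<lambda>x. u x - v x) w = L2_inner \<Omega> u w - L2_inner \<Omega> v w"
  unfolding L2_inner_def
  by (simp add: left_diff_distrib Bochner_Integration.integral_diff integrable_L2_mult assms)

lemma L2_inner_scale_right: "L2_inner \<Omega> w (\<lambda>x. c * u x) = cnj c * L2_inner \<Omega> w u"
  unfolding L2_inner_commute[of \<Omega> w] L2_inner_scale_left by simp

lemma L2_inner_diff_right:
  assumes "u \<in> L2 \<Omega>" "v \<in> L2 \<Omega>" "w \<in> L2 \<Omega>"
  shows "L2_inner \<Omega> w (\<lambda>x. u x - v x) = L2_inner \<Omega> w u - L2_inner \<Omega> w v"
  unfolding L2_inner_commute[of \<Omega> w] L2_inner_diff_left[OF assms] by simp

lemma L2_inner_lincomb_left: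
  assumes "\<And>i. i \<in> I \<Longrightarrow> f i \<in> L2 \<Omega>" "w \<in> L2 \<Omega>"
  shows "L2_inner \<Omega> (\<lambda>x. \<Sum>i\<in>I. c i * f i x) w = (\<Sum>i\<in>I. c i * L2_inner \<Omega> (f i) w)"
  using assms(1)
proof (induction I rule: infinite_finite_induct)
  case (insert i I)
  then show ?case
    by (simp add: L2_inner_add_left L2_inner_scale_left L2_lincomb L2_scale assms(2))
qed (simp_all add: L2_inner_def)

lemma L2_norm_nonneg [simp]: "0 \<le> L2_norm \<Omega> u"
  by (simp add: L2_norm_def)

lemma L2_norm_square: "(L2_norm \<Omega> u)\<^sup>2 = (\<integral>x. (cmod (u x))\<^sup>2 \<partial>lebesgue_on \<Omega>)"
  by (simp add: L2_norm_def)

lemma L2_inner_self: "L2_inner \<Omega> u u = of_real ((L2_norm \<Omega> u)\<^sup>2)"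
  unfolding L2_inner_def L2_norm_square complex_norm_square[symmetric] of_real_power[symmetric]
  by (rule integral_complex_of_real)

lemma L2_norm_scale: "L2_norm \<Omega> (\<lambda>x. c * u x) = cmod c * L2_norm \<Omega> u"
  by (simp add: L2_norm_def norm_mult power_mult_distrib real_sqrt_mult)

lemma L2_norm_minus: "L2_norm \<Omega> (\<lambda>x. u x - v x) = L2_norm \<Omega> (\<lambda>x. v x - u x)"
  by (simp add: L2_norm_def norm_minus_commute)

text \<open>Read as a quadratic in \<open>c\<close>, this yields Cauchy-Schwarz; with
  \<open>c = 1\<close> it yields the triangle inequality and the distance to a linear
  combination.\<close>

lemma L2_norm_diff_scale_square:
  assumes "u \<in> L2 \<Omega>" "v \<in> L2 \<Omega>"
  shows "(L2_norm \<Omega> (\<lambda>x. u x - c * v x))\<^sup>2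
    = (L2_norm \<Omega> u)\<^sup>2 - 2 * Re (c * L2_inner \<Omega> v u) + (cmod c)\<^sup>2 * (L2_norm \<Omega> v)\<^sup>2"
proof -
  have cv: "(\<lambda>x. c * v x) \<in> L2 \<Omega>" using assms(2) by (rule L2_scale)
  have "L2_inner \<Omega> (\<lambda>x. u x - c * v x) (\<lambda>x. u x - c * v x)
    = L2_inner \<Omega> u u - c * L2_inner \<Omega> v u - (cnj c * L2_inner \<Omega> u v - c * (cnj c * L2_inner \<Omega> v v))"
    using assms cv L2_diff[OF assms(1) cv]
    by (simp add: L2_inner_diff_left L2_inner_diff_right L2_inner_scale_left L2_inner_scale_right
        algebra_simps)
  also have "cnj c * L2_inner \<Omega> u v = cnj (c * L2_inner \<Omega> v u)"
    by (simp add: L2_inner_commute[of \<Omega> u v])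
  also have "c * (cnj c * L2_inner \<Omega> v v) = of_real ((cmod c)\<^sup>2 * (L2_norm \<Omega> v)\<^sup>2)"
    by (simp add: L2_inner_self complex_norm_square flip: of_real_power)
  finally have eq: "Re (L2_inner \<Omega> (\<lambda>x. u x - c * v x) (\<lambda>x. u x - c * v x))
    = Re (of_real ((L2_norm \<Omega> u)\<^sup>2) - c * L2_inner \<Omega> v u
        - (cnj (c * L2_inner \<Omega> v u) - of_real ((cmod c)\<^sup>2 * (L2_norm \<Omega> v)\<^sup>2)))"
    by (simp add: L2_inner_self)
  show ?thesis using eq unfolding L2_inner_self minus_complex.sel cnj.sel Re_complex_of_real
    by simp
qed

text \<open>The squared norm of \<open>v - c * u\<close> is a nonnegative quadratic in
  \<open>c\<close>, so its discriminant is bounded. The degenerate case of a vanishing leading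
  coefficient is part of \<open>complex_discriminant\<close>, which matters because
  \<open>L2_norm\<close> is only a seminorm.\<close>

lemma L2_Cauchy_Schwarz:
  assumes "u \<in> L2 \<Omega>" "v \<in> L2 \<Omega>"
  shows "cmod (L2_inner \<Omega> u v) \<le> L2_norm \<Omega> u * L2_norm \<Omega> v"
proof -
  have "0 \<le> (L2_norm \<Omega> v)\<^sup>2 - 2 * Re (c * L2_inner \<Omega> u v) + (cmod c)\<^sup>2 * (L2_norm \<Omega> u)\<^sup>2" for c
    using zero_le_power2[of "L2_norm \<Omega> (\<lambda>x. v x - c * u x)"]
    unfolding L2_norm_diff_scale_square[OF assms(2,1)] .
  then have "(cmod (L2_inner \<Omega> u v))\<^sup>2 \<le> (L2_norm \<Omega> v)\<^sup>2 * (L2_norm \<Omega> u)\<^sup>2"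
    by (rule complex_discriminant) simp
  also have "\<dots> = (L2_norm \<Omega> u * L2_norm \<Omega> v)\<^sup>2"
    by (simp only: power_mult_distrib mult.commute)
  finally show ?thesis
    by (rule power2_le_imp_le) simp
qed

lemma L2_norm_triangle_diff:
  assumes "u \<in> L2 \<Omega>" "v \<in> L2 \<Omega>"
  shows "L2_norm \<Omega> (\<lambda>x. u x - v x) \<le> L2_norm \<Omega> u + L2_norm \<Omega> v"
proof (rule power2_le_imp_le)
  have "- Re (L2_inner \<Omega> v u) \<le> cmod (L2_inner \<Omega> v u)"
    using abs_Re_le_cmod[of "L2_inner \<Omega> v u"] by linarith
  also have "\<dots> \<le> L2_norm \<Omega> v * L2_norm \<Omega> u"
    by (rule L2_Cauchy_Schwarz[OF assms(2,1)])
  finally have CS: "- Re (L2_inner \<Omega> v u) \<le> L2_norm \<Omega> v * L2_norm \<Omega> u" .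
  have "(L2_norm \<Omega> (\<lambda>x. u x - v x))\<^sup>2
      = (L2_norm \<Omega> u)\<^sup>2 - 2 * Re (L2_inner \<Omega> v u) + (L2_norm \<Omega> v)\<^sup>2"
    using L2_norm_diff_scale_square[OF assms, of 1] by simp
  also have "\<dots> \<le> (L2_norm \<Omega> u)\<^sup>2 + 2 * (L2_norm \<Omega> v * L2_norm \<Omega> u) + (L2_norm \<Omega> v)\<^sup>2"
    using CS by linarith
  also have "\<dots> = (L2_norm \<Omega> u + L2_norm \<Omega> v)\<^sup>2"
    by (simp add: power2_sum)
  finally show "(L2_norm \<Omega> (\<lambda>x. u x - v x))\<^sup>2 \<le> (L2_norm \<Omega> u + L2_norm \<Omega> v)\<^sup>2" .
qed simp

lemma L2_norm_triangle_diff3: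
  assumes "u \<in> L2 \<Omega>" "v \<in> L2 \<Omega>" "w \<in> L2 \<Omega>"
  shows "L2_norm \<Omega> (\<lambda>x. u x - v x) \<le> L2_norm \<Omega> (\<lambda>x. u x - w x) + L2_norm \<Omega> (\<lambda>x. w x - v x)"
  using L2_norm_triangle_diff[OF L2_diff[OF assms(1,3)] L2_diff[OF assms(2,3)]]
  by (simp add: L2_norm_minus[of \<Omega> w v])

lemma L2_norm_eq_0_iff:
  assumes "u \<in> L2 \<Omega>"
  shows "L2_norm \<Omega> u = 0 \<longleftrightarrow> (AE x in lebesgue_on \<Omega>. u x = 0)"
  using integral_nonneg_eq_0_iff_AE[OF L2_integrable_square[OF assms]] by (simp add: L2_norm_def)

lemma ae_eq_iff_L2_norm:
  assumes "u \<in> L2 \<Omega>" "v \<in> L2 \<Omega>"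
  shows "ae_eq \<Omega> u v \<longleftrightarrow> L2_norm \<Omega> (\<lambda>x. u x - v x) = 0"
  using L2_norm_eq_0_iff[OF L2_diff[OF assms]] by (simp add: ae_eq_def)

text \<open>Turns equality of classes into equality of scalars, which is stable under weak limits.
  For the converse the test function is the difference itself.\<close>

lemma ae_eq_iff_inner:
  assumes "u \<in> L2 \<Omega>" "v \<in> L2 \<Omega>"
  shows "ae_eq \<Omega> u v \<longleftrightarrow> (\<forall>w\<in>L2 \<Omega>. L2_inner \<Omega> u w = L2_inner \<Omega> v w)"
proof
  assume "ae_eq \<Omega> u v"
  then show "\<forall>w\<in>L2 \<Omega>. L2_inner \<Omega> u w = L2_inner \<Omega> v w"
    using L2_Cauchy_Schwarz[OF L2_diff[OF assms]] L2_inner_diff_left[OF assms]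
    by (auto simp: ae_eq_iff_L2_norm[OF assms])
next
  assume "\<forall>w\<in>L2 \<Omega>. L2_inner \<Omega> u w = L2_inner \<Omega> v w"
  then have "L2_inner \<Omega> (\<lambda>x. u x - v x) (\<lambda>x. u x - v x) = 0"
    using L2_inner_diff_left[OF assms L2_diff[OF assms]] L2_diff[OF assms] by simp
  then show "ae_eq \<Omega> u v"
    by (simp add: ae_eq_iff_L2_norm[OF assms] L2_inner_self)
qed

lemma L2_inner_cong_ae:
  assumes "u \<in> L2 \<Omega>" "u' \<in> L2 \<Omega>" "ae_eq \<Omega> u u'" "w \<in> L2 \<Omega>"
  shows "L2_inner \<Omega> u w = L2_inner \<Omega> u' w" "L2_inner \<Omega> w u = L2_inner \<Omega> w u'"
proof -
  show eq: "L2_inner \<Omega> u w = L2_inner \<Omega> u' w"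
    using assms ae_eq_iff_inner[OF assms(1,2)] by blast
  show "L2_inner \<Omega> w u = L2_inner \<Omega> w u'"
    unfolding L2_inner_commute[of \<Omega> w u] L2_inner_commute[of \<Omega> w u'] eq ..
qed

lemma L2_inner_tendsto_left:
  assumes "\<And>n. u n \<in> L2 \<Omega>" "v \<in> L2 \<Omega>" "w \<in> L2 \<Omega>"
    and lim: "(\<lambda>n. L2_norm \<Omega> (\<lambda>x. u n x - v x)) \<longlonglongrightarrow> 0"
  shows "(\<lambda>n. L2_inner \<Omega> (u n) w) \<longlonglongrightarrow> L2_inner \<Omega> v w"
proof -
  have bound: "norm (L2_inner \<Omega> (u n) w - L2_inner \<Omega> v w)
      \<le> L2_norm \<Omega> (\<lambda>x. u n x - v x) * L2_norm \<Omega> w" for n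
    using L2_Cauchy_Schwarz[OF L2_diff[OF assms(1,2)] assms(3)]
    by (simp add: L2_inner_diff_left[OF assms(1,2,3)])
  have "(\<lambda>n. L2_norm \<Omega> (\<lambda>x. u n x - v x) * L2_norm \<Omega> w) \<longlonglongrightarrow> 0"
    using tendsto_mult_right[OF lim, of "L2_norm \<Omega> w"] by simp
  then have "(\<lambda>n. L2_inner \<Omega> (u n) w - L2_inner \<Omega> v w) \<longlonglongrightarrow> 0"
    by (rule Lim_null_comparison[rotated]) (simp add: bound)
  then show ?thesis
    by (rule LIM_zero_cancel)
qed

section \<open>Orthonormal families and completeness\<close>

text \<open>The free index set covers both sequences and, with \<open>f = (\<lambda>s. s)\<close>,
  sets of functions as needed for Zorn's lemma. Such a set holds at most one representative of each
  class, since two distinct a.e. equal members would have inner product 1 instead of 0.\<close>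

definition L2_orthonormal :: "(real ^ 'd) set \<Rightarrow> 'i set \<Rightarrow> ('i \<Rightarrow> real ^ 'd \<Rightarrow> complex) \<Rightarrow> bool" where
  "L2_orthonormal \<Omega> I f \<longleftrightarrow>
     (\<forall>i\<in>I. f i \<in> L2 \<Omega>) \<and> (\<forall>i\<in>I. \<forall>j\<in>I. L2_inner \<Omega> (f i) (f j) = (if i = j then 1 else 0))"

lemma L2_orthonormal_subset: "L2_orthonormal \<Omega> I f \<Longrightarrow> J \<subseteq> I \<Longrightarrow> L2_orthonormal \<Omega> J f"
  unfolding L2_orthonormal_def by blast

lemma L2_orthonormalD:
  assumes "L2_orthonormal \<Omega> I f"
  shows "i \<in> I \<Longrightarrow> f i \<in> L2 \<Omega>"
    and "i \<in> I \<Longrightarrow> j \<in> I \<Longrightarrow> L2_inner \<Omega> (f i) (f j) = (if i = j then 1 else 0)"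
  using assms unfolding L2_orthonormal_def by blast+

text \<open>Pythagoras with arbitrary coefficients: the last sum is the penalty for deviating from
  the Fourier coefficients. Fourier coefficients give Bessel, general \<open>c\<close> gives best
  approximation, and \<open>u = 0\<close> gives the norm of a linear combination.\<close>

lemma L2_norm_diff_lincomb_square:
  assumes f: "L2_orthonormal \<Omega> I f" and fin: "finite I" and u: "u \<in> L2 \<Omega>"
  shows "(L2_norm \<Omega> (\<lambda>x. u x - (\<Sum>i\<in>I. c i * f i x)))\<^sup>2
    = (L2_norm \<Omega> u)\<^sup>2 - (\<Sum>i\<in>I. (cmod (L2_inner \<Omega> u (f i)))\<^sup>2)
      + (\<Sum>i\<in>I. (cmod (c i - L2_inner \<Omega> u (f i)))\<^sup>2)"
proof -
  let ?a = "\<lambda>i. L2_inner \<Omega> u (f i)"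
  let ?P = "\<lambda>x. \<Sum>i\<in>I. c i * f i x"
  note fL = L2_orthonormalD(1)[OF f]
  have P: "?P \<in> L2 \<Omega>" using fL by (rule L2_lincomb)
  have Pf: "L2_inner \<Omega> ?P (f j) = c j" if "j \<in> I" for j
  proof -
    have "L2_inner \<Omega> ?P (f j) = (\<Sum>i\<in>I. c i * L2_inner \<Omega> (f i) (f j))"
      using fL that by (intro L2_inner_lincomb_left) auto
    also have "\<dots> = (\<Sum>i\<in>I. if i = j then c i else 0)"
      using that L2_orthonormalD(2)[OF f] by (intro sum.cong) auto
    finally show ?thesis using that fin by simp
  qed
  have "L2_inner \<Omega> ?P ?P = (\<Sum>i\<in>I. c i * L2_inner \<Omega> (f i) ?P)"
    using fL P by (intro L2_inner_lincomb_left) auto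
  also have "\<dots> = (\<Sum>i\<in>I. c i * cnj (c i))"
    by (intro sum.cong) (simp_all add: L2_inner_commute[of \<Omega> _ ?P] Pf)
  also have "\<dots> = of_real (\<Sum>i\<in>I. (cmod (c i))\<^sup>2)"
    by (simp flip: complex_norm_square)
  finally have PP: "(L2_norm \<Omega> ?P)\<^sup>2 = (\<Sum>i\<in>I. (cmod (c i))\<^sup>2)"
    unfolding L2_inner_self of_real_eq_iff .
  have "L2_inner \<Omega> ?P u = (\<Sum>i\<in>I. c i * L2_inner \<Omega> (f i) u)"
    using fL u by (intro L2_inner_lincomb_left) auto
  also have "\<dots> = (\<Sum>i\<in>I. c i * cnj (?a i))"
    by (simp add: L2_inner_commute[of \<Omega> _ u])
  finally have Pu: "L2_inner \<Omega> ?P u = (\<Sum>i\<in>I. c i * cnj (?a i))" .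
  have sq: "(cmod (a - b))\<^sup>2 = (cmod a)\<^sup>2 - 2 * Re (a * cnj b) + (cmod b)\<^sup>2" for a b :: complex
    unfolding cmod_power2 by (simp add: power2_eq_square algebra_simps)
  have "(L2_norm \<Omega> (\<lambda>x. u x - ?P x))\<^sup>2
      = (L2_norm \<Omega> u)\<^sup>2 - 2 * Re (L2_inner \<Omega> ?P u) + (L2_norm \<Omega> ?P)\<^sup>2"
    using L2_norm_diff_scale_square[OF u P, of 1] by simp
  also have "\<dots> = (L2_norm \<Omega> u)\<^sup>2
      - (\<Sum>i\<in>I. (cmod (?a i))\<^sup>2) + (\<Sum>i\<in>I. (cmod (c i - ?a i))\<^sup>2)"
    unfolding Pu PP sq Re_sum sum.distrib sum_subtractf sum_distrib_left by simp
  finally show ?thesis .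
qed

lemma L2_Bessel:
  assumes "L2_orthonormal \<Omega> I f" "finite I" "u \<in> L2 \<Omega>"
  shows "(\<Sum>i\<in>I. (cmod (L2_inner \<Omega> u (f i)))\<^sup>2) \<le> (L2_norm \<Omega> u)\<^sup>2"
  using zero_le_power2[of "L2_norm \<Omega> (\<lambda>x. u x - (\<Sum>i\<in>I. L2_inner \<Omega> u (f i) * f i x))"]
  unfolding L2_norm_diff_lincomb_square[OF assms] by simp

lemma L2_Bessel_summable:
  fixes f :: "nat \<Rightarrow> real ^ 'd \<Rightarrow> complex"
  assumes f: "L2_orthonormal \<Omega> UNIV f" and u: "u \<in> L2 \<Omega>"
  shows "summable (\<lambda>n. (cmod (L2_inner \<Omega> u (f n)))\<^sup>2)"
  using L2_Bessel[OF L2_orthonormal_subset[OF f] _ u]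
  by (intro bounded_imp_summable[where B = "(L2_norm \<Omega> u)\<^sup>2"]) auto

lemma orthonormal_basis_imp_orthonormal:
  "orthonormal_basis \<Omega> e \<Longrightarrow> L2_orthonormal \<Omega> UNIV e"
  unfolding orthonormal_basis_def L2_orthonormal_def by simp

text \<open>The definition of a basis provides coefficients that depend on
  \<open>\<epsilon>\<close>. The Fourier partial sum of the same length approximates at least as
  well, and longer Fourier sums only reduce the error.\<close>

lemma orthonormal_basis_expansion:
  assumes e: "orthonormal_basis \<Omega> e" and u: "u \<in> L2 \<Omega>"
  shows "(\<lambda>N. L2_norm \<Omega> (\<lambda>x. u x - (\<Sum>n<N. L2_inner \<Omega> u (e n) * e n x))) \<longlonglongrightarrow> 0"
    (is "?r \<longlonglongrightarrow> 0")
proof (rule LIMSEQ_I)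
  fix \<epsilon> :: real assume "\<epsilon> > 0"
  note on = L2_orthonormal_subset[OF orthonormal_basis_imp_orthonormal[OF e]]
  obtain N c where N: "L2_norm \<Omega> (\<lambda>x. u x - (\<Sum>n<N. c n * e n x)) < \<epsilon>"
    using e u \<open>\<epsilon> > 0\<close> unfolding orthonormal_basis_def by blast
  have "?r M < \<epsilon>" if "M \<ge> N" for M
  proof -
    have "(?r M)\<^sup>2 = (L2_norm \<Omega> u)\<^sup>2 - (\<Sum>n<M. (cmod (L2_inner \<Omega> u (e n)))\<^sup>2)"
      using L2_norm_diff_lincomb_square[OF on _ u, of "{..<M}"] by simp
    also have "\<dots> \<le> (L2_norm \<Omega> u)\<^sup>2 - (\<Sum>n<N. (cmod (L2_inner \<Omega> u (e n)))\<^sup>2)"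
      using that by (intro diff_left_mono sum_mono2) auto
    also have "\<dots> \<le> (L2_norm \<Omega> (\<lambda>x. u x - (\<Sum>n<N. c n * e n x)))\<^sup>2"
      using L2_norm_diff_lincomb_square[OF on _ u, of "{..<N}" c] by (simp add: sum_nonneg)
    finally have "?r M \<le> L2_norm \<Omega> (\<lambda>x. u x - (\<Sum>n<N. c n * e n x))"
      by (rule power2_le_imp_le) simp
    then show ?thesis using N by linarith
  qed
  then show "\<exists>N. \<forall>M\<ge>N. norm (?r M - 0) < \<epsilon>" by auto
qed

text \<open>Norm convergence of the Fourier sums of \<open>u\<close> passes to the inner product
  with the fixed \<open>w\<close>.\<close>

lemma orthonormal_basis_Parseval_inner:
  assumes e: "orthonormal_basis \<Omega> e" and u: "u \<in> L2 \<Omega>" and w: "w \<in> L2 \<Omega>"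
  shows "(\<lambda>n. L2_inner \<Omega> u (e n) * L2_inner \<Omega> (e n) w) sums L2_inner \<Omega> u w"
proof -
  note eL = L2_orthonormalD(1)[OF orthonormal_basis_imp_orthonormal[OF e] UNIV_I]
  have "(\<lambda>N. L2_inner \<Omega> (\<lambda>x. \<Sum>n<N. L2_inner \<Omega> u (e n) * e n x) w) \<longlonglongrightarrow> L2_inner \<Omega> u w"
    using orthonormal_basis_expansion[OF e u]
    by (intro L2_inner_tendsto_left L2_lincomb eL u w) (simp add: L2_norm_minus[of \<Omega> _ u])
  moreover have "L2_inner \<Omega> (\<lambda>x. \<Sum>n<N. L2_inner \<Omega> u (e n) * e n x) w
      = (\<Sum>n<N. L2_inner \<Omega> u (e n) * L2_inner \<Omega> (e n) w)" for N
    by (intro L2_inner_lincomb_left eL w)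
  ultimately show ?thesis unfolding sums_def by simp
qed

lemma orthonormal_basis_Parseval:
  assumes e: "orthonormal_basis \<Omega> e" and u: "u \<in> L2 \<Omega>"
  shows "(\<lambda>n. (cmod (L2_inner \<Omega> u (e n)))\<^sup>2) sums (L2_norm \<Omega> u)\<^sup>2"
proof -
  have "(\<lambda>n. complex_of_real ((cmod (L2_inner \<Omega> u (e n)))\<^sup>2)) sums of_real ((L2_norm \<Omega> u)\<^sup>2)"
    using orthonormal_basis_Parseval_inner[OF e u u]
    by (simp add: L2_inner_self L2_inner_commute[of \<Omega> _ u] flip: complex_norm_square)
  then show ?thesis by (simp only: sums_of_real_iff)
qed

section \<open>Completeness of \<open>L2\<close> and the Riesz-Fischer theorem\<close>

lemma nn_integral_L2_norm:
  assumes "u \<in> L2 \<Omega>"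
  shows "(\<integral>\<^sup>+x. ennreal ((cmod (u x))\<^sup>2) \<partial>lebesgue_on \<Omega>) = ennreal ((L2_norm \<Omega> u)\<^sup>2)"
  unfolding L2_norm_square by (rule nn_integral_eq_integral[OF L2_integrable_square[OF assms]]) simp

text \<open>A rapidly Cauchy subsequence converges almost everywhere; Fatou's lemma then transfers
  the Cauchy estimate of the whole sequence to its distance from the pointwise limit.\<close>

lemma L2_complete:
  assumes u: "\<And>n. u n \<in> L2 \<Omega>"
    and Cauchy: "\<And>\<epsilon>. \<epsilon> > 0 \<Longrightarrow> \<exists>N. \<forall>m\<ge>N. \<forall>n\<ge>N. L2_norm \<Omega> (\<lambda>x. u m x - u n x) < \<epsilon>"
  obtains v where "v \<in> L2 \<Omega>" "(\<lambda>n. L2_norm \<Omega> (\<lambda>x. u n x - v x)) \<longlonglongrightarrow> 0"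
proof -
  note [measurable] = u
  have "\<exists>N. \<forall>m\<ge>N. \<forall>n\<ge>N. L2_norm \<Omega> (\<lambda>x. u m x - u n x) < (1/2) ^ k" for k :: nat
    by (rule Cauchy) simp
  then obtain N where N: "\<And>k m n. m \<ge> N k \<Longrightarrow> n \<ge> N k \<Longrightarrow> L2_norm \<Omega> (\<lambda>x. u m x - u n x) < (1/2) ^ k"
    by metis
  \<comment> \<open>Summing the thresholds makes \<open>r\<close> monotone with
    \<open>r k \<ge> N k\<close>; the extra \<open>k\<close> ensures
    \<open>r k \<ge> k\<close>.\<close>
  define r where "r k = k + (\<Sum>i\<le>k. N i)" for k
  have rN: "r k \<ge> N k" for k
    unfolding r_def by (rule trans_le_add2, rule member_le_sum) auto
  have r_mono: "r k \<le> r (Suc k)" for k by (simp add: r_def)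
  have r_ge: "r k \<ge> k" for k by (simp add: r_def)
  define g where "g k x = u (r (Suc k)) x - u (r k) x" for k x
  have gL: "g k \<in> L2 \<Omega>" for k unfolding g_def[abs_def] by (intro L2_diff u)
  note [measurable] = gL
  have g_norm: "(L2_norm \<Omega> (g k))\<^sup>2 \<le> (1/4) ^ k" for k
  proof -
    have "L2_norm \<Omega> (g k) \<le> (1/2) ^ k"
      unfolding g_def[abs_def] using N[of k "r (Suc k)" "r k"] rN[of k] r_mono[of k] by simp
    then have "(L2_norm \<Omega> (g k))\<^sup>2 \<le> ((1/2) ^ k)\<^sup>2" by (intro power_mono) auto
    also have "\<dots> = ((1/2)\<^sup>2) ^ k" by (simp only: mult.commute flip: power_mult)
    also have "\<dots> = (1/4 :: real) ^ k" by (simp add: power2_eq_square)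
    finally show ?thesis .
  qed
  \<comment> \<open>The weight \<open>2 ^ k\<close> leaves the integrals summable, as
    \<open>2 ^ k * (1/4) ^ k = (1/2) ^ k\<close>, yet a finite weighted sum at \<open>x\<close>
    forces \<open>cmod (g k x)\<close> below a geometric sequence of ratio
    \<open>sqrt (1/2)\<close>, so the increments are summable at \<open>x\<close>.\<close>
  have "(\<integral>\<^sup>+x. (\<Sum>k. ennreal (2 ^ k * (cmod (g k x))\<^sup>2)) \<partial>lebesgue_on \<Omega>)
      = (\<Sum>k. \<integral>\<^sup>+x. ennreal (2 ^ k * (cmod (g k x))\<^sup>2) \<partial>lebesgue_on \<Omega>)"
    by (rule nn_integral_suminf) measurable
  also have "\<dots> = (\<Sum>k. ennreal (2 ^ k * (L2_norm \<Omega> (g k))\<^sup>2))"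
    by (intro suminf_cong) (simp add: ennreal_mult nn_integral_cmult nn_integral_L2_norm gL)
  also have "\<dots> \<le> (\<Sum>k. ennreal ((1/2) ^ k))"
  proof (intro suminf_le allI ennreal_leI)
    fix k
    have "2 ^ k * (L2_norm \<Omega> (g k))\<^sup>2 \<le> 2 ^ k * (1/4) ^ k"
      using g_norm[of k] by (intro mult_left_mono) auto
    also have "\<dots> = (1/2 :: real) ^ k" by (simp flip: power_mult_distrib)
    finally show "2 ^ k * (L2_norm \<Omega> (g k))\<^sup>2 \<le> (1/2) ^ k" .
  qed auto
  also have "\<dots> < \<infinity>"
    using summable_geometric[of "1/2::real"] by (simp add: suminf_ennreal2)
  finally have "AE x in lebesgue_on \<Omega>. (\<Sum>k. ennreal (2 ^ k * (cmod (g k x))\<^sup>2)) \<noteq> \<infinity>"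
    by (intro nn_integral_noteq_infinite) auto
  then have AE_conv: "AE x in lebesgue_on \<Omega>. convergent (\<lambda>k. u (r k) x)"
  proof eventually_elim
    case (elim x)
    then have "summable (\<lambda>k. 2 ^ k * (cmod (g k x))\<^sup>2)"
      by (intro summable_suminf_not_top) auto
    then obtain B where B: "\<And>k. norm (2 ^ k * (cmod (g k x))\<^sup>2) \<le> B"
      using bounded_iff[THEN iffD1, OF summable_imp_bounded] by blast
    have "summable (\<lambda>k. sqrt B * sqrt (1/2) ^ k)"
      by (intro summable_mult summable_geometric) (simp add: real_sqrt_divide)
    then have "summable (\<lambda>k. g k x)"
    proof (rule summable_comparison_test')
      fix k :: nat
      have "(cmod (g k x))\<^sup>2 \<le> B * (1/2) ^ k"
        using B[of k] by (simp add: field_simps)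
      then have "cmod (g k x) \<le> sqrt (B * (1/2) ^ k)"
        by (rule real_le_rsqrt)
      then show "norm (g k x) \<le> sqrt B * sqrt (1/2) ^ k"
        by (simp only: real_sqrt_mult real_sqrt_power)
    qed
    then have "convergent (\<lambda>n. (\<Sum>k<n. g k x) + u (r 0) x)"
      by (intro convergent_add convergent_const) (simp add: summable_iff_convergent)
    moreover have "(\<Sum>k<n. g k x) + u (r 0) x = u (r n) x" for n
      unfolding g_def using sum_lessThan_telescope[of "\<lambda>n. u (r n) x" n] by simp
    ultimately show ?case by simp
  qed
  \<comment> \<open>Where the subsequence diverges \<open>lim\<close> is a default value; by
    \<open>AE_conv\<close> this concerns a null set only.\<close>
  define v where "v x = lim (\<lambda>k. u (r k) x)" for x
  have [measurable]: "v \<in> borel_measurable (lebesgue_on \<Omega>)"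
    unfolding v_def[abs_def] by measurable
  \<comment> \<open>Only the second index runs along the subsequence and tends to infinity;
    \<open>n\<close> stays arbitrary, so the full sequence is shown to converge.\<close>
  have bound: "(\<integral>\<^sup>+x. ennreal ((cmod (u n x - v x))\<^sup>2) \<partial>lebesgue_on \<Omega>) \<le> ennreal (\<epsilon>\<^sup>2)"
    if M: "\<forall>m\<ge>M. \<forall>n\<ge>M. L2_norm \<Omega> (\<lambda>x. u m x - u n x) < \<epsilon>" and n: "n \<ge> M" for M n \<epsilon>
  proof -
    have "AE x in lebesgue_on \<Omega>. ennreal ((cmod (u n x - v x))\<^sup>2)
        = liminf (\<lambda>k. ennreal ((cmod (u n x - u (r k) x))\<^sup>2))"
      using AE_conv
    proof eventually_elim
      case (elim x)
      then have "(\<lambda>k. u (r k) x) \<longlonglongrightarrow> v x" unfolding v_def by (simp add: convergent_LIMSEQ_iff)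
      then have "(\<lambda>k. ennreal ((cmod (u n x - u (r k) x))\<^sup>2)) \<longlonglongrightarrow> ennreal ((cmod (u n x - v x))\<^sup>2)"
        by (intro tendsto_intros)
      then show ?case by (rule lim_imp_Liminf[OF sequentially_bot, symmetric])
    qed
    then have "(\<integral>\<^sup>+x. ennreal ((cmod (u n x - v x))\<^sup>2) \<partial>lebesgue_on \<Omega>)
        = (\<integral>\<^sup>+x. liminf (\<lambda>k. ennreal ((cmod (u n x - u (r k) x))\<^sup>2)) \<partial>lebesgue_on \<Omega>)"
      by (rule nn_integral_cong_AE)
    also have "\<dots> \<le> liminf (\<lambda>k. \<integral>\<^sup>+x. ennreal ((cmod (u n x - u (r k) x))\<^sup>2) \<partial>lebesgue_on \<Omega>)"
      by (rule nn_integral_liminf) measurable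
    also have "\<dots> = liminf (\<lambda>k. ennreal ((L2_norm \<Omega> (\<lambda>x. u n x - u (r k) x))\<^sup>2))"
      by (simp add: nn_integral_L2_norm L2_diff u)
    also have "\<dots> \<le> liminf (\<lambda>k. ennreal (\<epsilon>\<^sup>2))"
    proof (rule Liminf_mono, rule eventually_sequentiallyI)
      fix k assume "k \<ge> M"
      then have "L2_norm \<Omega> (\<lambda>x. u n x - u (r k) x) < \<epsilon>"
        using M n r_ge[of k] by simp
      then show "ennreal ((L2_norm \<Omega> (\<lambda>x. u n x - u (r k) x))\<^sup>2) \<le> ennreal (\<epsilon>\<^sup>2)"
        by (intro ennreal_leI power_mono) auto
    qed
    also have "\<dots> = ennreal (\<epsilon>\<^sup>2)" by (simp add: Liminf_const)
    finally show ?thesis .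
  qed
  have diffL: "(\<lambda>x. u n x - v x) \<in> L2 \<Omega>"
    if "\<forall>m\<ge>M. \<forall>n\<ge>M. L2_norm \<Omega> (\<lambda>x. u m x - u n x) < \<epsilon>" "n \<ge> M" for M n \<epsilon>
  proof (rule L2_I)
    show "integrable (lebesgue_on \<Omega>) (\<lambda>x. (cmod (u n x - v x))\<^sup>2)"
      using bound[OF that] by (intro integrableI_nonneg) (auto simp: le_less_trans ennreal_less_top)
  qed measurable
  obtain M where M: "\<forall>m\<ge>M. \<forall>n\<ge>M. L2_norm \<Omega> (\<lambda>x. u m x - u n x) < 1"
    using Cauchy[of 1] by auto
  \<comment> \<open>\<open>v\<close> is recovered as \<open>u M - (u M - v)\<close>.\<close>
  have vL: "v \<in> L2 \<Omega>"
    using L2_diff[OF u[of M] diffL[OF M, of M]] by simp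
  have "(\<lambda>n. L2_norm \<Omega> (\<lambda>x. u n x - v x)) \<longlonglongrightarrow> 0"
  proof (rule LIMSEQ_I)
    fix \<epsilon> :: real assume "\<epsilon> > 0"
    then obtain M where M: "\<forall>m\<ge>M. \<forall>n\<ge>M. L2_norm \<Omega> (\<lambda>x. u m x - u n x) < \<epsilon> / 2"
      using Cauchy[of "\<epsilon> / 2"] by auto
    have "L2_norm \<Omega> (\<lambda>x. u n x - v x) \<le> \<epsilon> / 2" if "n \<ge> M" for n
    proof (rule power2_le_imp_le)
      show "(L2_norm \<Omega> (\<lambda>x. u n x - v x))\<^sup>2 \<le> (\<epsilon> / 2)\<^sup>2"
        using bound[OF M that] unfolding nn_integral_L2_norm[OF L2_diff[OF u vL]]
        by (subst (asm) ennreal_le_iff) auto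
    qed (use \<open>\<epsilon> > 0\<close> in simp)
    then show "\<exists>M. \<forall>n\<ge>M. norm (L2_norm \<Omega> (\<lambda>x. u n x - v x) - 0) < \<epsilon>"
      using \<open>\<epsilon> > 0\<close> by (intro exI[of _ M]) (fastforce intro: le_less_trans)
  qed
  with vL show ?thesis by (rule that)
qed

text \<open>By Pythagoras the squared distance of two partial sums is a block of the summable
  series, so the partial sums are Cauchy.\<close>

lemma L2_Riesz_Fischer:
  fixes f :: "nat \<Rightarrow> real ^ 'd \<Rightarrow> complex"
  assumes f: "L2_orthonormal \<Omega> UNIV f" and c: "summable (\<lambda>n. (cmod (c n))\<^sup>2)"
  obtains v where "v \<in> L2 \<Omega>" "(\<lambda>N. L2_norm \<Omega> (\<lambda>x. (\<Sum>n<N. c n * f n x) - v x)) \<longlonglongrightarrow> 0"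
proof -
  let ?S = "\<lambda>N x. \<Sum>n<N. c n * f n x"
  note fL = L2_orthonormalD(1)[OF f UNIV_I]
  have SL: "?S N \<in> L2 \<Omega>" for N by (intro L2_lincomb fL)
  have dist: "(L2_norm \<Omega> (\<lambda>x. ?S n x - ?S m x))\<^sup>2 = (\<Sum>i\<in>{m..<n}. (cmod (c i))\<^sup>2)" if "m \<le> n" for m n
  proof -
    have "?S n x - ?S m x = - (0 - (\<Sum>i\<in>{m..<n}. c i * f i x))" for x
      using that sum_diff_nat_ivl[of 0 m n "\<lambda>i. c i * f i x"] by (simp add: atLeast0LessThan)
    then have "L2_norm \<Omega> (\<lambda>x. ?S n x - ?S m x)
        = L2_norm \<Omega> (\<lambda>x. 0 - (\<Sum>i\<in>{m..<n}. c i * f i x))"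
      unfolding L2_norm_def by (simp only: norm_minus_cancel)
    then show ?thesis
      using L2_norm_diff_lincomb_square[OF L2_orthonormal_subset[OF f subset_UNIV] _ L2_zero, of "{m..<n}" c]
      by simp
  qed
  have "\<exists>N. \<forall>m\<ge>N. \<forall>n\<ge>N. L2_norm \<Omega> (\<lambda>x. ?S m x - ?S n x) < \<epsilon>" if "\<epsilon> > 0" for \<epsilon>
  proof -
    obtain N where N: "\<And>m n. m \<ge> N \<Longrightarrow> norm (\<Sum>i\<in>{m..<n}. (cmod (c i))\<^sup>2) < \<epsilon>\<^sup>2"
      using c \<open>\<epsilon> > 0\<close> unfolding summable_Cauchy by (metis zero_less_power)
    have *: "L2_norm \<Omega> (\<lambda>x. ?S n x - ?S m x) < \<epsilon>" if "m \<ge> N" "m \<le> n" for m n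
    proof (rule power2_less_imp_less)
      show "(L2_norm \<Omega> (\<lambda>x. ?S n x - ?S m x))\<^sup>2 < \<epsilon>\<^sup>2"
        unfolding dist[OF that(2)] using N[OF that(1), of n] by simp
    qed (use \<open>\<epsilon> > 0\<close> in simp)
    show ?thesis
    proof (intro exI[of _ N] allI impI)
      fix m n assume "m \<ge> N" "n \<ge> N"
      then show "L2_norm \<Omega> (\<lambda>x. ?S m x - ?S n x) < \<epsilon>"
        using *[of n m] *[of m n] L2_norm_minus[of \<Omega> "?S m" "?S n"] by (cases "m \<le> n") auto
    qed
  qed
  from L2_complete[OF SL this] show ?thesis using that by blast
qed

text \<open>Riesz-Fischer produces a \<open>v\<close> with the same Fourier coefficients as
  \<open>u\<close>; totality applied to \<open>u - v\<close> shows that the Fourier sums of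
  \<open>u\<close> converge to \<open>u\<close>.\<close>

lemma total_orthonormal_imp_basis:
  fixes e :: "nat \<Rightarrow> real ^ 'd \<Rightarrow> complex"
  assumes e: "L2_orthonormal \<Omega> UNIV e"
    and total: "\<And>u. u \<in> L2 \<Omega> \<Longrightarrow> (\<And>n. L2_inner \<Omega> u (e n) = 0) \<Longrightarrow> L2_norm \<Omega> u = 0"
  shows "orthonormal_basis \<Omega> e"
  unfolding orthonormal_basis_def
proof (intro conjI allI ballI impI)
  note eL = L2_orthonormalD(1)[OF e UNIV_I]
  fix u and \<epsilon> :: real assume u: "u \<in> L2 \<Omega>" and "\<epsilon> > 0"
  define c where "c n = L2_inner \<Omega> u (e n)" for n
  let ?S = "\<lambda>N x. \<Sum>n<N. c n * e n x"
  have SL: "?S N \<in> L2 \<Omega>" for N by (intro L2_lincomb eL)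
  obtain v where v: "v \<in> L2 \<Omega>" and lim: "(\<lambda>N. L2_norm \<Omega> (\<lambda>x. ?S N x - v x)) \<longlonglongrightarrow> 0"
    using L2_Riesz_Fischer[OF e, of c] L2_Bessel_summable[OF e u] unfolding c_def by blast
  have "L2_inner \<Omega> v (e n) = c n" for n
  proof (rule LIMSEQ_unique)
    show "(\<lambda>N. L2_inner \<Omega> (?S N) (e n)) \<longlonglongrightarrow> L2_inner \<Omega> v (e n)"
      by (rule L2_inner_tendsto_left[OF SL v eL lim])
    have "L2_inner \<Omega> (?S N) (e n) = c n" if "N \<ge> Suc n" for N
    proof -
      have "L2_inner \<Omega> (?S N) (e n) = (\<Sum>i<N. if i = n then c i else 0)"
        using L2_orthonormalD(2)[OF e UNIV_I UNIV_I, of _ n]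
        by (subst L2_inner_lincomb_left[OF eL eL]) (rule sum.cong, auto)
      then show ?thesis using that by simp
    qed
    then show "(\<lambda>N. L2_inner \<Omega> (?S N) (e n)) \<longlonglongrightarrow> c n"
      by (intro tendsto_eventually) (auto simp: eventually_sequentially)
  qed
  then have "L2_norm \<Omega> (\<lambda>x. u x - v x) = 0"
    by (intro total L2_diff u v) (simp add: L2_inner_diff_left[OF u v eL] c_def)
  then have "L2_norm \<Omega> (\<lambda>x. u x - ?S N x) \<le> L2_norm \<Omega> (\<lambda>x. ?S N x - v x)" for N
    using L2_norm_triangle_diff3[OF u SL v, of N] L2_norm_minus[of \<Omega> v "?S N"] by simp
  moreover obtain N where "L2_norm \<Omega> (\<lambda>x. ?S N x - v x) < \<epsilon>"
    using LIMSEQ_D[OF lim \<open>\<epsilon> > 0\<close>] by auto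
  ultimately show "\<exists>N c. L2_norm \<Omega> (\<lambda>x. u x - (\<Sum>n<N. c n * e n x)) < \<epsilon>"
    using le_less_trans by blast
qed (use e in \<open>auto simp: L2_orthonormal_def\<close>)

section \<open>Countable and infinite orthonormal sets\<close>

lemma integrable_lebesgue_on_bounded_support:
  fixes f :: "real ^ 'd \<Rightarrow> 'b::{banach, second_countable_topology}"
  assumes \<Omega>: "\<Omega> \<in> sets lebesgue" and f: "f \<in> borel_measurable (lebesgue_on \<Omega>)"
    and A: "A \<in> sets borel" "bounded A"
    and bound: "\<And>x. x \<in> \<Omega> \<Longrightarrow> norm (f x) \<le> B" and supp: "\<And>x. x \<in> \<Omega> \<Longrightarrow> x \<notin> A \<Longrightarrow> f x = 0"
  shows "integrable (lebesgue_on \<Omega>) f"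
proof (rule integrableI_bounded_set)
  have A': "A \<in> sets lebesgue" using A(1) by simp
  show "\<Omega> \<inter> A \<in> sets (lebesgue_on \<Omega>)"
    using \<Omega> A' by (auto simp: sets_restrict_space)
  have "emeasure (lebesgue_on \<Omega>) (\<Omega> \<inter> A) = emeasure lebesgue (\<Omega> \<inter> A)"
    using \<Omega> by (intro emeasure_restrict_space) auto
  also have "\<dots> \<le> emeasure lebesgue A" using A' by (intro emeasure_mono) auto
  also have "\<dots> = emeasure lborel A" using A(1) by simp
  also have "\<dots> < \<infinity>" by (rule emeasure_bounded_finite[OF A(2)])
  finally show "emeasure (lebesgue_on \<Omega>) (\<Omega> \<inter> A) < \<infinity>" .
qed (use f bound supp in auto)

lemma L2_indicator:
  assumes \<Omega>: "\<Omega> \<in> sets lebesgue" and A: "A \<in> sets borel" "bounded A"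
  shows "(\<lambda>x. indicator A x) \<in> L2 \<Omega>"
proof (rule L2_I)
  have A': "A \<inter> \<Omega> \<in> sets (lebesgue_on \<Omega>)"
    using A(1) by (auto simp: sets_restrict_space)
  show [measurable]: "(indicator A :: _ \<Rightarrow> complex) \<in> borel_measurable (lebesgue_on \<Omega>)"
    using A' by (simp add: borel_measurable_indicator_iff)
  show "integrable (lebesgue_on \<Omega>) (\<lambda>x. (cmod (indicator A x))\<^sup>2)"
  proof (rule integrable_lebesgue_on_bounded_support[OF \<Omega> _ A, where B = 1])
    show "(\<lambda>x. (cmod (indicator A x))\<^sup>2) \<in> borel_measurable (lebesgue_on \<Omega>)"
      by measurable
  qed (auto simp: indicator_def)
qed

text \<open>A nonempty open set is not null. This rules out that a function positive on such a set
  vanishes almost everywhere.\<close>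

lemma AE_lebesgue_on_open_imp_ex:
  fixes V :: "(real ^ 'd) set"
  assumes \<Omega>: "\<Omega> \<in> sets lebesgue" and V: "open V" "V \<noteq> {}" "V \<subseteq> \<Omega>"
    and AE: "AE x in lebesgue_on \<Omega>. P x"
  shows "\<exists>x\<in>V. P x"
proof (rule ccontr)
  assume "\<not> (\<exists>x\<in>V. P x)"
  moreover have "AE x in lebesgue. x \<in> \<Omega> \<longrightarrow> P x"
    using AE \<Omega> by (simp add: AE_restrict_space_iff)
  ultimately have "AE x in lebesgue. x \<notin> V"
    using V(3) by (auto elim: eventually_mono)
  then have "V \<in> null_sets lebesgue"
    using V(1) by (subst (asm) AE_iff_null_sets[symmetric]) auto
  then show False
    using open_not_negligible[OF V(1,2)] by (simp add: negligible_iff_null_sets)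
qed

text \<open>Bessel bounds all finite sums of squared coefficients, and a summable family has only
  countably many nonzero members.\<close>

lemma countable_orthonormal_not_orthogonal:
  assumes S: "L2_orthonormal \<Omega> S (\<lambda>s. s)" and u: "u \<in> L2 \<Omega>"
  shows "countable {s\<in>S. L2_inner \<Omega> u s \<noteq> 0}"
proof -
  have "(\<lambda>s. (cmod (L2_inner \<Omega> u s))\<^sup>2) summable_on S"
  proof (rule nonneg_bdd_above_summable_on)
    show "bdd_above (sum (\<lambda>s. (cmod (L2_inner \<Omega> u s))\<^sup>2) ` {F. F \<subseteq> S \<and> finite F})"
      using L2_Bessel[OF L2_orthonormal_subset[OF S] _ u] by (intro bdd_aboveI2) auto
  qed simp
  from summable_countable_real[OF this] show ?thesis by simp
qed

lemma sigma_finite_lebesgue: "sigma_finite_measure (lebesgue :: 'a::euclidean_space measure)"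
proof
  obtain A :: "'a set set" where A: "countable A" "A \<subseteq> sets lborel" "\<Union>A = space lborel"
      "\<forall>a\<in>A. emeasure lborel a \<noteq> \<infinity>"
    using sigma_finite_measure.sigma_finite_countable[OF sigma_finite_lborel] by blast
  then show "\<exists>A. countable A \<and> A \<subseteq> sets lebesgue \<and> \<Union>A = space lebesgue
      \<and> (\<forall>a\<in>A. emeasure (lebesgue :: 'a measure) a \<noteq> \<infinity>)"
    by (intro exI[of _ A]) auto
qed

text \<open>Dynkin's argument: the sets over which \<open>f\<close> integrates to zero are closed
  under complements, as \<open>UNIV \<in> B\<close> makes the total integral zero, and under
  disjoint countable unions. An intersection-stable generator therefore reaches all Borel
  sets.\<close>

lemma AE_zero_of_integrals_over_basis:
  fixes f :: "real ^ 'd \<Rightarrow> complex"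
  assumes f: "integrable lebesgue f"
    and B: "countable B" "topological_basis B" "Int_stable B" "UNIV \<in> B"
    and zero: "\<And>U. U \<in> B \<Longrightarrow> (LINT x:U|lebesgue. f x) = 0"
  shows "AE x in lebesgue. f x = 0"
proof (rule sigma_finite_measure.density_zero[OF sigma_finite_lebesgue f])
  have borel_eq: "sets borel = sigma_sets UNIV B"
    unfolding borel_eq_countable_basis[OF B(1,2)] by (rule sets_measure_of) simp
  have si: "set_integrable lebesgue A f" if "A \<in> sets lebesgue" for A
    unfolding set_integrable_def using that f by (rule integrable_mult_indicator)
  have sbm: "set_borel_measurable lebesgue A f" if "A \<in> sets lebesgue" for A
    using borel_measurable_integrable[OF si[OF that, unfolded set_integrable_def]]
    by (simp add: set_borel_measurable_def)
  have zero_borel: "(LINT x:A|lebesgue. f x) = 0" if "A \<in> sigma_sets UNIV B" for A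
    using B(3) subset_UNIV[of B, folded Pow_UNIV] that
  proof (induction rule: sigma_sets_induct_disjoint)
    case (compl A)
    then have A: "A \<in> sets lebesgue" using borel_eq by simp
    have "(LINT x:A \<union> (UNIV - A)|lebesgue. f x)
        = (LINT x:A|lebesgue. f x) + (LINT x:UNIV - A|lebesgue. f x)"
      using A by (intro set_integral_Un si) auto
    moreover have "A \<union> (UNIV - A) = UNIV" by auto
    ultimately show ?case using compl zero[OF B(4)] by simp
  next
    case (union A)
    then have "A i \<in> sets borel" for i using borel_eq by blast
    then have A: "A i \<in> sets lebesgue" for i by simp
    have "(LINT x:(\<Union>i. A i)|lebesgue. f x) = (\<Sum>i. (LINT x:A i|lebesgue. f x))"
      using A union by (intro lebesgue_integral_countable_add si sets.countable_UN)
        (auto simp: disjoint_family_on_def)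
    then show ?case using union by simp
  qed (use zero in \<open>auto simp: set_lebesgue_integral_def\<close>)
  fix A :: "(real ^ 'd) set" assume A: "A \<in> sets lebesgue"
  \<comment> \<open>A Lebesgue set differs from a Borel set by a null set, which does not change the
    integral.\<close>
  then obtain S N N' where N: "A = S \<union> N" "N \<subseteq> N'" "N' \<in> null_sets lborel" "S \<in> sets lborel"
    by (rule sets_completionE)
  have "AE x in lebesgue. x \<notin> N'"
    using N(3) by (intro AE_not_in null_sets_completionI)
  then have "AE x in lebesgue. x \<in> S \<longleftrightarrow> x \<in> A"
    by eventually_elim (use N in auto)
  moreover have "S \<in> sets lebesgue" using N(4) by simp
  ultimately have "(LINT x:A|lebesgue. f x) = (LINT x:S|lebesgue. f x)"
    using A by (intro set_integral_cong_set sbm)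
  then show "(LINT x:A|lebesgue. f x) = 0"
    using zero_borel N(4) borel_eq by simp
qed

text \<open>Finite intersections of a countable basis; the empty intersection supplies
  \<open>UNIV\<close>.\<close>

lemma ex_countable_Int_stable_basis:
  obtains B :: "'a::second_countable_topology set set"
  where "countable B" "topological_basis B" "Int_stable B" "UNIV \<in> B"
proof -
  obtain B0 :: "'a set set" where B0: "countable B0" "topological_basis B0"
    using ex_countable_basis by blast
  define B where "B = Inter ` {F. finite F \<and> F \<subseteq> B0}"
  have "countable B"
    unfolding B_def by (intro countable_image countable_Collect_finite_subset B0)
  moreover have "topological_basis B"
  proof (rule topological_basisI)
    fix U assume "U \<in> B"
    then show "open U"
      unfolding B_def using topological_basis_open[OF B0(2)] by (auto intro!: open_Inter)
  next
    fix x :: 'a and O' assume "open O'" "x \<in> O'"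
    then obtain U where "U \<in> B0" "x \<in> U" "U \<subseteq> O'"
      using topological_basisE[OF B0(2)] by metis
    then show "\<exists>U\<in>B. x \<in> U \<and> U \<subseteq> O'"
      unfolding B_def by (intro bexI[of _ U] conjI image_eqI[of _ _ "{U}"]) auto
  qed
  moreover have "Int_stable B"
    unfolding Int_stable_def B_def
  proof clarify
    fix F G assume "finite F" "F \<subseteq> B0" "finite G" "G \<subseteq> B0"
    then show "\<Inter>F \<inter> \<Inter>G \<in> Inter ` {F. finite F \<and> F \<subseteq> B0}"
      by (intro image_eqI[of _ _ "F \<union> G"]) auto
  qed
  moreover have "UNIV \<in> B"
    unfolding B_def by (intro image_eqI[of _ _ "{}"]) auto
  ultimately show ?thesis by (rule that)
qed

text \<open>The form in which separability of \<open>L2\<close> is used: a countable family of test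
  functions that detects every nonzero class.\<close>

lemma L2_countable_total:
  fixes \<Omega> :: "(real ^ 'd) set"
  assumes \<Omega>: "\<Omega> \<in> sets lebesgue"
  obtains H where "countable H" "H \<subseteq> L2 \<Omega>"
    "\<And>u. u \<in> L2 \<Omega> \<Longrightarrow> (\<And>h. h \<in> H \<Longrightarrow> L2_inner \<Omega> h u = 0) \<Longrightarrow> L2_norm \<Omega> u = 0"
proof -
  obtain B :: "(real ^ 'd) set set"
    where B: "countable B" "topological_basis B" "Int_stable B" "UNIV \<in> B"
    by (rule ex_countable_Int_stable_basis)
  \<comment> \<open>The balls give the test functions bounded support, hence membership in
    \<open>L2 \<Omega>\<close>, and make the truncation of \<open>u\<close> integrable.\<close>
  define h where "h = (\<lambda>(U, n::nat) (x :: real ^ 'd). indicator (U \<inter> ball 0 (real n)) x :: complex)"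
  define H where "H = h ` (B \<times> UNIV)"
  have "countable H" unfolding H_def using B(1) by auto
  moreover have "H \<subseteq> L2 \<Omega>"
    using topological_basis_open[OF B(2)]
    by (auto simp: H_def h_def intro!: L2_indicator[OF \<Omega>] borel_open bounded_Int)
  moreover have "L2_norm \<Omega> u = 0" if u: "u \<in> L2 \<Omega>" and orth: "\<And>h. h \<in> H \<Longrightarrow> L2_inner \<Omega> h u = 0" for u
  proof -
    have "AE x in lebesgue. indicator \<Omega> x *\<^sub>R (indicator (ball 0 (real n)) x * cnj (u x)) = 0" for n
    proof (rule AE_zero_of_integrals_over_basis[OF _ B])
      have "(\<lambda>x. indicator (ball 0 (real n)) x) \<in> L2 \<Omega>"
        by (intro L2_indicator[OF \<Omega>]) auto
      from integrable_L2_mult[OF this u]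
      show "integrable lebesgue (\<lambda>x. indicator \<Omega> x *\<^sub>R (indicator (ball 0 (real n)) x * cnj (u x)))"
        using \<Omega> by (subst (asm) integrable_restrict_space) auto
      fix U assume "U \<in> B"
      then have "L2_inner \<Omega> (h (U, n)) u = 0" by (intro orth) (auto simp: H_def)
      then have "(\<integral>x. indicator \<Omega> x *\<^sub>R (h (U, n) x * cnj (u x)) \<partial>lebesgue) = 0"
        unfolding L2_inner_def using \<Omega> by (subst (asm) integral_restrict_space) auto
      moreover have "indicator \<Omega> x *\<^sub>R (h (U, n) x * cnj (u x))
          = indicator U x *\<^sub>R (indicator \<Omega> x *\<^sub>R (indicator (ball 0 (real n)) x * cnj (u x)))" for x
        by (auto simp: h_def indicator_def)
      ultimately show "(LINT x:U|lebesgue. indicator \<Omega> x *\<^sub>R (indicator (ball 0 (real n)) x * cnj (u x))) = 0"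
        unfolding set_lebesgue_integral_def by simp
    qed
    then have "AE x in lebesgue. \<forall>n. indicator \<Omega> x *\<^sub>R (indicator (ball 0 (real n)) x * cnj (u x)) = 0"
      unfolding AE_all_countable by blast
    then have "AE x in lebesgue. x \<in> \<Omega> \<longrightarrow> u x = 0"
    proof eventually_elim
      case (elim x)
      obtain n where "norm x < real n" using reals_Archimedean2 by blast
      with elim[rule_format, of n] show ?case by (auto simp: indicator_def)
    qed
    then show ?thesis
      using \<Omega> by (simp add: L2_norm_eq_0_iff[OF u] AE_restrict_space_iff)
  qed
  ultimately show ?thesis by (rule that)
qed

text \<open>Every unit vector of \<open>S\<close> is detected by some member of the countable total
  set \<open>H\<close>, and each member of \<open>H\<close> detects only countably many elements of
  \<open>S\<close>.\<close>

lemma countable_L2_orthonormal: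
  assumes \<Omega>: "\<Omega> \<in> sets lebesgue" and S: "L2_orthonormal \<Omega> S (\<lambda>s. s)"
  shows "countable S"
proof -
  obtain H where H: "countable H" "H \<subseteq> L2 \<Omega>"
    and total: "\<And>u. u \<in> L2 \<Omega> \<Longrightarrow> (\<And>h. h \<in> H \<Longrightarrow> L2_inner \<Omega> h u = 0) \<Longrightarrow> L2_norm \<Omega> u = 0"
    using L2_countable_total[OF \<Omega>] by blast
  have "S \<subseteq> (\<Union>h\<in>H. {s\<in>S. L2_inner \<Omega> h s \<noteq> 0})"
  proof
    fix s assume s: "s \<in> S"
    have "of_real ((L2_norm \<Omega> s)\<^sup>2) = (1 :: complex)"
      using L2_orthonormalD(2)[OF S s s] by (simp add: L2_inner_self)
    then have "L2_norm \<Omega> s \<noteq> 0" by auto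
    then show "s \<in> (\<Union>h\<in>H. {s\<in>S. L2_inner \<Omega> h s \<noteq> 0})"
      using total[OF L2_orthonormalD(1)[OF S s]] s by blast
  qed
  moreover have "countable (\<Union>h\<in>H. {s\<in>S. L2_inner \<Omega> h s \<noteq> 0})"
    using H by (intro countable_UN countable_orthonormal_not_orthogonal[OF S]) auto
  ultimately show ?thesis by (rule countable_subset)
qed

text \<open>Normalised indicators of disjoint nonempty open sets witness that
  \<open>L2 \<Omega>\<close> is infinite-dimensional.\<close>

lemma L2_orthonormal_sequence_exists:
  fixes \<Omega> :: "(real ^ 'd) set"
  assumes \<Omega>: "open \<Omega>" "\<Omega> \<noteq> {}"
  obtains b :: "nat \<Rightarrow> real ^ 'd \<Rightarrow> complex" where "L2_orthonormal \<Omega> UNIV b"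
proof -
  have \<Omega>L: "\<Omega> \<in> sets lebesgue" using \<Omega>(1) by simp
  obtain a r where a: "ball a r \<subseteq> \<Omega>" and r: "r > 0"
    using \<Omega> open_contains_ball by blast
  \<comment> \<open>Open shells shrinking to \<open>a\<close>: consecutive radii
    \<open>r / (i + 1)\<close> make them disjoint, and the outermost one still lies in
    \<open>ball a r\<close>.\<close>
  define A where "A i = {x. r / real (i + 2) < dist a x \<and> dist a x < r / real (i + 1)}" for i :: nat
  define h where "h i = (\<lambda>x. indicator (A i) x :: complex)" for i
  have A_open: "open (A i)" for i
    unfolding A_def by (intro open_Collect_conj open_Collect_less continuous_intros)
  have A_ball: "A i \<subseteq> ball a r" for i
  proof
    fix x assume "x \<in> A i"
    then have "dist a x < r / real (i + 1)" by (simp add: A_def)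
    also have "\<dots> \<le> r" using r by (simp add: field_simps)
    finally show "x \<in> ball a r" by simp
  qed
  have A_ne: "A i \<noteq> {}" for i
  proof -
    have "r / real (i + 2) < r / real (i + 1)" using r by (simp add: field_simps)
    then obtain t where t: "r / real (i + 2) < t" "t < r / real (i + 1)" using dense by blast
    have "0 < r / real (i + 2)" using r by simp
    then have "t > 0" using t by linarith
    then obtain y where "dist a y = t" using vector_choose_dist[of t a] by auto
    then show ?thesis using t by (auto simp: A_def)
  qed
  have A_disj: "A i \<inter> A j = {}" if "i < j" for i j
  proof -
    have "r / real (j + 1) \<le> r / real (i + 2)" using that r by (intro divide_left_mono) auto
    then show ?thesis by (auto simp: A_def)
  qed
  have hL: "h i \<in> L2 \<Omega>" for i
    unfolding h_def using A_open bounded_subset[OF bounded_ball A_ball]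
    by (intro L2_indicator[OF \<Omega>L] borel_open)
  have h_norm: "L2_norm \<Omega> (h i) \<noteq> 0" for i
  proof
    assume "L2_norm \<Omega> (h i) = 0"
    then have "AE x in lebesgue_on \<Omega>. h i x = 0" by (simp add: L2_norm_eq_0_iff[OF hL])
    from AE_lebesgue_on_open_imp_ex[OF \<Omega>L A_open A_ne _ this] A_ball a
    obtain x where "x \<in> A i" "h i x = 0" by blast
    then show False by (simp add: h_def)
  qed
  have h_orth: "L2_inner \<Omega> (h i) (h j) = 0" if "i \<noteq> j" for i j
  proof -
    have "A i \<inter> A j = {}" using A_disj[of i j] A_disj[of j i] that by (cases "i < j") auto
    then have "(\<lambda>x. h i x * cnj (h j x)) = (\<lambda>x. 0)"
      by (auto simp: h_def fun_eq_iff split: split_indicator)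
    then show ?thesis by (simp add: L2_inner_def)
  qed
  define b where "b i = (\<lambda>x. of_real (1 / L2_norm \<Omega> (h i)) * h i x)" for i
  have "L2_orthonormal \<Omega> UNIV b"
    unfolding L2_orthonormal_def
  proof (intro conjI ballI)
    show "b i \<in> L2 \<Omega>" for i unfolding b_def by (intro L2_scale hL)
    show "L2_inner \<Omega> (b i) (b j) = (if i = j then 1 else 0)" for i j
      using h_orth[of i j] h_norm[of i] unfolding b_def L2_inner_scale_left L2_inner_scale_right
      by (auto simp: L2_inner_self power2_eq_square)
  qed
  then show ?thesis by (rule that)
qed

text \<open>Dimension count by summing \<open>(cmod (b i, s))^2\<close> in two orders: over a finite
  total \<open>S\<close> each \<open>b i\<close> contributes exactly 1, while over
  \<open>i < m\<close> each \<open>s\<close> contributes at most 1. So \<open>m \<le> card S\<close>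
  for every \<open>m\<close>.\<close>

lemma infinite_total_L2_orthonormal:
  fixes \<Omega> :: "(real ^ 'd) set"
  assumes \<Omega>: "open \<Omega>" "\<Omega> \<noteq> {}" and S: "L2_orthonormal \<Omega> S (\<lambda>s. s)"
    and total: "\<And>u. u \<in> L2 \<Omega> \<Longrightarrow> (\<And>s. s \<in> S \<Longrightarrow> L2_inner \<Omega> u s = 0) \<Longrightarrow> L2_norm \<Omega> u = 0"
  shows "infinite S"
proof
  assume fin: "finite S"
  obtain b :: "nat \<Rightarrow> real ^ 'd \<Rightarrow> complex" where b: "L2_orthonormal \<Omega> UNIV b"
    by (rule L2_orthonormal_sequence_exists[OF \<Omega>])
  note bL = L2_orthonormalD(1)[OF b UNIV_I]
  have norm1: "(L2_norm \<Omega> u)\<^sup>2 = 1" if "L2_inner \<Omega> u u = 1" for u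
    using that by (simp add: L2_inner_self flip: of_real_power)
  have b_norm: "(\<Sum>s\<in>S. (cmod (L2_inner \<Omega> (b i) s))\<^sup>2) = 1" for i
  proof -
    let ?r = "\<lambda>x. b i x - (\<Sum>s\<in>S. L2_inner \<Omega> (b i) s * s x)"
    have P: "(\<lambda>x. \<Sum>s\<in>S. L2_inner \<Omega> (b i) s * s x) \<in> L2 \<Omega>"
      by (intro L2_lincomb L2_orthonormalD(1)[OF S])
    have "L2_inner \<Omega> ?r t = 0" if t: "t \<in> S" for t
    proof -
      have tL: "t \<in> L2 \<Omega>" by (rule L2_orthonormalD(1)[OF S t])
      have "L2_inner \<Omega> (\<lambda>x. \<Sum>s\<in>S. L2_inner \<Omega> (b i) s * s x) t
          = (\<Sum>s\<in>S. L2_inner \<Omega> (b i) s * L2_inner \<Omega> s t)"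
        by (intro L2_inner_lincomb_left L2_orthonormalD(1)[OF S] tL)
      also have "\<dots> = (\<Sum>s\<in>S. if s = t then L2_inner \<Omega> (b i) s else 0)"
        using L2_orthonormalD(2)[OF S _ t] by (intro sum.cong) auto
      also have "\<dots> = L2_inner \<Omega> (b i) t" using fin t by simp
      finally show ?thesis by (simp add: L2_inner_diff_left[OF bL P tL])
    qed
    then have "L2_norm \<Omega> ?r = 0" by (intro total L2_diff bL P)
    then show ?thesis
      using L2_norm_diff_lincomb_square[OF S fin bL, of i "\<lambda>s. L2_inner \<Omega> (b i) s"]
        norm1 L2_orthonormalD(2)[OF b UNIV_I UNIV_I, of i i] by simp
  qed
  have "real m \<le> real (card S)" for m
  proof -
    have "real m = (\<Sum>i<m. \<Sum>s\<in>S. (cmod (L2_inner \<Omega> (b i) s))\<^sup>2)" by (simp add: b_norm)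
    also have "\<dots> = (\<Sum>s\<in>S. \<Sum>i<m. (cmod (L2_inner \<Omega> s (b i)))\<^sup>2)"
      by (subst sum.swap) (simp add: L2_inner_commute[of \<Omega> "b _"])
    also have "\<dots> \<le> (\<Sum>s\<in>S. (L2_norm \<Omega> s)\<^sup>2)"
      by (intro sum_mono L2_Bessel L2_orthonormal_subset[OF b] L2_orthonormalD(1)[OF S]) auto
    also have "\<dots> = (\<Sum>s\<in>S. 1)"
      using L2_orthonormalD(2)[OF S] by (intro sum.cong norm1) auto
    finally show ?thesis by simp
  qed
  from this[of "Suc (card S)"] show False by simp
qed

section \<open>Compact positive operators\<close>

lemma L2_positive_operatorD:
  assumes "L2_positive_operator \<Omega> T"
  shows "u \<in> L2 \<Omega> \<Longrightarrow> T u \<in> L2 \<Omega>"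
    and "u \<in> L2 \<Omega> \<Longrightarrow> v \<in> L2 \<Omega> \<Longrightarrow> L2_inner \<Omega> (T u) v = L2_inner \<Omega> u (T v)"
    and "u \<in> L2 \<Omega> \<Longrightarrow> L2_inner \<Omega> (T u) u = of_real (Re (L2_inner \<Omega> (T u) u))"
    and "u \<in> L2 \<Omega> \<Longrightarrow> 0 \<le> Re (L2_inner \<Omega> (T u) u)"
    and "u \<in> L2 \<Omega> \<Longrightarrow> v \<in> L2 \<Omega> \<Longrightarrow> ae_eq \<Omega> u v \<Longrightarrow> ae_eq \<Omega> (T u) (T v)"
    and "u \<in> L2 \<Omega> \<Longrightarrow> ae_eq \<Omega> (T (\<lambda>x. c * u x)) (\<lambda>x. c * T u x)"
proof -
  have lin: "L2_linear \<Omega> T"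
    and sym: "\<forall>u\<in>L2 \<Omega>. \<forall>v\<in>L2 \<Omega>. L2_inner \<Omega> (T u) v = L2_inner \<Omega> u (T v)"
    and pos: "\<forall>u\<in>L2 \<Omega>. L2_inner \<Omega> (T u) u \<in> \<real>\<^sub>\<ge>\<^sub>0"
    using assms unfolding L2_positive_operator_def L2_bounded_operator_def by auto
  show "u \<in> L2 \<Omega> \<Longrightarrow> T u \<in> L2 \<Omega>" "u \<in> L2 \<Omega> \<Longrightarrow> v \<in> L2 \<Omega> \<Longrightarrow> ae_eq \<Omega> u v \<Longrightarrow> ae_eq \<Omega> (T u) (T v)"
    "u \<in> L2 \<Omega> \<Longrightarrow> ae_eq \<Omega> (T (\<lambda>x. c * u x)) (\<lambda>x. c * T u x)"
    using lin unfolding L2_linear_def by auto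
  show "u \<in> L2 \<Omega> \<Longrightarrow> v \<in> L2 \<Omega> \<Longrightarrow> L2_inner \<Omega> (T u) v = L2_inner \<Omega> u (T v)"
    using sym by blast
  show "u \<in> L2 \<Omega> \<Longrightarrow> L2_inner \<Omega> (T u) u = of_real (Re (L2_inner \<Omega> (T u) u))"
    "u \<in> L2 \<Omega> \<Longrightarrow> 0 \<le> Re (L2_inner \<Omega> (T u) u)"
    using pos unfolding complex_nonneg_Reals_iff by (auto simp: complex_eq_iff)
qed

text \<open>\<open>(T u, w)\<close> is itself a semi-inner product, so the discriminant argument
  applies to the form of \<open>w - c * u\<close>.\<close>

lemma L2_positive_operator_Cauchy_Schwarz:
  assumes T: "L2_positive_operator \<Omega> T" and u: "u \<in> L2 \<Omega>" and w: "w \<in> L2 \<Omega>"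
  shows "(cmod (L2_inner \<Omega> (T u) w))\<^sup>2 \<le> Re (L2_inner \<Omega> (T w) w) * Re (L2_inner \<Omega> (T u) u)"
proof (rule complex_discriminant)
  note TL = L2_positive_operatorD(1)[OF T] and sym = L2_positive_operatorD(2)[OF T]
  show "0 \<le> Re (L2_inner \<Omega> (T u) u)" by (rule L2_positive_operatorD(4)[OF T u])
  fix c
  define z where "z = (\<lambda>x. w x - c * u x)"
  have cu: "(\<lambda>x. c * u x) \<in> L2 \<Omega>" by (rule L2_scale[OF u])
  have z: "z \<in> L2 \<Omega>" unfolding z_def by (rule L2_diff[OF w cu])
  have left: "L2_inner \<Omega> z y = L2_inner \<Omega> w y - c * L2_inner \<Omega> u y" if "y \<in> L2 \<Omega>" for y
    unfolding z_def using L2_inner_diff_left[OF w cu that] by (simp add: L2_inner_scale_left)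
  have right: "L2_inner \<Omega> y z = L2_inner \<Omega> y w - cnj c * L2_inner \<Omega> y u" if "y \<in> L2 \<Omega>" for y
    unfolding z_def using L2_inner_diff_right[OF w cu that] by (simp add: L2_inner_scale_right)
  \<comment> \<open>Symmetry moves \<open>T\<close> off the combination \<open>z\<close>, so the
    expansion takes place in the inner product.\<close>
  have "L2_inner \<Omega> (T z) z = L2_inner \<Omega> (T w) z - c * L2_inner \<Omega> (T u) z"
    using left[OF TL[OF z]] by (simp add: sym z w u)
  also have "\<dots> = L2_inner \<Omega> (T w) w - cnj c * L2_inner \<Omega> (T w) u - c * L2_inner \<Omega> (T u) w
      + c * cnj c * L2_inner \<Omega> (T u) u"
    by (simp add: right TL w u algebra_simps)
  also have "L2_inner \<Omega> (T w) u = cnj (L2_inner \<Omega> (T u) w)"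
    using sym[OF w u] by (simp add: L2_inner_commute[of \<Omega> w])
  also have "cnj c * cnj (L2_inner \<Omega> (T u) w) = cnj (c * L2_inner \<Omega> (T u) w)" by simp
  also have "c * cnj c * L2_inner \<Omega> (T u) u = of_real ((cmod c)\<^sup>2 * Re (L2_inner \<Omega> (T u) u))"
    using L2_positive_operatorD(3)[OF T u] by (simp flip: complex_norm_square)
  finally have eq: "L2_inner \<Omega> (T z) z = L2_inner \<Omega> (T w) w - cnj (c * L2_inner \<Omega> (T u) w)
      - c * L2_inner \<Omega> (T u) w + of_real ((cmod c)\<^sup>2 * Re (L2_inner \<Omega> (T u) u))" .
  show "0 \<le> Re (L2_inner \<Omega> (T w) w) - 2 * Re (c * L2_inner \<Omega> (T u) w)
      + (cmod c)\<^sup>2 * Re (L2_inner \<Omega> (T u) u)"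
    using L2_positive_operatorD(4)[OF T z]
    unfolding eq plus_complex.sel minus_complex.sel cnj.sel Re_complex_of_real by linarith
qed

lemma L2_normalize_eigenvector:
  assumes T: "L2_positive_operator \<Omega> T" and w: "w \<in> L2 \<Omega>" "L2_norm \<Omega> w \<noteq> 0"
    and eig: "ae_eq \<Omega> (T w) (\<lambda>x. of_real l * w x)"
  defines "w' \<equiv> \<lambda>x. of_real (1 / L2_norm \<Omega> w) * w x"
  shows "w' \<in> L2 \<Omega>" "L2_norm \<Omega> w' = 1" "ae_eq \<Omega> (T w') (\<lambda>x. of_real l * w' x)"
    "L2_inner \<Omega> w' s = of_real (1 / L2_norm \<Omega> w) * L2_inner \<Omega> w s"
proof -
  show "w' \<in> L2 \<Omega>" unfolding w'_def by (rule L2_scale[OF w(1)])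
  show "L2_norm \<Omega> w' = 1"
    unfolding w'_def L2_norm_scale using w(2) by (simp add: norm_divide)
  show "L2_inner \<Omega> w' s = of_real (1 / L2_norm \<Omega> w) * L2_inner \<Omega> w s"
    unfolding w'_def by (rule L2_inner_scale_left)
  have "ae_eq \<Omega> (T w') (\<lambda>x. of_real (1 / L2_norm \<Omega> w) * T w x)"
    unfolding w'_def by (rule L2_positive_operatorD(6)[OF T w(1)])
  then show "ae_eq \<Omega> (T w') (\<lambda>x. of_real l * w' x)"
    using eig unfolding ae_eq_def w'_def by eventually_elim simp
qed

text \<open>Compactness turns a maximising sequence for the quadratic form of \<open>T\<close> on the orthogonal
  complement of \<open>S\<close> into an eigenvector.\<close>

lemma L2_compact_positive_eigenvector_pos:
  assumes comp: "L2_compact_operator \<Omega> T" and T: "L2_positive_operator \<Omega> T"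
    and S: "\<And>s. s \<in> S \<Longrightarrow> s \<in> L2 \<Omega>" "\<And>s. s \<in> S \<Longrightarrow> ae_eq \<Omega> (T s) (\<lambda>x. of_real (l s) * s x)"
    and u0: "u0 \<in> L2 \<Omega>" "\<And>s. s \<in> S \<Longrightarrow> L2_inner \<Omega> u0 s = 0" "L2_inner \<Omega> (T u0) u0 \<noteq> 0"
  obtains v M where "v \<in> L2 \<Omega>" "L2_norm \<Omega> v \<noteq> 0" "\<And>s. s \<in> S \<Longrightarrow> L2_inner \<Omega> v s = 0"
    "0 \<le> M" "ae_eq \<Omega> (T v) (\<lambda>x. of_real M * v x)"
proof -
  note TL = L2_positive_operatorD(1)[OF T] and sym = L2_positive_operatorD(2)[OF T]
    and real = L2_positive_operatorD(3)[OF T] and pos = L2_positive_operatorD(4)[OF T]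
  define W where "W = {u\<in>L2 \<Omega>. \<forall>s\<in>S. L2_inner \<Omega> u s = 0}"
  define q where "q u = Re (L2_inner \<Omega> (T u) u)" for u
  have WL: "u \<in> L2 \<Omega>" if "u \<in> W" for u using that by (simp add: W_def)
  have W_scale: "(\<lambda>x. c * u x) \<in> W" if "u \<in> W" for u c
    using that by (simp add: W_def L2_scale L2_inner_scale_left)
  \<comment> \<open>The complement is invariant because \<open>S\<close> consists of eigenvectors:
    \<open>(T u, s) = (u, T s)\<close> is a multiple of \<open>(u, s) = 0\<close>.\<close>
  have W_T: "T u \<in> W" if "u \<in> W" for u
  proof -
    have "L2_inner \<Omega> (T u) s = 0" if s: "s \<in> S" for s
      using L2_inner_cong_ae(2)[OF TL[OF S(1)[OF s]] L2_scale[OF S(1)[OF s]] S(2)[OF s] WL[OF \<open>u \<in> W\<close>]]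
        sym[OF WL[OF \<open>u \<in> W\<close>] S(1)[OF s]] \<open>u \<in> W\<close> s
      by (simp add: W_def L2_inner_scale_right)
    then show ?thesis using TL[OF WL[OF that]] by (simp add: W_def)
  qed
  have q_scale: "q (\<lambda>x. c * u x) = (cmod c)\<^sup>2 * q u" if u: "u \<in> L2 \<Omega>" for u c
  proof -
    have "L2_inner \<Omega> (T (\<lambda>x. c * u x)) (\<lambda>x. c * u x)
        = L2_inner \<Omega> (\<lambda>x. c * T u x) (\<lambda>x. c * u x)"
      by (intro L2_inner_cong_ae TL L2_scale u L2_positive_operatorD(6)[OF T])
    also have "\<dots> = c * cnj c * of_real (q u)"
      using real[OF u] unfolding q_def by (simp add: L2_inner_scale_left L2_inner_scale_right)
    also have "\<dots> = of_real ((cmod c)\<^sup>2 * q u)" by (simp flip: complex_norm_square)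
    finally show ?thesis by (simp add: q_def[of "\<lambda>x. c * u x"] del: of_real_mult)
  qed
  obtain B where B: "\<And>u. u \<in> L2 \<Omega> \<Longrightarrow> L2_norm \<Omega> (T u) \<le> B * L2_norm \<Omega> u"
    using T unfolding L2_positive_operator_def L2_bounded_operator_def by blast
  define Q where "Q = q ` {u\<in>W. L2_norm \<Omega> u = 1}"
  have bdd: "bdd_above Q"
    unfolding Q_def
  proof (rule bdd_aboveI2)
    fix u assume u: "u \<in> {u\<in>W. L2_norm \<Omega> u = 1}"
    then have uL: "u \<in> L2 \<Omega>" using WL by blast
    have "q u \<le> cmod (L2_inner \<Omega> (T u) u)" unfolding q_def by (rule complex_Re_le_cmod)
    also have "\<dots> \<le> L2_norm \<Omega> (T u) * L2_norm \<Omega> u" by (rule L2_Cauchy_Schwarz[OF TL[OF uL] uL])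
    finally show "q u \<le> B" using B[OF uL] u by simp
  qed
  have u0W: "u0 \<in> W" using u0 by (simp add: W_def)
  have q0: "q u0 > 0"
    using pos[OF u0(1)] real[OF u0(1)] u0(3) unfolding q_def by (metis less_eq_real_def of_real_0)
  have u0_norm: "L2_norm \<Omega> u0 \<noteq> 0"
  proof
    assume "L2_norm \<Omega> u0 = 0"
    then have "cmod (L2_inner \<Omega> (T u0) u0) \<le> 0"
      using L2_Cauchy_Schwarz[OF TL[OF u0(1)] u0(1)] by simp
    then show False using u0(3) by simp
  qed
  let ?u1 = "\<lambda>x. of_real (1 / L2_norm \<Omega> u0) * u0 x"
  have u1: "?u1 \<in> W" "L2_norm \<Omega> ?u1 = 1" "q ?u1 > 0"
    using W_scale[OF u0W, of "of_real (1 / L2_norm \<Omega> u0)"] u0_norm q0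
    unfolding L2_norm_scale q_scale[OF u0(1)]
    by (auto simp: norm_divide)
  then have "q ?u1 \<in> Q" unfolding Q_def by blast
  define M where "M = Sup Q"
  have q_le_norm1: "q u \<le> M" if "u \<in> W" "L2_norm \<Omega> u = 1" for u
    unfolding M_def by (rule cSup_upper[OF _ bdd]) (use that in \<open>auto simp: Q_def\<close>)
  have M_pos: "M > 0" using q_le_norm1[OF u1(1,2)] u1(3) by linarith
  have q_le: "q u \<le> M * (L2_norm \<Omega> u)\<^sup>2" if u: "u \<in> W" for u
  proof (cases "L2_norm \<Omega> u = 0")
    case True
    have "q u \<le> cmod (L2_inner \<Omega> (T u) u)" unfolding q_def by (rule complex_Re_le_cmod)
    also have "\<dots> \<le> L2_norm \<Omega> (T u) * L2_norm \<Omega> u"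
      by (rule L2_Cauchy_Schwarz[OF TL[OF WL[OF u]] WL[OF u]])
    finally show ?thesis using True by simp
  next
    case False
    let ?u = "\<lambda>x. of_real (1 / L2_norm \<Omega> u) * u x"
    have "L2_norm \<Omega> ?u = 1"
      unfolding L2_norm_scale using False by (simp add: norm_divide)
    then have "q ?u \<le> M" by (rule q_le_norm1[OF W_scale[OF u]])
    then show ?thesis
      using False unfolding q_scale[OF WL[OF u]]
      by (simp add: norm_divide power_divide field_simps)
  qed
  \<comment> \<open>Cauchy-Schwarz for the form, applied to \<open>u\<close> and \<open>T u\<close>,
    bounds the fourth power of the norm of \<open>T u\<close> by \<open>q (T u) * q u\<close>.
    Invariance of \<open>W\<close> allows the bound \<open>M\<close> for \<open>q (T u)\<close>, and
    one squared norm cancels.\<close>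
  have T_norm: "(L2_norm \<Omega> (T u))\<^sup>2 \<le> M * q u" if u: "u \<in> W" for u
  proof (cases "L2_norm \<Omega> (T u) = 0")
    case True
    then show ?thesis using M_pos pos[OF WL[OF u]] by (simp add: q_def)
  next
    case False
    have "((L2_norm \<Omega> (T u))\<^sup>2)\<^sup>2 = (cmod (L2_inner \<Omega> (T u) (T u)))\<^sup>2"
      by (simp add: L2_inner_self norm_power)
    also have "\<dots> \<le> q (T u) * q u"
      unfolding q_def by (rule L2_positive_operator_Cauchy_Schwarz[OF T WL[OF u] TL[OF WL[OF u]]])
    also have "\<dots> \<le> (M * (L2_norm \<Omega> (T u))\<^sup>2) * q u"
      using q_le[OF W_T[OF u]] pos[OF WL[OF u]] by (intro mult_right_mono) (auto simp: q_def)
    finally have "(L2_norm \<Omega> (T u))\<^sup>2 * (L2_norm \<Omega> (T u))\<^sup>2 \<le> (M * q u) * (L2_norm \<Omega> (T u))\<^sup>2"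
      by (simp add: power2_eq_square mult_ac)
    then show ?thesis using False by (subst (asm) mult_le_cancel_right_pos) auto
  qed
  have "\<exists>u. u \<in> W \<and> L2_norm \<Omega> u = 1 \<and> M - 1 / real (Suc n) < q u" for n
  proof -
    have "M - 1 / real (Suc n) < Sup Q" unfolding M_def[symmetric] by simp
    from less_cSupD[OF _ this] \<open>q ?u1 \<in> Q\<close> show ?thesis unfolding Q_def by blast
  qed
  then obtain u where u: "\<And>n. u n \<in> W" "\<And>n. L2_norm \<Omega> (u n) = 1" "\<And>n. M - 1 / real (Suc n) < q (u n)"
    by metis
  have uL: "u n \<in> L2 \<Omega>" for n using u(1) WL by blast
  \<comment> \<open>Expanding the square and inserting \<open>T_norm\<close> leaves at most
    \<open>M * (M - q (u n))\<close>, so a maximising sequence consists of approximate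
    eigenvectors.\<close>
  have sq_bound: "(L2_norm \<Omega> (\<lambda>x. T (u n) x - of_real M * u n x))\<^sup>2 \<le> M * (1 / real (Suc n))" for n
  proof -
    have "Re (of_real M * L2_inner \<Omega> (u n) (T (u n))) = M * q (u n)"
      unfolding q_def by (simp add: sym[OF uL uL])
    then have "(L2_norm \<Omega> (\<lambda>x. T (u n) x - of_real M * u n x))\<^sup>2
        = (L2_norm \<Omega> (T (u n)))\<^sup>2 - 2 * (M * q (u n)) + M\<^sup>2"
      using L2_norm_diff_scale_square[OF TL[OF uL] uL, of n "of_real M" n] u(2) by simp
    also have "\<dots> \<le> M * (M - q (u n))"
      using T_norm[OF u(1), of n] by (simp add: power2_eq_square algebra_simps)
    also have "\<dots> \<le> M * (1 / real (Suc n))"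
      using u(3)[of n] M_pos by (intro mult_left_mono) auto
    finally show ?thesis .
  qed
  have "(\<lambda>n. M * (1 / real (Suc n))) \<longlonglongrightarrow> 0"
    using tendsto_mult_right[OF lim_inverse_n'[THEN LIMSEQ_Suc], of M] by simp
  then have "(\<lambda>n. (L2_norm \<Omega> (\<lambda>x. T (u n) x - of_real M * u n x))\<^sup>2) \<longlonglongrightarrow> 0"
    by (rule Lim_null_comparison[rotated]) (use sq_bound in auto)
  then have Tu_Mu: "(\<lambda>n. L2_norm \<Omega> (\<lambda>x. T (u n) x - of_real M * u n x)) \<longlonglongrightarrow> 0"
    using tendsto_real_sqrt by fastforce
  have "bounded (range (\<lambda>n. L2_norm \<Omega> (u n)))" by (simp add: u(2))
  then obtain r v where r: "strict_mono r" and v: "v \<in> L2 \<Omega>"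
    and Tuv: "(\<lambda>n. L2_norm \<Omega> (\<lambda>x. T (u (r n)) x - v x)) \<longlonglongrightarrow> 0"
    using comp uL unfolding L2_compact_operator_def by blast
  have MuL: "(\<lambda>x. of_real M * u n x) \<in> L2 \<Omega>" for n by (intro L2_scale uL)
  \<comment> \<open>Since \<open>T (u n) - M * u n\<close> tends to zero, the limit \<open>v\<close>
    that compactness gives for \<open>T (u (r n))\<close> is also the limit of
    \<open>M * u (r n)\<close>.\<close>
  have Muv: "(\<lambda>n. L2_norm \<Omega> (\<lambda>x. of_real M * u (r n) x - v x)) \<longlonglongrightarrow> 0"
  proof (rule Lim_null_comparison)
    show "(\<lambda>n. L2_norm \<Omega> (\<lambda>x. T (u (r n)) x - of_real M * u (r n) x)
        + L2_norm \<Omega> (\<lambda>x. T (u (r n)) x - v x)) \<longlonglongrightarrow> 0"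
      using tendsto_add[OF LIMSEQ_subseq_LIMSEQ[OF Tu_Mu r] Tuv] by (simp add: o_def)
    show "\<forall>\<^sub>F n in sequentially. norm (L2_norm \<Omega> (\<lambda>x. of_real M * u (r n) x - v x))
        \<le> L2_norm \<Omega> (\<lambda>x. T (u (r n)) x - of_real M * u (r n) x)
        + L2_norm \<Omega> (\<lambda>x. T (u (r n)) x - v x)"
    proof (rule always_eventually, rule allI)
      fix n
      show "norm (L2_norm \<Omega> (\<lambda>x. of_real M * u (r n) x - v x))
        \<le> L2_norm \<Omega> (\<lambda>x. T (u (r n)) x - of_real M * u (r n) x)
        + L2_norm \<Omega> (\<lambda>x. T (u (r n)) x - v x)"
        using L2_norm_triangle_diff3[OF MuL v TL[OF uL], of "r n" "r n"]
        by (simp add: L2_norm_minus[of \<Omega> "\<lambda>x. of_real M * u (r n) x" "T (u (r n))"])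
    qed
  qed
  have lim_Mu: "(\<lambda>n. of_real M * L2_inner \<Omega> (u (r n)) w) \<longlonglongrightarrow> L2_inner \<Omega> v w" if "w \<in> L2 \<Omega>" for w
    using L2_inner_tendsto_left[OF MuL v that Muv] by (simp add: L2_inner_scale_left)
  have lim_Tu: "(\<lambda>n. L2_inner \<Omega> (T (u (r n))) w) \<longlonglongrightarrow> L2_inner \<Omega> v w" if "w \<in> L2 \<Omega>" for w
    by (rule L2_inner_tendsto_left[OF TL[OF uL] v that Tuv])
  \<comment> \<open>The scalars \<open>M * (T (u (r n)), w)\<close> have two limits:
    \<open>(T v, w)\<close> by \<open>lim_Mu\<close> tested against \<open>T w\<close>, and
    \<open>M * (v, w)\<close> by \<open>lim_Tu\<close>.\<close>
  have "ae_eq \<Omega> (T v) (\<lambda>x. of_real M * v x)"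
    unfolding ae_eq_iff_inner[OF TL[OF v] L2_scale[OF v]]
  proof
    fix w assume w: "w \<in> L2 \<Omega>"
    have "(\<lambda>n. of_real M * L2_inner \<Omega> (T (u (r n))) w) \<longlonglongrightarrow> L2_inner \<Omega> (T v) w"
      using lim_Mu[OF TL[OF w]] by (simp add: sym uL v w)
    moreover have "(\<lambda>n. of_real M * L2_inner \<Omega> (T (u (r n))) w) \<longlonglongrightarrow> of_real M * L2_inner \<Omega> v w"
      by (intro tendsto_mult_left lim_Tu w)
    ultimately show "L2_inner \<Omega> (T v) w = L2_inner \<Omega> (\<lambda>x. of_real M * v x) w"
      unfolding L2_inner_scale_left by (rule LIMSEQ_unique)
  qed
  moreover have "L2_inner \<Omega> v s = 0" if s: "s \<in> S" for s
  proof -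
    have "L2_inner \<Omega> (u n) s = 0" for n using u(1)[of n] s by (simp add: W_def)
    then have "(\<lambda>n. of_real M * L2_inner \<Omega> (u (r n)) s) \<longlonglongrightarrow> 0" by simp
    with lim_Mu[OF S(1)[OF s]] show ?thesis by (rule LIMSEQ_unique)
  qed
  \<comment> \<open>The vectors \<open>M * u (r n)\<close> all have norm \<open>M > 0\<close>, so
    they cannot tend to a null vector.\<close>
  moreover have "L2_norm \<Omega> v \<noteq> 0"
  proof
    assume v0: "L2_norm \<Omega> v = 0"
    have "M \<le> L2_norm \<Omega> (\<lambda>x. of_real M * u (r n) x - v x)" for n
      using L2_norm_triangle_diff3[OF MuL L2_zero v, of "r n"] v0 M_pos
      by (simp add: L2_norm_scale u(2))
    then have "M \<le> 0" by (intro LIMSEQ_le_const[OF Muv]) auto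
    then show False using M_pos by simp
  qed
  ultimately show ?thesis using that v M_pos by (meson less_imp_le)
qed

text \<open>If the form vanishes at \<open>u0\<close>, Cauchy-Schwarz for the form gives
  \<open>T u0 = 0\<close>, so \<open>u0\<close> itself is an eigenvector for 0. Thus eigenvectors in
  the kernel are found as well, and a maximal family is total in all of
  \<open>L2 \<Omega>\<close>.\<close>

lemma L2_compact_positive_eigenvector:
  assumes comp: "L2_compact_operator \<Omega> T" and T: "L2_positive_operator \<Omega> T"
    and S: "\<And>s. s \<in> S \<Longrightarrow> s \<in> L2 \<Omega>" "\<And>s. s \<in> S \<Longrightarrow> ae_eq \<Omega> (T s) (\<lambda>x. of_real (l s) * s x)"
    and u0: "u0 \<in> L2 \<Omega>" "\<And>s. s \<in> S \<Longrightarrow> L2_inner \<Omega> u0 s = 0" "L2_norm \<Omega> u0 \<noteq> 0"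
  obtains v M where "v \<in> L2 \<Omega>" "L2_norm \<Omega> v = 1" "\<And>s. s \<in> S \<Longrightarrow> L2_inner \<Omega> v s = 0"
    "0 \<le> M" "ae_eq \<Omega> (T v) (\<lambda>x. of_real M * v x)"
proof -
  have "\<exists>v M. v \<in> L2 \<Omega> \<and> L2_norm \<Omega> v \<noteq> 0 \<and> (\<forall>s\<in>S. L2_inner \<Omega> v s = 0)
    \<and> 0 \<le> M \<and> ae_eq \<Omega> (T v) (\<lambda>x. of_real M * v x)"
  proof (cases "L2_inner \<Omega> (T u0) u0 = 0")
    case True
    note Tu0 = L2_positive_operatorD(1)[OF T u0(1)]
    have "cmod (L2_inner \<Omega> (T u0) (T u0)) = 0"
      using L2_positive_operator_Cauchy_Schwarz[OF T u0(1) Tu0] True by simp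
    then have "ae_eq \<Omega> (T u0) (\<lambda>x. 0)"
      by (simp add: ae_eq_iff_L2_norm[OF Tu0 L2_zero] L2_inner_self)
    then show ?thesis using u0 by (intro exI[of _ u0] exI[of _ 0]) auto
  next
    case False
    from L2_compact_positive_eigenvector_pos[OF comp T S u0(1,2) False] show ?thesis by metis
  qed
  then obtain v M where v: "v \<in> L2 \<Omega>" "L2_norm \<Omega> v \<noteq> 0" "\<forall>s\<in>S. L2_inner \<Omega> v s = 0" "0 \<le> M"
    and eig: "ae_eq \<Omega> (T v) (\<lambda>x. of_real M * v x)" by blast
  note n = L2_normalize_eigenvector[OF T v(1,2) eig]
  from that[OF n(1,2) _ v(4) n(3)] n(4) v(3) show ?thesis by simp
qed

text \<open>Zorn's lemma gives merely a set of eigenfunctions. Separability makes it countable and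
  infinite dimension makes it infinite, so \<open>from_nat_into\<close> enumerates it bijectively by
  \<open>nat\<close>.\<close>

theorem L2_spectral_theorem_compact_positive:
  fixes \<Omega> :: "(real ^ 'd) set"
  assumes \<Omega>: "open \<Omega>" "\<Omega> \<noteq> {}"
    and comp: "L2_compact_operator \<Omega> T" and T: "L2_positive_operator \<Omega> T"
  obtains e :: "nat \<Rightarrow> real ^ 'd \<Rightarrow> complex" and lam :: "nat \<Rightarrow> real"
  where "orthonormal_basis \<Omega> e" "\<And>n. 0 \<le> lam n"
    "\<And>n. ae_eq \<Omega> (T (e n)) (\<lambda>x. of_real (lam n) * e n x)"
proof -
  define \<A> where "\<A> = {S. L2_orthonormal \<Omega> S (\<lambda>s. s) \<and>
    (\<forall>s\<in>S. \<exists>l\<ge>0. ae_eq \<Omega> (T s) (\<lambda>x. of_real (l :: real) * s x))}"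
  have "\<exists>M\<in>\<A>. \<forall>X\<in>\<A>. M \<subseteq> X \<longrightarrow> X = M"
  proof (rule subset_Zorn')
    fix C assume C: "subset.chain \<A> C"
    have "L2_orthonormal \<Omega> (\<Union>C) (\<lambda>s. s)"
      unfolding L2_orthonormal_def
    proof (intro conjI ballI)
      fix s assume "s \<in> \<Union>C"
      then obtain A where A: "A \<in> C" "s \<in> A" by blast
      then have "A \<in> \<A>" using C by (auto simp: subset.chain_def)
      then show "s \<in> L2 \<Omega>" using A(2) by (auto simp: \<A>_def L2_orthonormal_def)
      fix t assume "t \<in> \<Union>C"
      then obtain A' where A': "A' \<in> C" "t \<in> A'" by blast
      \<comment> \<open>Orthonormality compares two functions, so both must be placed in a single
        member of the chain.\<close>
      have "A \<subseteq> A' \<or> A' \<subseteq> A" using C A(1) A'(1) by (auto simp: subset.chain_def)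
      then obtain D where "D \<in> C" "s \<in> D" "t \<in> D" using A A' by blast
      moreover from this have "D \<in> \<A>" using C by (auto simp: subset.chain_def)
      ultimately show "L2_inner \<Omega> s t = (if s = t then 1 else 0)"
        unfolding \<A>_def L2_orthonormal_def by blast
    qed
    moreover have "\<exists>l\<ge>0. ae_eq \<Omega> (T s) (\<lambda>x. of_real (l :: real) * s x)" if "s \<in> \<Union>C" for s
    proof -
      from that obtain A where A: "A \<in> C" "s \<in> A" by blast
      then have "A \<in> \<A>" using C by (auto simp: subset.chain_def)
      then show ?thesis using A(2) by (auto simp: \<A>_def)
    qed
    ultimately show "\<Union>C \<in> \<A>" by (simp add: \<A>_def)
  qed
  then obtain S where S: "S \<in> \<A>" and max: "\<And>X. X \<in> \<A> \<Longrightarrow> S \<subseteq> X \<Longrightarrow> X = S" by blast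
  have on: "L2_orthonormal \<Omega> S (\<lambda>s. s)" using S by (simp add: \<A>_def)
  obtain l where l: "\<And>s. s \<in> S \<Longrightarrow> 0 \<le> l s" "\<And>s. s \<in> S \<Longrightarrow> ae_eq \<Omega> (T s) (\<lambda>x. of_real (l s :: real) * s x)"
    using S unfolding \<A>_def by (auto simp: bchoice_iff)
  note SL = L2_orthonormalD(1)[OF on]
  have total: "L2_norm \<Omega> u = 0" if u: "u \<in> L2 \<Omega>" "\<And>s. s \<in> S \<Longrightarrow> L2_inner \<Omega> u s = 0" for u
  proof (rule ccontr)
    assume "L2_norm \<Omega> u \<noteq> 0"
    from L2_compact_positive_eigenvector[OF comp T SL l(2) u this]
    obtain v M where v: "v \<in> L2 \<Omega>" "L2_norm \<Omega> v = 1" "\<And>s. s \<in> S \<Longrightarrow> L2_inner \<Omega> v s = 0"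
      "0 \<le> M" "ae_eq \<Omega> (T v) (\<lambda>x. of_real M * v x)" by metis
    have vv: "L2_inner \<Omega> v v = 1" by (simp add: L2_inner_self v(2))
    then have "v \<notin> S" using v(3)[of v] by auto
    have vs: "L2_inner \<Omega> s v = 0" if "s \<in> S" for s
      using v(3)[OF that] by (simp add: L2_inner_commute[of \<Omega> s])
    have "L2_orthonormal \<Omega> (insert v S) (\<lambda>s. s)"
      using on v(1,3) vv vs \<open>v \<notin> S\<close> unfolding L2_orthonormal_def by auto
    moreover have "\<forall>s\<in>insert v S. \<exists>l\<ge>0. ae_eq \<Omega> (T s) (\<lambda>x. of_real (l :: real) * s x)"
      using v(4,5) l by blast
    ultimately have "insert v S \<in> \<A>" by (simp add: \<A>_def)
    from max[OF this] \<open>v \<notin> S\<close> show False by blast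
  qed
  have "countable S" using \<Omega>(1) by (intro countable_L2_orthonormal[OF _ on]) simp
  moreover have "infinite S" by (rule infinite_total_L2_orthonormal[OF \<Omega> on total])
  ultimately have bij: "bij_betw (from_nat_into S) UNIV S" by (rule bij_betw_from_nat_into)
  define e where "e = from_nat_into S"
  have eS: "e n \<in> S" for n using bij unfolding e_def by (auto simp: bij_betw_def)
  have inj: "e m = e n \<longleftrightarrow> m = n" for m n
    using bij unfolding e_def bij_betw_def by (auto simp: inj_on_def)
  have surj: "\<exists>n. s = e n" if "s \<in> S" for s using that bij unfolding e_def bij_betw_def by blast
  have "orthonormal_basis \<Omega> e"
  proof (rule total_orthonormal_imp_basis)
    show "L2_orthonormal \<Omega> UNIV e"
      unfolding L2_orthonormal_def using SL[OF eS] L2_orthonormalD(2)[OF on eS eS] by (simp add: inj)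
    fix u assume u: "u \<in> L2 \<Omega>" and "\<And>n. L2_inner \<Omega> u (e n) = 0"
    then show "L2_norm \<Omega> u = 0" using surj by (intro total[OF u]) auto
  qed
  from that[OF this, of "\<lambda>n. l (e n)"] l eS show ?thesis by blast
qed

section \<open>Weak limits, Dini and mollifiers\<close>

lemma l2_weak_limit_bound:
  fixes a :: "nat \<Rightarrow> nat \<Rightarrow> complex"
  assumes lim: "\<And>n. (\<lambda>k. a k n) \<longlonglongrightarrow> \<alpha> n"
    and bound: "\<And>k N. (\<Sum>n<N. (cmod (a k n))\<^sup>2) \<le> C"
  shows "(\<Sum>n<N. (cmod (\<alpha> n))\<^sup>2) \<le> C"
proof (rule LIMSEQ_le_const2)
  show "(\<lambda>k. \<Sum>n<N. (cmod (a k n))\<^sup>2) \<longlonglongrightarrow> (\<Sum>n<N. (cmod (\<alpha> n))\<^sup>2)"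
    by (intro tendsto_intros lim)
qed (use bound in auto)

lemma summable_l2_mult:
  fixes a b :: "nat \<Rightarrow> complex"
  assumes "summable (\<lambda>n. (cmod (a n))\<^sup>2)" "summable (\<lambda>n. (cmod (b n))\<^sup>2)"
  shows "summable (\<lambda>n. a n * b n)"
proof (rule summable_comparison_test'[OF summable_add[OF assms]])
  fix n
  show "norm (a n * b n) \<le> (cmod (a n))\<^sup>2 + (cmod (b n))\<^sup>2"
    using sum_squares_bound[of "cmod (a n)" "cmod (b n)"]
      mult_nonneg_nonneg[OF norm_ge_zero norm_ge_zero, of "a n" "b n"]
    unfolding norm_mult by linarith
qed

text \<open>A bounded, coordinatewise convergent sequence converges weakly: a finite head converges
  termwise, and Cauchy-Schwarz makes the tail small uniformly in \<open>k\<close>, since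
  \<open>b\<close> has small tails.\<close>

lemma l2_weak_limit:
  fixes a :: "nat \<Rightarrow> nat \<Rightarrow> complex"
  assumes lim: "\<And>n. (\<lambda>k. a k n) \<longlonglongrightarrow> \<alpha> n"
    and bound: "\<And>k N. (\<Sum>n<N. (cmod (a k n))\<^sup>2) \<le> C"
    and b: "summable (\<lambda>n. (cmod (b n))\<^sup>2)"
  shows "(\<lambda>k. \<Sum>n. a k n * b n) \<longlonglongrightarrow> (\<Sum>n. \<alpha> n * b n)"
proof (rule LIMSEQ_I)
  fix \<epsilon> :: real assume \<epsilon>: "\<epsilon> > 0"
  note bound' = l2_weak_limit_bound[OF lim bound]
  have C: "0 \<le> C" using bound[of 0 0] by simp
  have sa: "summable (\<lambda>n. a k n * b n)" for k
    by (intro summable_l2_mult b summableI_nonneg_bounded[where x = C]) (use bound in auto)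
  have s\<alpha>: "summable (\<lambda>n. \<alpha> n * b n)"
    by (intro summable_l2_mult b summableI_nonneg_bounded[where x = C]) (use bound' in auto)
  define D where "D k n = a k n - \<alpha> n" for k n
  \<comment> \<open>\<open>C\<close> bounds the squared sums of both \<open>a k\<close> and its
    limit \<open>\<alpha>\<close>; the squared triangle inequality costs a factor 2 for
    each.\<close>
  have D_bound: "(\<Sum>n\<in>{N..<M}. (cmod (D k n))\<^sup>2) \<le> 4 * C" for k N M
  proof -
    have "(cmod (D k n))\<^sup>2 \<le> 2 * (cmod (a k n))\<^sup>2 + 2 * (cmod (\<alpha> n))\<^sup>2" for n
    proof -
      have "(cmod (D k n))\<^sup>2 \<le> (cmod (a k n) + cmod (\<alpha> n))\<^sup>2"
        unfolding D_def by (intro power_mono norm_triangle_ineq4) auto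
      also have "\<dots> \<le> 2 * (cmod (a k n))\<^sup>2 + 2 * (cmod (\<alpha> n))\<^sup>2"
        using sum_squares_bound[of "cmod (a k n)" "cmod (\<alpha> n)"] by (simp add: power2_sum)
      finally show ?thesis .
    qed
    then have "(\<Sum>n\<in>{N..<M}. (cmod (D k n))\<^sup>2)
        \<le> (\<Sum>n\<in>{N..<M}. 2 * (cmod (a k n))\<^sup>2 + 2 * (cmod (\<alpha> n))\<^sup>2)"
      by (intro sum_mono)
    also have "\<dots> \<le> (\<Sum>n<M. 2 * (cmod (a k n))\<^sup>2 + 2 * (cmod (\<alpha> n))\<^sup>2)"
      by (intro sum_mono2) auto
    also have "\<dots> \<le> 4 * C"
      using bound[of k M] bound'[of M] by (simp add: sum.distrib flip: sum_distrib_left)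
    finally show ?thesis .
  qed
  \<comment> \<open>Chosen so that \<open>sqrt (4 * C) * \<eta> \<le> \<epsilon> / 2\<close>; adding
    1 covers \<open>C = 0\<close>.\<close>
  define \<eta> where "\<eta> = \<epsilon> / (2 * (sqrt (4 * C) + 1))"
  have \<eta>: "\<eta> > 0" using \<epsilon> C by (simp add: \<eta>_def add_nonneg_pos)
  obtain N where N: "\<And>m M. m \<ge> N \<Longrightarrow> norm (\<Sum>n\<in>{m..<M}. (cmod (b n))\<^sup>2) < \<eta>\<^sup>2"
    using b \<eta> unfolding summable_Cauchy by (metis zero_less_power)
  have tail: "cmod (\<Sum>n\<in>{N..<M}. D k n * b n) \<le> \<epsilon> / 2" for k M
  proof -
    have "cmod (\<Sum>n\<in>{N..<M}. D k n * b n) \<le> (\<Sum>n\<in>{N..<M}. \<bar>cmod (D k n)\<bar> * \<bar>cmod (b n)\<bar>)"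
      by (rule order_trans[OF norm_sum]) (simp add: norm_mult)
    also have "\<dots> \<le> L2_set (\<lambda>n. cmod (D k n)) {N..<M} * L2_set (\<lambda>n. cmod (b n)) {N..<M}"
      by (rule L2_set_mult_ineq)
    also have "\<dots> \<le> sqrt (4 * C) * \<eta>"
    proof (intro mult_mono)
      show "L2_set (\<lambda>n. cmod (D k n)) {N..<M} \<le> sqrt (4 * C)"
        unfolding L2_set_def using D_bound by (intro real_sqrt_le_mono)
      show "L2_set (\<lambda>n. cmod (b n)) {N..<M} \<le> \<eta>"
        unfolding L2_set_def using N[of N M] \<eta> by (intro real_le_lsqrt) (auto intro: sum_nonneg)
    qed (use C in auto)
    also have "\<dots> \<le> (sqrt (4 * C) + 1) * \<eta>" using \<eta> by (intro mult_right_mono) auto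
    also have "\<dots> = \<epsilon> / 2"
    proof -
      have "sqrt (4 * C) + 1 \<noteq> 0" using C by (smt (verit) real_sqrt_ge_zero)
      then show ?thesis unfolding \<eta>_def by (simp add: field_simps)
    qed
    finally show ?thesis .
  qed
  have split: "cmod ((\<Sum>n. a k n * b n) - (\<Sum>n. \<alpha> n * b n)) \<le> cmod (\<Sum>n<N. D k n * b n) + \<epsilon> / 2" for k
  proof -
    have sD: "(\<lambda>M. \<Sum>n<M. D k n * b n) \<longlonglongrightarrow> (\<Sum>n. a k n * b n) - (\<Sum>n. \<alpha> n * b n)"
      unfolding D_def left_diff_distrib using summable_sums[OF sa] summable_sums[OF s\<alpha>]
      by (intro sums_diff[unfolded sums_def]) (auto simp: sums_def)
    show ?thesis
    proof (rule LIMSEQ_le_const2[OF tendsto_norm[OF sD]], intro exI allI impI)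
      fix M assume "N \<le> M"
      then have "(\<Sum>n<M. D k n * b n) = (\<Sum>n<N. D k n * b n) + (\<Sum>n\<in>{N..<M}. D k n * b n)"
        by (simp add: lessThan_atLeast0 sum.atLeastLessThan_concat)
      then show "cmod (\<Sum>n<M. D k n * b n) \<le> cmod (\<Sum>n<N. D k n * b n) + \<epsilon> / 2"
        using norm_triangle_ineq[of "\<Sum>n<N. D k n * b n" "\<Sum>n\<in>{N..<M}. D k n * b n"] tail[of k M]
        by simp
    qed
  qed
  have "(\<lambda>k. \<Sum>n<N. D k n * b n) \<longlonglongrightarrow> (\<Sum>n<N. (\<alpha> n - \<alpha> n) * b n)"
    unfolding D_def by (intro tendsto_intros lim)
  then have "(\<lambda>k. \<Sum>n<N. D k n * b n) \<longlonglongrightarrow> 0" by simp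
  from LIMSEQ_D[OF this, of "\<epsilon> / 2"] \<epsilon>
  obtain k0 where k0: "\<And>k. k \<ge> k0 \<Longrightarrow> cmod (\<Sum>n<N. D k n * b n) < \<epsilon> / 2" by auto
  have "cmod ((\<Sum>n. a k n * b n) - (\<Sum>n. \<alpha> n * b n)) < \<epsilon>" if "k \<ge> k0" for k
    using split[of k] k0[OF that] by linarith
  then show "\<exists>k0. \<forall>k\<ge>k0. cmod ((\<Sum>n. a k n * b n) - (\<Sum>n. \<alpha> n * b n)) < \<epsilon>" by blast
qed

text \<open>If uniformity fails, points \<open>x N\<close> with a gap of at least
  \<open>\<epsilon>\<close> accumulate at some \<open>y\<close>. Monotonicity spreads the gap at
  \<open>x N\<close> to every earlier index, so for fixed \<open>n\<close> continuity carries it to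
  \<open>y\<close>, against pointwise convergence there.\<close>

lemma Dini_uniform_limit:
  fixes f :: "nat \<Rightarrow> 'a::metric_space \<Rightarrow> real"
  assumes A: "compact A" and f: "\<And>n. continuous_on A (f n)" and g: "continuous_on A g"
    and mono: "\<And>x. x \<in> A \<Longrightarrow> incseq (\<lambda>n. f n x)"
    and lim: "\<And>x. x \<in> A \<Longrightarrow> (\<lambda>n. f n x) \<longlonglongrightarrow> g x"
  shows "uniform_limit A f g sequentially"
proof (rule ccontr)
  assume "\<not> uniform_limit A f g sequentially"
  then obtain \<epsilon> where \<epsilon>: "\<epsilon> > 0" and "\<And>N. \<exists>n\<ge>N. \<exists>x\<in>A. \<not> dist (f n x) (g x) < \<epsilon>"
    unfolding uniform_limit_sequentially_iff by blast
  then obtain m x where m: "\<And>N. m N \<ge> N" and x: "\<And>N. x N \<in> A"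
    and far: "\<And>N. \<not> dist (f (m N) (x N)) (g (x N)) < \<epsilon>"
    by metis
  have le: "f n y \<le> g y" if "y \<in> A" for n y
    using incseq_le[OF mono lim] that by blast
  have gap: "\<epsilon> \<le> g (x N) - f n (x N)" if "n \<le> N" for n N
  proof -
    have "f n (x N) \<le> f (m N) (x N)"
      using mono[OF x] m[of N] that by (auto simp: incseq_def)
    then show ?thesis using far[of N] le[OF x, of "m N" N] by (simp add: dist_real_def)
  qed
  obtain y r where y: "y \<in> A" and r: "strict_mono r" and xy: "(x \<circ> r) \<longlonglongrightarrow> y"
    using A x unfolding compact_def by metis
  have gap_y: "\<epsilon> \<le> g y - f n y" for n
  proof (rule LIMSEQ_le_const)
    have "continuous_on A (\<lambda>z. g z - f n z)" by (intro continuous_intros f g)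
    from continuous_on_tendsto_compose[OF this xy y]
    show "(\<lambda>k. g (x (r k)) - f n (x (r k))) \<longlonglongrightarrow> g y - f n y" using x by (simp add: o_def)
    show "\<exists>N. \<forall>k\<ge>N. \<epsilon> \<le> g (x (r k)) - f n (x (r k))"
      using gap seq_suble[OF r] order_trans by blast
  qed
  moreover obtain n where "dist (f n y) (g y) < \<epsilon>"
    using tendstoD[OF lim[OF y] \<epsilon>] by (auto simp: eventually_sequentially)
  moreover have "f n y \<le> g y" by (rule le[OF y])
  ultimately show False using gap_y[of n] by (simp add: dist_real_def)
qed

section \<open>Mollifiers and their averages\<close>

text \<open>The support lies in a compact subset of \<open>V\<close>, not merely in
  \<open>V\<close>, so that for \<open>V \<subseteq> \<Omega>\<close> the function belongs to
  \<open>C_c \<Omega>\<close>. Real values make conjugation trivial in inner products.\<close>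

definition mollifier :: "(real ^ 'd) set \<Rightarrow> (real ^ 'd) set \<Rightarrow> (real ^ 'd \<Rightarrow> real) \<Rightarrow> bool" where
  "mollifier \<Omega> V w \<longleftrightarrow> continuous_on UNIV w \<and> (\<forall>x. 0 \<le> w x) \<and>
     (\<exists>D. compact D \<and> D \<subseteq> V \<and> (\<forall>x. x \<notin> D \<longrightarrow> w x = 0)) \<and> (\<integral>x. w x \<partial>lebesgue_on \<Omega>) = 1"

lemma integrable_lebesgue_on_compact_support:
  fixes f :: "real ^ 'd \<Rightarrow> 'b::{banach, second_countable_topology}"
  assumes \<Omega>: "open \<Omega>" and f: "continuous_on \<Omega> f" and D: "compact D" "D \<subseteq> \<Omega>"
    and supp: "\<And>x. x \<notin> D \<Longrightarrow> f x = 0"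
  shows "integrable (lebesgue_on \<Omega>) f"
proof -
  have "compact (f ` D)"
    using f D by (intro compact_continuous_image) (auto intro: continuous_on_subset)
  then have "bounded (f ` D)" by (rule compact_imp_bounded)
  then obtain B where B: "\<And>x. x \<in> D \<Longrightarrow> norm (f x) \<le> B"
    unfolding bounded_iff by blast
  have "norm (f x) \<le> max 0 B" for x using B[of x] supp[of x] by (cases "x \<in> D") auto
  then show ?thesis
    using \<Omega> f D supp
    by (intro integrable_lebesgue_on_bounded_support[where A = D and B = "max 0 B"]
        continuous_imp_measurable_on_sets_lebesgue borel_compact compact_imp_bounded) auto
qed

lemma mollifier_exists:
  fixes \<Omega> V :: "(real ^ 'd) set"
  assumes \<Omega>: "open \<Omega>" and V: "open V" "V \<noteq> {}" "V \<subseteq> \<Omega>"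
  obtains w where "mollifier \<Omega> V w"
proof -
  obtain p \<rho> where \<rho>: "\<rho> > 0" and D: "cball p \<rho> \<subseteq> V"
    using V open_contains_cball by blast
  \<comment> \<open>A tent over the ball, positive exactly inside it; dividing by its integral gives
    mass one.\<close>
  define f where "f x = max 0 (\<rho> - dist p x)" for x
  have f_cont: "continuous_on A f" for A unfolding f_def by (intro continuous_intros)
  have f_nonneg: "0 \<le> f x" for x by (simp add: f_def)
  have f_supp: "f x = 0" if "x \<notin> cball p \<rho>" for x using that by (simp add: f_def)
  have f_int: "integrable (lebesgue_on \<Omega>) f"
    using D V(3) f_supp
    by (intro integrable_lebesgue_on_compact_support[OF \<Omega> f_cont, of "cball p \<rho>"]) auto
  define I where "I = (\<integral>x. f x \<partial>lebesgue_on \<Omega>)"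
  have "I \<noteq> 0"
  proof
    assume "I = 0"
    then have "AE x in lebesgue_on \<Omega>. f x = 0"
      using integral_nonneg_eq_0_iff_AE[OF f_int] f_nonneg by (simp add: I_def)
    moreover have "ball p \<rho> \<subseteq> \<Omega>" using D V(3) ball_subset_cball by blast
    ultimately obtain x where "x \<in> ball p \<rho>" "f x = 0"
      using AE_lebesgue_on_open_imp_ex[of \<Omega> "ball p \<rho>" "\<lambda>x. f x = 0"] \<Omega> \<rho> by auto
    then show False by (simp add: f_def)
  qed
  moreover have "I \<ge> 0" unfolding I_def by (intro integral_nonneg_AE) (simp add: f_nonneg)
  ultimately have "I > 0" by simp
  then have "mollifier \<Omega> V (\<lambda>x. f x / I)"
    unfolding mollifier_def using D f_supp f_nonneg
    by (auto intro!: continuous_intros f_cont exI[of _ "cball p \<rho>"] simp: I_def[symmetric])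
  then show ?thesis by (rule that)
qed

lemma mollifier_C_c:
  assumes V: "V \<subseteq> \<Omega>" and w: "mollifier \<Omega> V w"
  shows "(\<lambda>x. complex_of_real (w x)) \<in> C_c \<Omega>"
proof -
  obtain D where D: "compact D" "D \<subseteq> V" "\<And>x. x \<notin> D \<Longrightarrow> w x = 0"
    using w unfolding mollifier_def by blast
  let ?S = "closure {x\<in>\<Omega>. complex_of_real (w x) \<noteq> 0}"
  have SD: "?S \<subseteq> D" using D by (intro closure_minimal compact_imp_closed) auto
  moreover have "compact ?S"
    using compact_Int_closed[OF D(1) closed_closure, of "{x\<in>\<Omega>. complex_of_real (w x) \<noteq> 0}"] SD
    by (simp only: inf.absorb2)
  moreover have "continuous_on \<Omega> (\<lambda>x. complex_of_real (w x))"
    using w unfolding mollifier_def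
    by (intro continuous_on_of_real) (auto intro: continuous_on_subset)
  ultimately show ?thesis using V D(2) unfolding C_c_def by auto
qed

lemma mollifier_integrable:
  assumes \<Omega>: "open \<Omega>" and V: "V \<subseteq> \<Omega>" and w: "mollifier \<Omega> V w"
    and h: "continuous_on \<Omega> (h :: real ^ 'd \<Rightarrow> complex)"
  shows "integrable (lebesgue_on \<Omega>) (\<lambda>x. h x * of_real (w x))"
proof -
  obtain D where D: "compact D" "D \<subseteq> V" "\<And>x. x \<notin> D \<Longrightarrow> w x = 0"
    using w unfolding mollifier_def by blast
  have "continuous_on \<Omega> w"
    using w unfolding mollifier_def by (auto intro: continuous_on_subset)
  then show ?thesis
    using D V h by (intro integrable_lebesgue_on_compact_support[OF \<Omega>, of _ D] continuous_intros) auto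
qed

lemma mollifier_L2:
  assumes \<Omega>: "open \<Omega>" and V: "V \<subseteq> \<Omega>" and w: "mollifier \<Omega> V w"
  shows "(\<lambda>x. complex_of_real (w x)) \<in> L2 \<Omega>"
proof (rule L2_I)
  have cont: "continuous_on \<Omega> (\<lambda>x. complex_of_real (w x))"
    using w unfolding mollifier_def
    by (intro continuous_on_of_real) (auto intro: continuous_on_subset)
  then show "(\<lambda>x. complex_of_real (w x)) \<in> borel_measurable (lebesgue_on \<Omega>)"
    using \<Omega> by (intro continuous_imp_measurable_on_sets_lebesgue) auto
  have "integrable (lebesgue_on \<Omega>) (\<lambda>x. cmod (of_real (w x) * of_real (w x)))"
    by (intro integrable_norm mollifier_integrable[OF assms cont])
  then show "integrable (lebesgue_on \<Omega>) (\<lambda>x. (cmod (complex_of_real (w x)))\<^sup>2)"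
    by (simp add: norm_mult power2_eq_square)
qed

text \<open>Mass one makes \<open>c\<close> its own average, so the error is an average of
  \<open>h - c\<close> over the support, where it is at most \<open>\<epsilon>\<close>.\<close>

lemma mollifier_average:
  assumes \<Omega>: "open \<Omega>" and V: "V \<subseteq> \<Omega>" and w: "mollifier \<Omega> V w"
    and h: "continuous_on \<Omega> (h :: real ^ 'd \<Rightarrow> complex)"
    and close: "\<And>x. x \<in> V \<Longrightarrow> cmod (h x - c) \<le> \<epsilon>"
  shows "cmod ((\<integral>x. h x * of_real (w x) \<partial>lebesgue_on \<Omega>) - c) \<le> \<epsilon>"
proof -
  obtain D where D: "compact D" "D \<subseteq> V" "\<And>x. x \<notin> D \<Longrightarrow> w x = 0"
    using w unfolding mollifier_def by blast
  have w_nonneg: "0 \<le> w x" for x using w by (simp add: mollifier_def)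
  have w_int: "(\<integral>x. w x \<partial>lebesgue_on \<Omega>) = 1" using w by (simp add: mollifier_def)
  note int = mollifier_integrable[OF \<Omega> V w]
  \<comment> \<open>A non-integrable function has integral 0 by convention, so integral 1 already
    forces integrability.\<close>
  have w_int': "integrable (lebesgue_on \<Omega>) w"
    by (rule ccontr) (use w_int not_integrable_integral_eq[of "lebesgue_on \<Omega>" w] in simp)
  have c_int: "(\<integral>x. c * of_real (w x) \<partial>lebesgue_on \<Omega>) = c"
    using w_int by simp
  have "(\<integral>x. h x * of_real (w x) \<partial>lebesgue_on \<Omega>) - c
      = (\<integral>x. h x * of_real (w x) - c * of_real (w x) \<partial>lebesgue_on \<Omega>)"
    by (subst Bochner_Integration.integral_diff[OF int[OF h] int[OF continuous_on_const]])
      (simp only: c_int)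
  also have "cmod \<dots> \<le> (\<integral>x. \<epsilon> * w x \<partial>lebesgue_on \<Omega>)"
  proof (rule order_trans[OF integral_norm_bound], rule integral_mono)
    show "integrable (lebesgue_on \<Omega>) (\<lambda>x. norm (h x * of_real (w x) - c * of_real (w x)))"
      by (intro integrable_norm Bochner_Integration.integrable_diff int h continuous_on_const)
    show "integrable (lebesgue_on \<Omega>) (\<lambda>x. \<epsilon> * w x)" using w_int' by simp
    fix x
    have "norm (h x * of_real (w x) - c * of_real (w x)) = cmod (h x - c) * w x"
      using w_nonneg[of x] by (simp add: norm_mult flip: left_diff_distrib)
    also have "\<dots> \<le> \<epsilon> * w x"
      using close[of x] D(2,3) w_nonneg[of x] by (cases "x \<in> D") (auto intro: mult_right_mono)
    finally show "norm (h x * of_real (w x) - c * of_real (w x)) \<le> \<epsilon> * w x" .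
  qed
  also have "\<dots> = \<epsilon>" using w_int by simp
  finally show ?thesis .
qed

section \<open>The Mercer expansion\<close>

lemma sum_le_sums:
  fixes f :: "nat \<Rightarrow> real"
  assumes f: "f sums s" and nonneg: "\<And>n. 0 \<le> f n"
  shows "(\<Sum>n<N. f n) \<le> s"
  unfolding sums_unique[OF f] using sums_summable[OF f] nonneg by (intro sum_le_suminf) auto

text \<open>If \<open>lam\<close> is summable, \<open>T\<close> serves as its own absolute value and
  \<open>e\<close> as the test basis. Conversely both the root \<open>A\<close> and the basis
  \<open>f\<close> are arbitrary: \<open>A\<close> is first shown to have the eigenpairs of
  \<open>T\<close>, then its trace along \<open>f\<close> is compared with the partial sums of
  \<open>lam\<close>.\<close>

lemma L2_trace_class_iff:
  assumes T: "L2_positive_operator \<Omega> T" and e: "orthonormal_basis \<Omega> e"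
    and nonneg: "\<And>n. 0 \<le> lam n"
    and eig: "\<And>n. ae_eq \<Omega> (T (e n)) (\<lambda>x. of_real (lam n) * e n x)"
  shows "L2_trace_class \<Omega> T \<longleftrightarrow> summable lam"
proof
  note eL = L2_orthonormalD(1)[OF orthonormal_basis_imp_orthonormal[OF e] UNIV_I]
  note e_inner = L2_orthonormalD(2)[OF orthonormal_basis_imp_orthonormal[OF e] UNIV_I UNIV_I]
  note TL = L2_positive_operatorD(1)[OF T] and sym = L2_positive_operatorD(2)[OF T]
  have inner_Te: "L2_inner \<Omega> (T (e n)) v = of_real (lam n) * L2_inner \<Omega> (e n) v" if "v \<in> L2 \<Omega>" for n v
    using L2_inner_cong_ae(1)[OF TL[OF eL] L2_scale[OF eL] eig that] by (simp add: L2_inner_scale_left)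
  {
    assume summ: "summable lam"
    have "L2_inner \<Omega> (T (T u)) v = L2_inner \<Omega> (T u) (T v)" if "u \<in> L2 \<Omega>" "v \<in> L2 \<Omega>" for u v
      by (rule sym[OF TL[OF that(1)] that(2)])
    then have "L2_abs_operator \<Omega> T T" using T by (simp add: L2_abs_operator_def)
    moreover have "Re (L2_inner \<Omega> (T (e n)) (e n)) = lam n" for n
      by (simp add: inner_Te[OF eL] e_inner)
    ultimately show "L2_trace_class \<Omega> T"
      using T e summ unfolding L2_trace_class_def
      by (intro conjI exI[of _ T] exI[of _ e]) (auto simp: L2_positive_operator_def)
  }
  assume "L2_trace_class \<Omega> T"
  then obtain A f where A: "L2_positive_operator \<Omega> A"
    and AA: "\<And>u v. u \<in> L2 \<Omega> \<Longrightarrow> v \<in> L2 \<Omega> \<Longrightarrow> L2_inner \<Omega> (A (A u)) v = L2_inner \<Omega> (T u) (T v)"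
    and f: "orthonormal_basis \<Omega> f" and summ: "summable (\<lambda>n. Re (L2_inner \<Omega> (A (f n)) (f n)))"
    unfolding L2_trace_class_def L2_abs_operator_def by blast
  note fL = L2_orthonormalD(1)[OF orthonormal_basis_imp_orthonormal[OF f] UNIV_I]
  note AL = L2_positive_operatorD(1)[OF A] and Asym = L2_positive_operatorD(2)[OF A]
  have AAe: "L2_inner \<Omega> (A (A (e n))) v = of_real ((lam n)\<^sup>2) * L2_inner \<Omega> (e n) v" if v: "v \<in> L2 \<Omega>" for n v
    using inner_Te[OF TL[OF v], of n] inner_Te[OF v, of n]
    by (simp add: AA[OF eL v] sym[OF eL v, symmetric] power2_eq_square)
  \<comment> \<open>\<open>w = A e - \<lambda> e\<close> satisfies \<open>(A + \<lambda>) w = (A\<^sup>2 - \<lambda>\<^sup>2) e = 0\<close>, and \<open>A \<ge> 0\<close>.\<close>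
  have Ae: "ae_eq \<Omega> (A (e n)) (\<lambda>x. of_real (lam n) * e n x)" for n
  proof -
    let ?le = "\<lambda>x. of_real (lam n) * e n x"
    let ?w = "\<lambda>x. A (e n) x - ?le x"
    have le: "?le \<in> L2 \<Omega>" by (intro L2_scale eL)
    have w: "?w \<in> L2 \<Omega>" by (intro L2_diff AL eL le)
    have "L2_norm \<Omega> ?w = 0"
    proof (cases "lam n = 0")
      case True
      \<comment> \<open>The argument via \<open>lam n * (L2_norm \<Omega> ?w)^2 \<le> 0\<close> says
        nothing for \<open>lam n = 0\<close>; here symmetry and \<open>A (A (e n)) = 0\<close> give
        \<open>A (e n) = 0\<close> directly.\<close>
      have "L2_inner \<Omega> (A (e n)) (A (e n)) = 0"
        using AAe[OF eL, of n n] True by (simp add: Asym[OF AL[OF eL] eL])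
      then show ?thesis using True by (simp add: L2_inner_self)
    next
      case False
      have "L2_inner \<Omega> (A ?w) ?w = L2_inner \<Omega> ?w (A ?w)" by (rule Asym[OF w w])
      also have "\<dots> = L2_inner \<Omega> (A (e n)) (A ?w) - of_real (lam n) * L2_inner \<Omega> (e n) (A ?w)"
        by (simp only: L2_inner_diff_left[OF AL[OF eL] le AL[OF w]] L2_inner_scale_left)
      also have "L2_inner \<Omega> (A (e n)) (A ?w) = of_real ((lam n)\<^sup>2) * L2_inner \<Omega> (e n) ?w"
        by (simp only: Asym[OF AL[OF eL] w, symmetric] AAe[OF w])
      also have "L2_inner \<Omega> (e n) (A ?w) = L2_inner \<Omega> (A (e n)) ?w"
        by (simp only: Asym[OF eL w])
      also have "of_real ((lam n)\<^sup>2) * L2_inner \<Omega> (e n) ?w - of_real (lam n) * L2_inner \<Omega> (A (e n)) ?w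
          = - of_real (lam n) * L2_inner \<Omega> ?w ?w"
        by (simp add: L2_inner_diff_left[OF AL[OF eL] le w] L2_inner_scale_left
            power2_eq_square algebra_simps)
      also have "\<dots> = of_real (- (lam n * (L2_norm \<Omega> ?w)\<^sup>2))"
        by (simp add: L2_inner_self)
      finally have "Re (L2_inner \<Omega> (A ?w) ?w) = - (lam n * (L2_norm \<Omega> ?w)\<^sup>2)"
        by (simp only: Re_complex_of_real)
      with L2_positive_operatorD(4)[OF A w] have "lam n * (L2_norm \<Omega> ?w)\<^sup>2 \<le> 0" by simp
      then show ?thesis using False nonneg[of n] by (simp add: mult_le_0_iff)
    qed
    then show ?thesis by (simp add: ae_eq_iff_L2_norm[OF AL[OF eL] le])
  qed
  have A_form: "(\<lambda>n. lam n * (cmod (L2_inner \<Omega> u (e n)))\<^sup>2) sums Re (L2_inner \<Omega> (A u) u)"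
    if u: "u \<in> L2 \<Omega>" for u
  proof -
    have "L2_inner \<Omega> (e n) (A u) = of_real (lam n) * L2_inner \<Omega> (e n) u" for n
      using L2_inner_cong_ae(1)[OF AL[OF eL] L2_scale[OF eL] Ae u]
      by (simp add: Asym[OF eL u] L2_inner_scale_left)
    then have "L2_inner \<Omega> u (e n) * L2_inner \<Omega> (e n) (A u)
        = of_real (lam n * (cmod (L2_inner \<Omega> u (e n)))\<^sup>2)" for n
      by (simp add: L2_inner_commute[of \<Omega> _ u] flip: complex_norm_square)
    then have "(\<lambda>n. complex_of_real (lam n * (cmod (L2_inner \<Omega> u (e n)))\<^sup>2)) sums L2_inner \<Omega> (A u) u"
      using orthonormal_basis_Parseval_inner[OF e u AL[OF u]] by (simp add: Asym[OF u u] del: of_real_mult)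
    from sums_Re[OF this] show ?thesis by (simp only: Re_complex_of_real)
  qed
  show "summable lam"
  proof (rule summableI_nonneg_bounded[OF nonneg])
    fix N
    \<comment> \<open>Parseval for each unit vector \<open>e n\<close> in the basis
      \<open>f\<close>. Only finitely many \<open>n\<close> occur, so the sums can be
      exchanged.\<close>
    have "(\<lambda>m. \<Sum>n<N. lam n * (cmod (L2_inner \<Omega> (e n) (f m)))\<^sup>2) sums (\<Sum>n<N. lam n * (L2_norm \<Omega> (e n))\<^sup>2)"
      by (intro sums_sum sums_mult orthonormal_basis_Parseval[OF f eL])
    moreover have "(L2_norm \<Omega> (e n))\<^sup>2 = 1" for n
      using e_inner[of n n] by (simp add: L2_inner_self flip: of_real_power)
    ultimately have sums: "(\<lambda>m. \<Sum>n<N. lam n * (cmod (L2_inner \<Omega> (e n) (f m)))\<^sup>2) sums (\<Sum>n<N. lam n)"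
      by simp
    show "(\<Sum>n<N. lam n) \<le> (\<Sum>m. Re (L2_inner \<Omega> (A (f m)) (f m)))"
    proof (rule sums_le[OF _ sums summable_sums[OF summ]])
      fix m
      have "(\<Sum>n<N. lam n * (cmod (L2_inner \<Omega> (f m) (e n)))\<^sup>2) \<le> Re (L2_inner \<Omega> (A (f m)) (f m))"
        using nonneg by (intro sum_le_sums[OF A_form[OF fL]]) auto
      then show "(\<Sum>n<N. lam n * (cmod (L2_inner \<Omega> (e n) (f m)))\<^sup>2) \<le> Re (L2_inner \<Omega> (A (f m)) (f m))"
        by (simp add: L2_inner_commute[of \<Omega> "e _" "f m"])
    qed
  qed
qed

text \<open>The eigenbasis enters as data, already with continuous representatives where
  \<open>lam n \<noteq> 0\<close>. For \<open>lam n = 0\<close> the representative may be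
  discontinuous, and its point values are always multiplied by zero.\<close>

locale mercer =
  fixes \<Omega> X :: "(real ^ 'd) set"
    and K :: "(real ^ 'd) \<times> (real ^ 'd) \<Rightarrow> complex"
    and T :: "(real ^ 'd \<Rightarrow> complex) \<Rightarrow> (real ^ 'd \<Rightarrow> complex)"
    and e :: "nat \<Rightarrow> real ^ 'd \<Rightarrow> complex" and lam :: "nat \<Rightarrow> real"
  assumes open_\<Omega>: "open \<Omega>" and \<Omega>_X: "\<Omega> \<subseteq> X" and X_closure: "X \<subseteq> closure \<Omega>"
    and K_cont: "continuous_on (X \<times> X) K"
    and T: "L2_positive_operator \<Omega> T"
    and T_cont: "u \<in> L2 \<Omega> \<Longrightarrow> \<exists>g. continuous_version \<Omega> X (T u) g"
    and T_kernel: "u \<in> C_c \<Omega> \<Longrightarrow> continuous_version \<Omega> X (T u) g \<Longrightarrow> x \<in> \<Omega> \<Longrightarrow>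
      g x = (\<integral>y. K (x, y) * u y \<partial>lebesgue_on \<Omega>)"
    and basis: "orthonormal_basis \<Omega> e" and lam_nonneg: "0 \<le> lam n"
    and eigen: "ae_eq \<Omega> (T (e n)) (\<lambda>x. of_real (lam n) * e n x)"
    and e_cont: "lam n \<noteq> 0 \<Longrightarrow> continuous_on X (e n)"
begin

lemmas eL = L2_orthonormalD(1)[OF orthonormal_basis_imp_orthonormal[OF basis] UNIV_I]
lemmas TL = L2_positive_operatorD(1)[OF T]
lemmas T_sym = L2_positive_operatorD(2)[OF T]

text \<open>Parseval for \<open>u\<close> and \<open>T v\<close>, with \<open>T\<close> moved back
  onto \<open>e n\<close>. The eigenvalue is split evenly so that each factor can be bounded by the
  form at its own function.\<close>

lemma T_expansion:
  assumes u: "u \<in> L2 \<Omega>" and v: "v \<in> L2 \<Omega>"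
  shows "(\<lambda>n. (of_real (sqrt (lam n)) * L2_inner \<Omega> u (e n)) * (of_real (sqrt (lam n)) * L2_inner \<Omega> (e n) v))
    sums L2_inner \<Omega> (T u) v"
proof -
  have "L2_inner \<Omega> (e n) (T v) = of_real (lam n) * L2_inner \<Omega> (e n) v" for n
    using L2_inner_cong_ae(1)[OF TL[OF eL] L2_scale[OF eL] eigen v]
    by (simp add: T_sym[OF eL v] L2_inner_scale_left)
  moreover have "complex_of_real (lam n) = of_real (sqrt (lam n)) * of_real (sqrt (lam n))" for n
    using lam_nonneg[of n] by (simp flip: of_real_mult)
  ultimately show ?thesis
    using orthonormal_basis_Parseval_inner[OF basis u TL[OF v]] by (simp add: T_sym[OF u v] mult_ac)
qed

text \<open>The bound is the form at \<open>u\<close>, not the norm of \<open>u\<close>; it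
  therefore stays finite when \<open>u\<close> runs through mollifiers concentrating at a
  point.\<close>

lemma T_partial_sum_le:
  assumes u: "u \<in> L2 \<Omega>"
  shows "(\<Sum>n<N. (cmod (of_real (sqrt (lam n)) * L2_inner \<Omega> u (e n)))\<^sup>2) \<le> Re (L2_inner \<Omega> (T u) u)"
proof -
  have "(of_real (sqrt (lam n)) * L2_inner \<Omega> u (e n)) * (of_real (sqrt (lam n)) * L2_inner \<Omega> (e n) u)
      = of_real ((cmod (of_real (sqrt (lam n)) * L2_inner \<Omega> u (e n)))\<^sup>2)" for n
    unfolding complex_norm_square by (simp add: L2_inner_commute[of \<Omega> _ u])
  from sums_Re[OF T_expansion[OF u u, unfolded this]]
  have "(\<lambda>n. (cmod (of_real (sqrt (lam n)) * L2_inner \<Omega> u (e n)))\<^sup>2) sums Re (L2_inner \<Omega> (T u) u)"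
    by (simp only: Re_complex_of_real)
  then show ?thesis by (rule sum_le_sums) simp
qed

text \<open>The inner product is a double average of \<open>K\<close> over \<open>V\<close> and
  \<open>U\<close>: the kernel formula gives the inner average at points of \<open>V\<close>, and
  pairing with \<open>w\<close> gives the outer one.\<close>

lemma T_mollifier_average:
  assumes U: "U \<subseteq> \<Omega>" and u: "mollifier \<Omega> U u" and V: "V \<subseteq> \<Omega>" and w: "mollifier \<Omega> V w"
    and close: "\<And>z z'. z \<in> V \<Longrightarrow> z' \<in> U \<Longrightarrow> cmod (K (z, z') - c) \<le> \<epsilon>"
  shows "cmod (L2_inner \<Omega> (T (\<lambda>x. of_real (u x))) (\<lambda>x. of_real (w x)) - c) \<le> \<epsilon>"
proof -
  let ?u = "\<lambda>x. complex_of_real (u x)"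
  note uL = mollifier_L2[OF open_\<Omega> U u]
  \<comment> \<open>The kernel formula speaks of the continuous version only, so \<open>T ?u\<close>
    is exchanged for \<open>g\<close> under the integral.\<close>
  obtain g where g: "continuous_version \<Omega> X (T ?u) g" using T_cont[OF uL] by blast
  then have g_cont: "continuous_on \<Omega> g" and g_ae: "AE x in lebesgue_on \<Omega>. T ?u x = g x"
    using \<Omega>_X by (auto simp: continuous_version_def ae_eq_def intro: continuous_on_subset)
  have g_close: "cmod (g z - c) \<le> \<epsilon>" if z: "z \<in> V" for z
  proof -
    have "continuous_on \<Omega> (\<lambda>y. K (z, y))"
      using z V \<Omega>_X by (intro continuous_on_compose2[OF K_cont] continuous_intros) auto
    from mollifier_average[OF open_\<Omega> U u this close[OF z]] show ?thesis
      using T_kernel[OF mollifier_C_c[OF U u] g] z V by auto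
  qed
  have "L2_inner \<Omega> (T ?u) (\<lambda>x. of_real (w x)) = (\<integral>x. g x * of_real (w x) \<partial>lebesgue_on \<Omega>)"
    unfolding L2_inner_def
  proof (rule integral_cong_AE)
    show "(\<lambda>x. T ?u x * cnj (of_real (w x))) \<in> borel_measurable (lebesgue_on \<Omega>)"
      using integrable_L2_mult[OF TL[OF uL] mollifier_L2[OF open_\<Omega> V w]]
      by (rule borel_measurable_integrable)
    show "(\<lambda>x. g x * of_real (w x)) \<in> borel_measurable (lebesgue_on \<Omega>)"
      using mollifier_integrable[OF open_\<Omega> V w g_cont] by (rule borel_measurable_integrable)
    show "AE x in lebesgue_on \<Omega>. T ?u x * cnj (of_real (w x)) = g x * of_real (w x)"
      using g_ae by eventually_elim simp
  qed
  then show ?thesis using mollifier_average[OF open_\<Omega> V w g_cont g_close] by simp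
qed

section \<open>Approximate point evaluations at points of \<open>X\<close>\<close>

text \<open>Intersecting with \<open>\<Omega>\<close> permits \<open>x\<close> on the boundary,
  where \<open>K\<close> is continuous but the kernel formula does not apply.\<close>

definition delta_seq :: "real ^ 'd \<Rightarrow> (nat \<Rightarrow> real ^ 'd \<Rightarrow> real) \<Rightarrow> bool" where
  "delta_seq x w \<longleftrightarrow> (\<forall>k. mollifier \<Omega> (ball x (1 / real (Suc k)) \<inter> \<Omega>) (w k))"

lemma delta_seq_exists:
  assumes "x \<in> X"
  obtains w where "delta_seq x w"
proof -
  have "\<exists>w. mollifier \<Omega> (ball x (1 / real (Suc k)) \<inter> \<Omega>) w" for k
  proof -
    have "ball x (1 / real (Suc k)) \<inter> \<Omega> \<noteq> {}"
      using assms X_closure open_Int_closure_eq_empty[of "ball x (1 / real (Suc k))" \<Omega>] by force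
    from mollifier_exists[OF open_\<Omega> open_Int[OF open_ball open_\<Omega>] this inf_le2]
    show ?thesis by blast
  qed
  then show ?thesis using that unfolding delta_seq_def by metis
qed

lemma delta_seq_L2: "delta_seq x w \<Longrightarrow> (\<lambda>y. complex_of_real (w k y)) \<in> L2 \<Omega>"
  unfolding delta_seq_def by (intro mollifier_L2[OF open_\<Omega>, of "ball x (1 / real (Suc k)) \<inter> \<Omega>"]) auto

lemma delta_seq_integral_tendsto:
  assumes x: "x \<in> X" and w: "delta_seq x w" and h: "continuous_on X (h :: real ^ 'd \<Rightarrow> complex)"
  shows "(\<lambda>k. \<integral>y. h y * of_real (w k y) \<partial>lebesgue_on \<Omega>) \<longlonglongrightarrow> h x"
proof (rule LIMSEQ_I)
  fix \<epsilon> :: real assume \<epsilon>: "\<epsilon> > 0"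
  then obtain \<delta> where \<delta>: "\<delta> > 0" "\<And>y. y \<in> X \<Longrightarrow> dist y x < \<delta> \<Longrightarrow> dist (h y) (h x) < \<epsilon> / 2"
    using h[unfolded continuous_on_iff, rule_format, OF x, of "\<epsilon> / 2"] by auto
  obtain k0 where k0: "1 / real (Suc k0) < \<delta>" using nat_approx_posE[OF \<delta>(1)] by blast
  have "norm ((\<integral>y. h y * of_real (w k y) \<partial>lebesgue_on \<Omega>) - h x) < \<epsilon>" if "k \<ge> k0" for k
  proof -
    have "1 / real (Suc k) \<le> 1 / real (Suc k0)" using that by (simp add: field_simps)
    then have "cmod (h y - h x) \<le> \<epsilon> / 2" if "y \<in> ball x (1 / real (Suc k)) \<inter> \<Omega>" for y
      using that k0 \<Omega>_X unfolding dist_norm[symmetric]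
      by (intro less_imp_le \<delta>(2)) (auto simp: dist_commute)
    then have "cmod ((\<integral>y. h y * of_real (w k y) \<partial>lebesgue_on \<Omega>) - h x) \<le> \<epsilon> / 2"
      using w[unfolded delta_seq_def] continuous_on_subset[OF h \<Omega>_X]
      by (intro mollifier_average[OF open_\<Omega>, of "ball x (1 / real (Suc k)) \<inter> \<Omega>"]) auto
    then show ?thesis using \<epsilon> by simp
  qed
  then show "\<exists>k0. \<forall>k\<ge>k0. norm ((\<integral>y. h y * of_real (w k y) \<partial>lebesgue_on \<Omega>) - h x) < \<epsilon>" by blast
qed

text \<open>The factor \<open>sqrt (lam n)\<close> makes the claim hold for every \<open>n\<close>:
  it vanishes exactly when \<open>e n\<close> need not be continuous.\<close>

lemma delta_seq_coeff_tendsto: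
  assumes x: "x \<in> X" and w: "delta_seq x w"
  shows "(\<lambda>k. of_real (sqrt (lam n)) * L2_inner \<Omega> (e n) (\<lambda>y. of_real (w k y)))
      \<longlonglongrightarrow> of_real (sqrt (lam n)) * e n x"
    and "(\<lambda>k. of_real (sqrt (lam n)) * L2_inner \<Omega> (\<lambda>y. of_real (w k y)) (e n))
      \<longlonglongrightarrow> of_real (sqrt (lam n)) * cnj (e n x)"
proof -
  show lim: "(\<lambda>k. of_real (sqrt (lam n)) * L2_inner \<Omega> (e n) (\<lambda>y. of_real (w k y)))
      \<longlonglongrightarrow> of_real (sqrt (lam n)) * e n x"
  proof (cases "lam n = 0")
    case False
    then show ?thesis
      using delta_seq_integral_tendsto[OF x w e_cont] by (auto simp: L2_inner_def intro: tendsto_mult_left)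
  qed simp
  show "(\<lambda>k. of_real (sqrt (lam n)) * L2_inner \<Omega> (\<lambda>y. of_real (w k y)) (e n))
      \<longlonglongrightarrow> of_real (sqrt (lam n)) * cnj (e n x)"
    using tendsto_cnj[OF lim] by (simp add: L2_inner_commute[of \<Omega> _ "e n"])
qed

text \<open>A single \<open>N\<close> for both indices and a non-strict bound, so that the estimate
  survives the two successive limits and also covers \<open>k = j\<close>.\<close>

lemma delta_seq_kernel:
  assumes x: "x \<in> X" and y: "y \<in> X" and w: "delta_seq x w" and u: "delta_seq y u" and \<epsilon>: "\<epsilon> > 0"
  obtains N where "\<And>k j. k \<ge> N \<Longrightarrow> j \<ge> N \<Longrightarrow>
    cmod (L2_inner \<Omega> (T (\<lambda>z. of_real (u k z))) (\<lambda>z. of_real (w j z)) - K (x, y)) \<le> \<epsilon>"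
proof -
  have xy: "(x, y) \<in> X \<times> X" using x y by simp
  obtain \<delta> where \<delta>: "\<delta> > 0" "\<And>p. p \<in> X \<times> X \<Longrightarrow> dist p (x, y) < \<delta> \<Longrightarrow> dist (K p) (K (x, y)) < \<epsilon>"
    using K_cont[unfolded continuous_on_iff, rule_format, OF xy \<epsilon>] by blast
  obtain N where N: "1 / real (Suc N) < \<delta> / 2" using nat_approx_posE[of "\<delta> / 2"] \<delta>(1) by auto
  have "cmod (L2_inner \<Omega> (T (\<lambda>z. of_real (u k z))) (\<lambda>z. of_real (w j z)) - K (x, y)) \<le> \<epsilon>"
    if "k \<ge> N" "j \<ge> N" for k j
  proof (rule T_mollifier_average)
    show "mollifier \<Omega> (ball y (1 / real (Suc k)) \<inter> \<Omega>) (u k)"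
      "mollifier \<Omega> (ball x (1 / real (Suc j)) \<inter> \<Omega>) (w j)"
      using u w unfolding delta_seq_def by blast+
    fix z z' assume z: "z \<in> ball x (1 / real (Suc j)) \<inter> \<Omega>" and z': "z' \<in> ball y (1 / real (Suc k)) \<inter> \<Omega>"
    have le: "1 / real (Suc k) \<le> 1 / real (Suc N)" "1 / real (Suc j) \<le> 1 / real (Suc N)"
      using that by (simp_all add: field_simps)
    have "dist (z, z') (x, y) \<le> dist z x + dist z' y"
      unfolding dist_Pair_Pair by (rule sqrt_sum_squares_le_sum) auto
    also have "\<dots> < \<delta>" using z z' le N by (auto simp: dist_commute)
    finally have "dist (K (z, z')) (K (x, y)) < \<epsilon>" using z z' \<Omega>_X by (intro \<delta>(2)) auto
    then show "cmod (K (z, z') - K (x, y)) \<le> \<epsilon>" by (simp add: dist_norm)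
  qed auto
  then show ?thesis by (rule that)
qed

lemma delta_seq_form_tendsto:
  assumes x: "x \<in> X" and w: "delta_seq x w"
  shows "(\<lambda>k. L2_inner \<Omega> (T (\<lambda>z. of_real (w k z))) (\<lambda>z. of_real (w k z))) \<longlonglongrightarrow> K (x, x)"
proof (rule LIMSEQ_I)
  fix \<epsilon> :: real assume \<epsilon>: "\<epsilon> > 0"
  obtain N where "\<And>k j. k \<ge> N \<Longrightarrow> j \<ge> N \<Longrightarrow>
    cmod (L2_inner \<Omega> (T (\<lambda>z. of_real (w k z))) (\<lambda>z. of_real (w j z)) - K (x, x)) \<le> \<epsilon> / 2"
    by (rule delta_seq_kernel[OF x x w w half_gt_zero[OF \<epsilon>]]) blast
  moreover have "\<epsilon> / 2 < \<epsilon>" using \<epsilon> by simp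
  ultimately show "\<exists>N. \<forall>k\<ge>N. norm (L2_inner \<Omega> (T (\<lambda>z. of_real (w k z))) (\<lambda>z. of_real (w k z)) - K (x, x)) < \<epsilon>"
    using le_less_trans by blast
qed

text \<open>The forms at \<open>w k\<close> converge to \<open>K (x, x)\<close> and are therefore
  bounded, although the norms of the \<open>w k\<close> are not.\<close>

lemma delta_seq_bound:
  assumes x: "x \<in> X" and w: "delta_seq x w"
  obtains C where "\<And>k N. (\<Sum>n<N. (cmod (of_real (sqrt (lam n)) * L2_inner \<Omega> (\<lambda>y. of_real (w k y)) (e n)))\<^sup>2) \<le> C"
proof -
  have "Bseq (\<lambda>k. L2_inner \<Omega> (T (\<lambda>z. of_real (w k z))) (\<lambda>z. of_real (w k z)))"
    using delta_seq_form_tendsto[OF x w] by (intro convergent_imp_Bseq convergentI)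
  then obtain C where C: "\<And>k. cmod (L2_inner \<Omega> (T (\<lambda>z. of_real (w k z))) (\<lambda>z. of_real (w k z))) \<le> C"
    unfolding Bseq_def by blast
  show ?thesis
  proof (rule that[of C])
    fix k N
    have "(\<Sum>n<N. (cmod (of_real (sqrt (lam n)) * L2_inner \<Omega> (\<lambda>y. of_real (w k y)) (e n)))\<^sup>2)
        \<le> Re (L2_inner \<Omega> (T (\<lambda>z. of_real (w k z))) (\<lambda>z. of_real (w k z)))"
      by (rule T_partial_sum_le[OF delta_seq_L2[OF w]])
    also have "\<dots> \<le> C" using C[of k] complex_Re_le_cmod order_trans by blast
    finally show "(\<Sum>n<N. (cmod (of_real (sqrt (lam n)) * L2_inner \<Omega> (\<lambda>y. of_real (w k y)) (e n)))\<^sup>2) \<le> C" .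
  qed
qed

lemma kernel_diag_nonneg:
  assumes x: "x \<in> X"
  shows "K (x, x) \<in> \<real>\<^sub>\<ge>\<^sub>0"
proof -
  obtain w where w: "delta_seq x w" using delta_seq_exists[OF x] .
  show ?thesis
  proof (rule Lim_in_closed_set[OF closed_nonneg_Reals_complex _ _ delta_seq_form_tendsto[OF x w]])
    have "L2_inner \<Omega> (T (\<lambda>z. of_real (w k z))) (\<lambda>z. of_real (w k z)) \<in> \<real>\<^sub>\<ge>\<^sub>0" for k
      using T delta_seq_L2[OF w] unfolding L2_positive_operator_def by blast
    then show "\<forall>\<^sub>F k in sequentially. L2_inner \<Omega> (T (\<lambda>z. of_real (w k z))) (\<lambda>z. of_real (w k z)) \<in> \<real>\<^sub>\<ge>\<^sub>0"
      by (intro always_eventually allI)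
  qed simp
qed

text \<open>The uniform bound on weighted coefficients passes to their limits. Square-summability is
  what lets these limits act as the fixed factor in the second weak limit.\<close>

lemma summable_eigen_square:
  assumes x: "x \<in> X"
  shows "summable (\<lambda>n. (cmod (of_real (sqrt (lam n)) * cnj (e n x)))\<^sup>2)"
proof -
  obtain w where w: "delta_seq x w" using delta_seq_exists[OF x] .
  obtain C where "\<And>k N. (\<Sum>n<N. (cmod (of_real (sqrt (lam n)) * L2_inner \<Omega> (\<lambda>y. of_real (w k y)) (e n)))\<^sup>2) \<le> C"
    by (rule delta_seq_bound[OF x w]) blast
  from l2_weak_limit_bound[OF delta_seq_coeff_tendsto(2)[OF x w] this]
  show ?thesis by (rule summableI_nonneg_bounded[rotated]) simp
qed

lemma mercer_sums:
  assumes x: "x \<in> X" and y: "y \<in> X"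
  shows "(\<lambda>n. of_real (lam n) * e n x * cnj (e n y)) sums K (x, y)"
proof -
  obtain w where w: "delta_seq x w" using delta_seq_exists[OF x] .
  obtain u where u: "delta_seq y u" using delta_seq_exists[OF y] .
  define a where "a k n = of_real (sqrt (lam n)) * L2_inner \<Omega> (\<lambda>z. of_real (u k z)) (e n)" for k n
  define \<alpha> where "\<alpha> n = of_real (sqrt (lam n)) * cnj (e n y)" for n
  define b where "b j n = of_real (sqrt (lam n)) * L2_inner \<Omega> (e n) (\<lambda>z. of_real (w j z))" for j n
  define \<beta> where "\<beta> n = of_real (sqrt (lam n)) * e n x" for n
  have a_lim: "(\<lambda>k. a k n) \<longlonglongrightarrow> \<alpha> n" for n
    unfolding a_def \<alpha>_def by (rule delta_seq_coeff_tendsto(2)[OF y u])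
  have b_lim: "(\<lambda>j. b j n) \<longlonglongrightarrow> \<beta> n" for n
    unfolding b_def \<beta>_def by (rule delta_seq_coeff_tendsto(1)[OF x w])
  obtain Ca where a_bound: "\<And>k N. (\<Sum>n<N. (cmod (a k n))\<^sup>2) \<le> Ca"
    unfolding a_def by (rule delta_seq_bound[OF y u]) blast
  obtain Cb where Cb: "\<And>k N. (\<Sum>n<N. (cmod (of_real (sqrt (lam n)) * L2_inner \<Omega> (\<lambda>z. of_real (w k z)) (e n)))\<^sup>2) \<le> Cb"
    by (rule delta_seq_bound[OF x w]) blast
  have b_bound: "(\<Sum>n<N. (cmod (b j n))\<^sup>2) \<le> Cb" for j N
    using Cb[where k = j and N = N] unfolding b_def norm_mult L2_inner_commute[of \<Omega> "e _"] complex_mod_cnj .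
  have b_sum: "summable (\<lambda>n. (cmod (b j n))\<^sup>2)" for j
    by (rule summableI_nonneg_bounded[where x = Cb]) (use b_bound in auto)
  have \<alpha>_sum: "summable (\<lambda>n. (cmod (\<alpha> n))\<^sup>2)"
    unfolding \<alpha>_def by (rule summable_eigen_square[OF y])
  have \<beta>_sum: "summable (\<lambda>n. (cmod (\<beta> n))\<^sup>2)"
    using summable_eigen_square[OF x] by (simp add: \<beta>_def norm_mult)
  have T_ab: "L2_inner \<Omega> (T (\<lambda>z. of_real (u k z))) (\<lambda>z. of_real (w j z)) = (\<Sum>n. a k n * b j n)" for k j
    using T_expansion[OF delta_seq_L2[OF u] delta_seq_L2[OF w]] unfolding a_def b_def by (rule sums_unique)
  have lim1: "(\<lambda>k. \<Sum>n. a k n * b j n) \<longlonglongrightarrow> (\<Sum>n. \<alpha> n * b j n)" for j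
    by (rule l2_weak_limit[OF a_lim a_bound b_sum])
  \<comment> \<open>The roles are exchanged: \<open>\<alpha>\<close> is now the fixed
    square-summable factor and \<open>b j\<close> the weakly convergent one.\<close>
  have lim2: "(\<lambda>j. \<Sum>n. \<alpha> n * b j n) \<longlonglongrightarrow> (\<Sum>n. \<alpha> n * \<beta> n)"
    using l2_weak_limit[OF b_lim b_bound \<alpha>_sum] by (simp add: mult.commute)
  \<comment> \<open>The joint estimate is passed to the limit
    \<open>k \<rightarrow> \<infinity>\<close> for each fixed \<open>j \<ge> N\<close>, then to
    \<open>j \<rightarrow> \<infinity>\<close>; that \<open>N\<close> depends on neither index makes
    this possible.\<close>
  have close: "cmod ((\<Sum>n. \<alpha> n * \<beta> n) - K (x, y)) \<le> \<epsilon>" if \<epsilon>: "\<epsilon> > 0" for \<epsilon>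
  proof -
    obtain N where N: "\<And>k j. k \<ge> N \<Longrightarrow> j \<ge> N \<Longrightarrow> cmod ((\<Sum>n. a k n * b j n) - K (x, y)) \<le> \<epsilon>"
      by (rule delta_seq_kernel[OF x y w u \<epsilon>, unfolded T_ab]) blast
    have "cmod ((\<Sum>n. \<alpha> n * b j n) - K (x, y)) \<le> \<epsilon>" if "j \<ge> N" for j
      using N that by (intro LIMSEQ_le_const2[OF tendsto_norm[OF tendsto_diff[OF lim1 tendsto_const]]]) blast
    then show ?thesis
      by (intro LIMSEQ_le_const2[OF tendsto_norm[OF tendsto_diff[OF lim2 tendsto_const]]]) blast
  qed
  have "cmod ((\<Sum>n. \<alpha> n * \<beta> n) - K (x, y)) \<le> 0"
    by (rule field_le_epsilon) (use close in simp)
  then have "(\<Sum>n. \<alpha> n * \<beta> n) = K (x, y)" by simp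
  moreover have "\<alpha> n * \<beta> n = of_real (lam n) * e n x * cnj (e n y)" for n
  proof -
    have "\<alpha> n * \<beta> n = of_real (sqrt (lam n) * sqrt (lam n)) * e n x * cnj (e n y)"
      unfolding \<alpha>_def \<beta>_def of_real_mult by (simp only: mult_ac)
    also have "sqrt (lam n) * sqrt (lam n) = lam n" using lam_nonneg by simp
    finally show ?thesis .
  qed
  ultimately show ?thesis
    using summable_sums[OF summable_l2_mult[OF \<alpha>_sum \<beta>_sum]] by simp
qed

lemma mercer_diag_sums:
  assumes x: "x \<in> X"
  shows "(\<lambda>n. lam n * (cmod (e n x))\<^sup>2) sums Re (K (x, x))"
proof -
  have "of_real (lam n) * e n x * cnj (e n x) = complex_of_real (lam n * (cmod (e n x))\<^sup>2)" for n
    by (simp add: mult.assoc flip: complex_norm_square)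
  from sums_Re[OF mercer_sums[OF x x, unfolded this]] show ?thesis by (simp only: Re_complex_of_real)
qed

lemma eigen_cont: "continuous_on X (\<lambda>x. of_real (lam n) * e n x)"
  by (cases "lam n = 0") (auto intro!: continuous_intros e_cont)

lemma eigen_tensor_cont: "continuous_on (X \<times> X) (\<lambda>(x, y). of_real (lam n) * (e n x * cnj (e n y)))"
proof (cases "lam n = 0")
  case False
  have "continuous_on (X \<times> X) (\<lambda>p. e n (fst p))" "continuous_on (X \<times> X) (\<lambda>p. e n (snd p))"
    by (rule continuous_on_compose2[OF e_cont[OF False]]; auto intro!: continuous_intros)+
  then show ?thesis unfolding case_prod_unfold by (intro continuous_intros)
qed (simp add: case_prod_unfold)

lemma mercer_diag_uniform:
  assumes A: "compact A" "A \<subseteq> X"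
  shows "uniform_limit A (\<lambda>N x. \<Sum>n<N. lam n * (cmod (e n x))\<^sup>2) (\<lambda>x. Re (K (x, x))) sequentially"
proof (rule Dini_uniform_limit[OF A(1)])
  show "continuous_on A (\<lambda>x. \<Sum>n<N. lam n * (cmod (e n x))\<^sup>2)" for N
  proof (rule continuous_on_sum)
    fix n
    show "continuous_on A (\<lambda>x. lam n * (cmod (e n x))\<^sup>2)"
      using e_cont[of n] A(2) by (cases "lam n = 0") (auto intro!: continuous_intros intro: continuous_on_subset)
  qed
  show "continuous_on A (\<lambda>x. Re (K (x, x)))"
    using A(2) by (intro continuous_on_Re continuous_on_compose2[OF K_cont] continuous_intros) auto
  show "incseq (\<lambda>N. \<Sum>n<N. lam n * (cmod (e n x))\<^sup>2)" for x
    by (intro incseq_SucI) (simp add: lam_nonneg)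
  show "(\<lambda>N. \<Sum>n<N. lam n * (cmod (e n x))\<^sup>2) \<longlonglongrightarrow> Re (K (x, x))" if "x \<in> A" for x
    using mercer_diag_sums that A(2) unfolding sums_def by blast
qed

text \<open>Termwise \<open>2 * cmod (e n x) * cmod (e n y)\<close> is at most the sum of the
  squares, so the uniform Cauchy property of the diagonal series dominates.\<close>

lemma mercer_abs_uniform:
  assumes C: "compact C" "C \<subseteq> X \<times> X"
  shows "uniformly_convergent_on C (\<lambda>N (x, y). \<Sum>n<N. lam n * cmod (e n x * cnj (e n y)))"
proof -
  \<comment> \<open>A compact set in \<open>X\<close> containing both coordinates of every point of
    \<open>C\<close>; the diagonal result is applied on it.\<close>
  let ?A = "fst ` C \<union> snd ` C"
  let ?d = "\<lambda>x n. lam n * (cmod (e n x))\<^sup>2"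
  let ?f = "\<lambda>N (x, y). \<Sum>n<N. lam n * cmod (e n x * cnj (e n y))"
  have A: "compact ?A" "?A \<subseteq> X"
    using C by (auto intro!: compact_Un compact_continuous_image continuous_intros)
  have unif: "uniformly_Cauchy_on ?A (\<lambda>N x. \<Sum>n<N. ?d x n)"
    using mercer_diag_uniform[OF A] by (intro uniformly_convergent_Cauchy uniformly_convergentI)
  have diff: "(\<Sum>n<M. f n) - (\<Sum>n<N. f n) = (\<Sum>n\<in>{N..<M}. f n)" if "N \<le> M" for f :: "nat \<Rightarrow> real" and N M
    using that sum_diff_nat_ivl[of 0 N M f] by (simp add: atLeast0LessThan)
  have "uniformly_Cauchy_on C ?f"
    unfolding uniformly_Cauchy_on_def
  proof (intro allI impI)
    fix \<epsilon> :: real assume "\<epsilon> > 0"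
    then obtain N where N: "\<And>x m n. x \<in> ?A \<Longrightarrow> m \<ge> N \<Longrightarrow> n \<ge> N \<Longrightarrow>
        dist (\<Sum>k<m. ?d x k) (\<Sum>k<n. ?d x k) < \<epsilon>"
      using unif unfolding uniformly_Cauchy_on_def by meson
    have *: "dist (?f m p) (?f n p) < \<epsilon>" if p: "p \<in> C" and mn: "n \<ge> N" "n \<le> m" for p m n
    proof -
      obtain x y where xy: "p = (x, y)" by (cases p)
      then have xA: "x \<in> ?A" "y \<in> ?A" using p by (auto intro: rev_image_eqI)
      have small: "(\<Sum>k\<in>{n..<m}. ?d z k) < \<epsilon>" if "z \<in> ?A" for z
        using N[OF that, of m n] mn diff[OF mn(2), of "?d z"] by (simp add: dist_real_def)
      have "lam k * cmod (e k x * cnj (e k y)) \<le> (?d x k + ?d y k) / 2" for k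
        using mult_left_mono[OF sum_squares_bound[of "cmod (e k x)" "cmod (e k y)"] lam_nonneg[of k]]
        by (simp add: norm_mult algebra_simps)
      then have "(\<Sum>k\<in>{n..<m}. lam k * cmod (e k x * cnj (e k y))) \<le> (\<Sum>k\<in>{n..<m}. (?d x k + ?d y k) / 2)"
        by (intro sum_mono)
      also have "\<dots> = ((\<Sum>k\<in>{n..<m}. ?d x k) + (\<Sum>k\<in>{n..<m}. ?d y k)) / 2"
        by (simp add: sum.distrib flip: sum_divide_distrib)
      also have "\<dots> < \<epsilon>" using small[OF xA(1)] small[OF xA(2)] by simp
      finally have "(\<Sum>k\<in>{n..<m}. lam k * cmod (e k x * cnj (e k y))) < \<epsilon>" .
      moreover have "0 \<le> (\<Sum>k\<in>{n..<m}. lam k * cmod (e k x * cnj (e k y)))"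
        by (intro sum_nonneg mult_nonneg_nonneg lam_nonneg) auto
      ultimately show ?thesis
        using diff[OF mn(2), of "\<lambda>k. lam k * cmod (e k x * cnj (e k y))"] xy by (simp add: dist_real_def)
    qed
    show "\<exists>N. \<forall>p\<in>C. \<forall>m\<ge>N. \<forall>n\<ge>N. dist (?f m p) (?f n p) < \<epsilon>"
    proof (intro exI[of _ N] ballI allI impI)
      fix p m n assume "p \<in> C" "m \<ge> N" "n \<ge> N"
      then show "dist (?f m p) (?f n p) < \<epsilon>"
        using *[of p n m] *[of p m n] by (cases "n \<le> m") (auto simp: dist_commute)
    qed
  qed
  then show ?thesis by (rule Cauchy_uniformly_convergent)
qed

text \<open>The diagonal series has nonnegative terms, so it may be integrated termwise, and each
  \<open>e n\<close> has norm one.\<close>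

lemma mercer_trace:
  "(\<Sum>n. ennreal (lam n)) = (\<integral>\<^sup>+x. ennreal (Re (K (x, x))) \<partial>lebesgue_on \<Omega>)"
proof -
  note [measurable] = eL
  have "(\<integral>\<^sup>+x. ennreal (Re (K (x, x))) \<partial>lebesgue_on \<Omega>)
      = (\<integral>\<^sup>+x. (\<Sum>n. ennreal (lam n * (cmod (e n x))\<^sup>2)) \<partial>lebesgue_on \<Omega>)"
  proof (rule nn_integral_cong)
    fix x assume "x \<in> space (lebesgue_on \<Omega>)"
    then have "x \<in> X" using \<Omega>_X by auto
    from mercer_diag_sums[OF this]
    show "ennreal (Re (K (x, x))) = (\<Sum>n. ennreal (lam n * (cmod (e n x))\<^sup>2))"
      by (intro suminf_ennreal_eq[symmetric]) (simp add: lam_nonneg)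
  qed
  also have "\<dots> = (\<Sum>n. \<integral>\<^sup>+x. ennreal (lam n * (cmod (e n x))\<^sup>2) \<partial>lebesgue_on \<Omega>)"
    by (rule nn_integral_suminf) measurable
  also have "\<dots> = (\<Sum>n. ennreal (lam n))"
  proof (rule suminf_cong)
    fix n
    have "(L2_norm \<Omega> (e n))\<^sup>2 = 1"
      using L2_orthonormalD(2)[OF orthonormal_basis_imp_orthonormal[OF basis] UNIV_I UNIV_I, of n n]
      by (simp add: L2_inner_self flip: of_real_power)
    then show "(\<integral>\<^sup>+x. ennreal (lam n * (cmod (e n x))\<^sup>2) \<partial>lebesgue_on \<Omega>) = ennreal (lam n)"
      by (simp add: ennreal_mult lam_nonneg nn_integral_cmult nn_integral_L2_norm eL)
  qed
  finally show ?thesis by simp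
qed

lemma mercer_trace_class:
  "L2_trace_class \<Omega> T \<longleftrightarrow> (\<integral>\<^sup>+x. ennreal (Re (K (x, x))) \<partial>lebesgue_on \<Omega>) < \<infinity>"
proof -
  have "summable lam \<longleftrightarrow> (\<Sum>n. ennreal (lam n)) < \<infinity>"
  proof
    assume "summable lam"
    from suminf_ennreal2[OF lam_nonneg this] show "(\<Sum>n. ennreal (lam n)) < \<infinity>" by simp
  next
    assume "(\<Sum>n. ennreal (lam n)) < \<infinity>"
    then show "summable lam" by (intro summable_suminf_not_top lam_nonneg) simp
  qed
  then show ?thesis
    unfolding L2_trace_class_iff[OF T basis lam_nonneg eigen] mercer_trace .
qed

end

section \<open>Passing to continuous eigenfunctions\<close>

text \<open>Inner products ignore null sets; totality of the new family follows from Parseval for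
  the old one.\<close>

lemma orthonormal_basis_cong_ae:
  assumes e: "orthonormal_basis \<Omega> e" and e': "\<And>n. e' n \<in> L2 \<Omega>" and ae: "\<And>n. ae_eq \<Omega> (e n) (e' n)"
  shows "orthonormal_basis \<Omega> e'"
proof (rule total_orthonormal_imp_basis)
  note on = orthonormal_basis_imp_orthonormal[OF e]
  note eL = L2_orthonormalD(1)[OF on UNIV_I]
  have inner: "L2_inner \<Omega> u (e' n) = L2_inner \<Omega> u (e n)" if "u \<in> L2 \<Omega>" for u n
    using L2_inner_cong_ae(2)[OF eL e' ae that] by simp
  have inner': "L2_inner \<Omega> (e' n) u = L2_inner \<Omega> (e n) u" if "u \<in> L2 \<Omega>" for u n
    using L2_inner_cong_ae(1)[OF eL e' ae that] by simp
  show "L2_orthonormal \<Omega> UNIV e'"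
    using L2_orthonormalD(2)[OF on UNIV_I UNIV_I] e'
    by (simp add: L2_orthonormal_def inner inner' eL)
  fix u assume u: "u \<in> L2 \<Omega>" and "\<And>n. L2_inner \<Omega> u (e' n) = 0"
  then have "(\<lambda>n. 0) sums (L2_norm \<Omega> u)\<^sup>2"
    using orthonormal_basis_Parseval[OF e u] by (simp add: inner[OF u])
  from sums_unique2[OF sums_zero this] show "L2_norm \<Omega> u = 0" by simp
qed

theorem theorem5p2:
  fixes \<Omega> X :: "(real ^ 'd) set"
    and K :: "(real ^ 'd) \<times> (real ^ 'd) \<Rightarrow> complex"
    and T :: "(real ^ 'd \<Rightarrow> complex) \<Rightarrow> (real ^ 'd \<Rightarrow> complex)"
  assumes "open \<Omega>" and "\<Omega> \<noteq> {}"
    and "\<Omega> \<subseteq> X" and "X \<subseteq> closure \<Omega>"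
    and "continuous_on (X \<times> X) K"
    and "L2_compact_operator \<Omega> T" and "L2_positive_operator \<Omega> T"
    and "\<forall>u\<in>L2 \<Omega>. \<exists>g. continuous_version \<Omega> X (T u) g"
    and "\<forall>u\<in>C_c \<Omega>. \<forall>g. continuous_version \<Omega> X (T u) g \<longrightarrow>
           (\<forall>x\<in>\<Omega>. g x = (\<integral>y. K (x, y) * u y \<partial>lebesgue_on \<Omega>))"
  shows "\<exists>(e :: nat \<Rightarrow> real ^ 'd \<Rightarrow> complex) (lam :: nat \<Rightarrow> real).
      orthonormal_basis \<Omega> e \<and>
      (\<forall>n. 0 \<le> lam n) \<and>
      (\<forall>n. continuous_on X (\<lambda>x. of_real (lam n) * e n x)) \<and>
      (\<forall>n. ae_eq \<Omega> (T (e n)) (\<lambda>x. of_real (lam n) * e n x)) \<and>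
      (\<forall>n. lam n \<noteq> 0 \<longrightarrow> continuous_on X (e n)) \<and>
      (\<forall>n. continuous_on (X \<times> X) (\<lambda>(x, y). of_real (lam n) * (e n x * cnj (e n y)))) \<and>
      (\<forall>x\<in>X. \<forall>y\<in>X. (\<lambda>n. of_real (lam n) * e n x * cnj (e n y)) sums K (x, y)) \<and>
      (\<forall>C. compact C \<and> C \<subseteq> X \<times> X \<longrightarrow>
         uniformly_convergent_on C (\<lambda>N (x, y). \<Sum>n<N. lam n * cmod (e n x * cnj (e n y)))) \<and>
      (\<forall>x\<in>X. K (x, x) \<in> \<real>\<^sub>\<ge>\<^sub>0) \<and>
      (\<Sum>n. ennreal (lam n)) = (\<integral>\<^sup>+x. ennreal (Re (K (x, x))) \<partial>lebesgue_on \<Omega>) \<and>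
      (L2_trace_class \<Omega> T \<longleftrightarrow> (\<integral>\<^sup>+x. ennreal (Re (K (x, x))) \<partial>lebesgue_on \<Omega>) < \<infinity>)"
proof -
  obtain e0 :: "nat \<Rightarrow> real ^ 'd \<Rightarrow> complex" and lam :: "nat \<Rightarrow> real"
    where e0: "orthonormal_basis \<Omega> e0" and lam: "\<And>n. 0 \<le> lam n"
      and eig0: "\<And>n. ae_eq \<Omega> (T (e0 n)) (\<lambda>x. of_real (lam n) * e0 n x)"
    using L2_spectral_theorem_compact_positive[OF assms(1,2,6,7)] by metis
  note e0L = L2_orthonormalD(1)[OF orthonormal_basis_imp_orthonormal[OF e0] UNIV_I]
  have "\<forall>n. \<exists>g. continuous_version \<Omega> X (T (e0 n)) g" using assms(8) e0L by blast
  then obtain g where g: "\<And>n. continuous_version \<Omega> X (T (e0 n)) (g n)" by metis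
  then have g_cont: "continuous_on X (g n)" and g_ae: "ae_eq \<Omega> (T (e0 n)) (g n)" for n
    by (auto simp: continuous_version_def)
  \<comment> \<open>Since \<open>T (e0 n) = lam n * e0 n\<close> has the continuous version
    \<open>g n\<close>, dividing by a nonzero \<open>lam n\<close> gives a continuous representative
    of \<open>e0 n\<close>. For \<open>lam n = 0\<close> there is nothing to divide, and
    \<open>e0 n\<close> is kept.\<close>
  define e where "e n = (if lam n = 0 then e0 n else (\<lambda>x. g n x / of_real (lam n)))" for n
  have e_ae: "ae_eq \<Omega> (e0 n) (e n)" for n
  proof (cases "lam n = 0")
    case False
    then show ?thesis
      using g_ae[of n] eig0[of n] unfolding ae_eq_def
      by (auto simp: e_def elim!: eventually_elim2)
  qed (simp add: e_def ae_eq_def)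
  have e_cont: "continuous_on X (e n)" if "lam n \<noteq> 0" for n
    using that g_cont[of n] by (auto simp: e_def intro!: continuous_intros)
  have eL: "e n \<in> L2 \<Omega>" for n
  proof (rule L2_I)
    show meas: "e n \<in> borel_measurable (lebesgue_on \<Omega>)"
    proof (cases "lam n = 0")
      case False
      then show ?thesis
        using e_cont[OF False] assms(1,3)
        by (intro continuous_imp_measurable_on_sets_lebesgue) (auto intro: continuous_on_subset)
    qed (simp add: e_def L2_measurable[OF e0L])
    have "AE x in lebesgue_on \<Omega>. (cmod (e0 n x))\<^sup>2 = (cmod (e n x))\<^sup>2"
      using e_ae[of n] unfolding ae_eq_def by eventually_elim simp
    from integrable_cong_AE_imp[OF L2_integrable_square[OF e0L] _ this] meas
    show "integrable (lebesgue_on \<Omega>) (\<lambda>x. (cmod (e n x))\<^sup>2)" by simp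
  qed
  have basis: "orthonormal_basis \<Omega> e" by (rule orthonormal_basis_cong_ae[OF e0 eL e_ae])
  have eig: "ae_eq \<Omega> (T (e n)) (\<lambda>x. of_real (lam n) * e n x)" for n
    using L2_positive_operatorD(5)[OF assms(7) e0L eL e_ae, of n] eig0[of n] e_ae[of n]
    unfolding ae_eq_def by eventually_elim simp
  interpret mercer \<Omega> X K T e lam
  proof (rule mercer.intro)
    show "\<exists>g. continuous_version \<Omega> X (T u) g" if "u \<in> L2 \<Omega>" for u
      using assms(8) that by blast
    show "g x = (\<integral>y. K (x, y) * u y \<partial>lebesgue_on \<Omega>)"
      if "u \<in> C_c \<Omega>" "continuous_version \<Omega> X (T u) g" "x \<in> \<Omega>" for u g x
      using assms(9) that by blast
  qed (use assms(1,3,4,5,7) basis lam eig e_cont in blast)+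
  show ?thesis
    using basis lam eig e_cont eigen_cont eigen_tensor_cont mercer_sums mercer_abs_uniform
      kernel_diag_nonneg mercer_trace mercer_trace_class
    by (intro exI[of _ e] exI[of _ lam]) blast
qed

end
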